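(* Let $d\ge1$, $m\in\{0,1\}$, $C=\mathbb{R}^m_+\times\mathbb{R}^{d-m}$ with $\mathbb{R}_+=(0,\infty)$, and $K=(-1,1)^d$, so that $|x|_{K^\circ}=\sum_{i=1}^d|x_i|$. Let $\mathfrak{M}$ be the family of functions $f\in W^{\mathbf I,\nabla}_{\infty,\infty}(C)$ such that $\big\||\nabla\partial_{\mathbf I}f|_{K^\circ}\big\|_{L_\infty(C)}\le1$. Let $X=Y=L_\infty(C)$ and $\mathcal{L}=\mathcal{L}(X,Y)$. Then for all $\delta>0$ and $N>0$ $$\mathcal{E}_\delta(\partial_{\mathbf I},\mathfrak{M},\mathcal{L})=\Omega(\partial_{\mathbf I},\mathfrak{M};\delta)=\big(2^m(d+1)\delta\big)^{\frac1{d+1}}$$ and $$E_N(\partial_{\mathbf I},\mathfrak{M})=\frac d{d+1}\left(\frac{2^m}N\right)^{\frac1d}.$$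
   Context: For a locally integrable function $f$, $\partial_{\mathbf I}f=\dfrac{\partial^d f}{\partial x_1\cdots\partial x_d}$, where the derivatives are distributional; $\nabla$ is the distributional gradient. $W^{1,\infty}(C)$ is the space of functions $g:C\to\mathbb{R}$ such that $g$ and all its first-order distributional partial derivatives belong to $L_\infty(C)$. $W^{\mathbf I,\nabla}_{\infty,\infty}(C)$ is the space of functions $f\in L_\infty(C)$ such that $\partial_{\mathbf I}f\in W^{1,\infty}(C)$. $\mathcal{L}(X,Y)$ is the space of linear operators $S:X\to Y$ with $\|S\|=\sup_{\|x\|_X\le1}\|Sx\|_Y<\infty$. For an operator $A$ with domain $D_A\subset X$, values in $Y$, and a class $\mathfrak{M}\subset D_A$: - modulus of continuity: $\Omega(A,\mathfrak{M};\delta)=\sup\{\|Ax\|_Y: x\in\mathfrak{M},\ \|x\|_X\le\delta\}$; - Stechkin problem of best approximation by bounded operators: $E_N(A,\mathfrak{M})=\inf\big\{\sup_{x\in\mathfrak{M}}\|Ax-Sx\|_Y: S\in\mathcal{L}(X,Y),\ \|S\|\le N\big\}$; - optimal recovery from elements known with error $\delta$: $\mathcal{E}_\delta(A,\mathfrak{M},\mathcal{L}(X,Y))=\inf_{S\in\mathcal{L}(X,Y)}\sup\{\|Ax-S\eta\|_Y: x\in\mathfrak{M},\ \eta\in X,\ \|x-\eta\|_X\le\delta\}$. *)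

theory Defs
  imports "HOL-Probability.Essential_Supremum"
begin

text \<open>
  Elements of \<open>L\<^sub>\<infinity>(M)\<close> are handled through representatives: measurable functions with finite
  essential supremum, two of them being identified when they agree almost everywhere. Norms
  and suprema live in the extended reals, so that unbounded suprema have the value \<open>\<infinity>\<close>.
\<close>

definition Linf_norm :: "'a measure \<Rightarrow> ('a \<Rightarrow> real) \<Rightarrow> ereal" where
  "Linf_norm M f = esssup M (\<lambda>x. ereal \<bar>f x\<bar>)"

definition Linf :: "'a measure \<Rightarrow> ('a \<Rightarrow> real) set" where
  "Linf M = {f \<in> borel_measurable M. Linf_norm M f < \<infinity>}"

definition op_norm :: "'a measure \<Rightarrow> (('a \<Rightarrow> real) \<Rightarrow> ('a \<Rightarrow> real)) \<Rightarrow> ereal" where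
  "op_norm M S = (SUP f\<in>{f \<in> Linf M. Linf_norm M f \<le> 1}. Linf_norm M (S f))"

text \<open>
  The bounded linear operators from \<open>L\<^sub>\<infinity>(M)\<close> to itself. The second conjunct says that \<open>S\<close> is
  well defined on almost-everywhere classes; linearity is an identity between classes.
\<close>

definition bounded_ops :: "'a measure \<Rightarrow> (('a \<Rightarrow> real) \<Rightarrow> ('a \<Rightarrow> real)) set" where
  "bounded_ops M = {S.
     (\<forall>f\<in>Linf M. S f \<in> Linf M) \<and>
     (\<forall>f\<in>Linf M. \<forall>g\<in>Linf M. (AE x in M. f x = g x) \<longrightarrow> (AE x in M. S f x = S g x)) \<and>
     (\<forall>f\<in>Linf M. \<forall>g\<in>Linf M. AE x in M. S (\<lambda>y. f y + g y) x = S f x + S g x) \<and>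
     (\<forall>c. \<forall>f\<in>Linf M. AE x in M. S (\<lambda>y. c * f y) x = c * S f x) \<and>
     op_norm M S < \<infinity>}"

definition modulus_of_continuity ::
  "'a measure \<Rightarrow> (('a \<Rightarrow> real) \<Rightarrow> ('a \<Rightarrow> real)) \<Rightarrow> ('a \<Rightarrow> real) set \<Rightarrow> real \<Rightarrow> ereal" where
  "modulus_of_continuity M A \<MM> \<delta> =
     (SUP f\<in>{f \<in> \<MM>. Linf_norm M f \<le> ereal \<delta>}. Linf_norm M (A f))"

definition best_approximation ::
  "'a measure \<Rightarrow> (('a \<Rightarrow> real) \<Rightarrow> ('a \<Rightarrow> real)) \<Rightarrow> ('a \<Rightarrow> real) set \<Rightarrow> real \<Rightarrow> ereal" where
  "best_approximation M A \<MM> N =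
     (INF S\<in>{S \<in> bounded_ops M. op_norm M S \<le> ereal N}.
        SUP f\<in>\<MM>. Linf_norm M (\<lambda>x. A f x - S f x))"

definition optimal_recovery ::
  "'a measure \<Rightarrow> (('a \<Rightarrow> real) \<Rightarrow> ('a \<Rightarrow> real)) \<Rightarrow> ('a \<Rightarrow> real) set
     \<Rightarrow> (('a \<Rightarrow> real) \<Rightarrow> ('a \<Rightarrow> real)) set \<Rightarrow> real \<Rightarrow> ereal" where
  "optimal_recovery M A \<MM> \<L> \<delta> =
     (INF S\<in>\<L>.
        SUP (f, \<eta>)\<in>{(f, \<eta>). f \<in> \<MM> \<and> \<eta> \<in> Linf M \<and> Linf_norm M (\<lambda>x. f x - \<eta> x) \<le> ereal \<delta>}.
          Linf_norm M (\<lambda>x. A f x - S \<eta> x))"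

definition partial_deriv :: "'n::finite \<Rightarrow> (real^'n \<Rightarrow> real) \<Rightarrow> (real^'n \<Rightarrow> real)" where
  "partial_deriv i \<phi> = (\<lambda>x. frechet_derivative \<phi> (at x) (axis i 1))"

definition iterated_partial_deriv ::
  "'n::finite list \<Rightarrow> (real^'n \<Rightarrow> real) \<Rightarrow> (real^'n \<Rightarrow> real)" where
  "iterated_partial_deriv is \<phi> = foldr partial_deriv is \<phi>"

text \<open>
  Requiring every iterated partial derivative to be differentiable is the same as \<open>C\<^sup>\<infinity>\<close>.
\<close>

definition smooth_function :: "(real^'n::finite \<Rightarrow> real) \<Rightarrow> bool" where
  "smooth_function \<phi> \<longleftrightarrow> (\<forall>is x. iterated_partial_deriv is \<phi> differentiable (at x))"

definition test_functions :: "(real^'n::finite) set \<Rightarrow> (real^'n \<Rightarrow> real) set" where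
  "test_functions C = {\<phi>. smooth_function \<phi> \<and>
     compact (closure {x. \<phi> x \<noteq> 0}) \<and> closure {x. \<phi> x \<noteq> 0} \<subseteq> C}"

definition locally_integrable :: "(real^'n::finite) set \<Rightarrow> (real^'n \<Rightarrow> real) \<Rightarrow> bool" where
  "locally_integrable C f \<longleftrightarrow> (\<forall>K. compact K \<and> K \<subseteq> C \<longrightarrow> integrable (lebesgue_on K) f)"

definition has_distr_deriv ::
  "(real^'n::finite) set \<Rightarrow> 'n list \<Rightarrow> (real^'n \<Rightarrow> real) \<Rightarrow> (real^'n \<Rightarrow> real) \<Rightarrow> bool" where
  "has_distr_deriv C is f g \<longleftrightarrow> locally_integrable C f \<and> locally_integrable C g \<and>
     (\<forall>\<phi>\<in>test_functions C.
        (LINT x|lebesgue_on C. f x * iterated_partial_deriv is \<phi> x) =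
        (-1) ^ length is * (LINT x|lebesgue_on C. g x * \<phi> x))"

text \<open>
  A representative of the distributional derivative, which is unique up to null sets when
  \<open>C\<close> is open. It is meaningful only if the derivative is a locally integrable function.
\<close>

definition distr_deriv ::
  "(real^'n::finite) set \<Rightarrow> 'n list \<Rightarrow> (real^'n \<Rightarrow> real) \<Rightarrow> (real^'n \<Rightarrow> real)" where
  "distr_deriv C is f = (SOME g. has_distr_deriv C is f g)"

text \<open>
  A list containing each coordinate exactly once, so that \<open>distr_deriv C all_coords\<close> is
  \<open>\<partial>\<^sup>d / \<partial>x\<^sub>1 \<dots> \<partial>x\<^sub>d\<close>. The order of the list does not matter, because the partial
  derivatives of a test function commute.
\<close>

definition all_coords :: "'n::finite list" where
  "all_coords = (SOME is. distinct is \<and> set is = UNIV)"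

lemma all_coords: "distinct (all_coords :: 'n::finite list)" "set (all_coords :: 'n list) = UNIV"
proof -
  have "\<exists>is::'n list. distinct is \<and> set is = UNIV"
    using finite_distinct_list[of "UNIV :: 'n set"] by auto
  then have "distinct (all_coords :: 'n list) \<and> set (all_coords :: 'n list) = UNIV"
    unfolding all_coords_def by (rule someI_ex)
  then show "distinct (all_coords :: 'n list)" "set (all_coords :: 'n list) = UNIV"
    by auto
qed

abbreviation mixed_deriv ::
  "(real^'n::finite) set \<Rightarrow> (real^'n \<Rightarrow> real) \<Rightarrow> (real^'n \<Rightarrow> real)" where
  "mixed_deriv C \<equiv> distr_deriv C all_coords"

definition distr_gradient ::
  "(real^'n::finite) set \<Rightarrow> (real^'n \<Rightarrow> real) \<Rightarrow> (real^'n \<Rightarrow> real^'n)" where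
  "distr_gradient C g = (\<lambda>x. \<chi> i. distr_deriv C [i] g x)"

definition W1inf :: "(real^'n::finite) set \<Rightarrow> (real^'n \<Rightarrow> real) set" where
  "W1inf C = {g \<in> Linf (lebesgue_on C).
     \<forall>i. \<exists>h\<in>Linf (lebesgue_on C). has_distr_deriv C [i] g h}"

definition W_mixed_grad :: "(real^'n::finite) set \<Rightarrow> (real^'n \<Rightarrow> real) set" where
  "W_mixed_grad C = {f \<in> Linf (lebesgue_on C).
     \<exists>g\<in>W1inf C. has_distr_deriv C all_coords f g}"

definition polar_set :: "'a::real_inner set \<Rightarrow> 'a set" where
  "polar_set K = {y. \<forall>x\<in>K. x \<bullet> y \<le> 1}"

text \<open>The Minkowski functional of \<open>B\<close>, written \<open>|x|\<^sub>B\<close> in the literature.\<close>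

definition set_gauge :: "'a::real_vector set \<Rightarrow> 'a \<Rightarrow> real" where
  "set_gauge B x = Inf {t. t > 0 \<and> (\<exists>b\<in>B. x = t *\<^sub>R b)}"

definition unit_cube :: "(real^'n::finite) set" where
  "unit_cube = {x. \<forall>i. x $ i \<in> {-1<..<1}}"

lemma polar_unit_cube:
  "polar_set (unit_cube :: (real^'n::finite) set) = {y. (\<Sum>i\<in>UNIV. \<bar>y $ i\<bar>) \<le> 1}"
proof (intro set_eqI iffI)
  fix y :: "real^'n" assume y: "y \<in> polar_set unit_cube"
  have le: "s * (\<Sum>i\<in>UNIV. \<bar>y $ i\<bar>) \<le> 1" if s: "0 < s" "s < 1" for s
  proof -
    have "(\<chi> i. s * sgn (y $ i)) \<in> (unit_cube :: (real^'n) set)"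
      using s by (auto simp: unit_cube_def sgn_if)
    then have "(\<chi> i. s * sgn (y $ i)) \<bullet> y \<le> 1"
      using y by (auto simp: polar_set_def)
    also have "(\<chi> i. s * sgn (y $ i)) \<bullet> y = s * (\<Sum>i\<in>UNIV. \<bar>y $ i\<bar>)"
      by (auto simp: inner_vec_def sum_distrib_left sgn_if intro!: sum.cong)
    finally show ?thesis .
  qed
  have "(\<Sum>i\<in>UNIV. \<bar>y $ i\<bar>) \<le> 1"
    by (rule field_le_mult_one_interval) (rule le)
  then show "y \<in> {y. (\<Sum>i\<in>UNIV. \<bar>y $ i\<bar>) \<le> 1}" by simp
next
  fix y :: "real^'n" assume y: "y \<in> {y. (\<Sum>i\<in>UNIV. \<bar>y $ i\<bar>) \<le> 1}"
  have "x \<bullet> y \<le> 1" if "x \<in> unit_cube" for x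
  proof -
    have le1: "\<bar>x $ i\<bar> \<le> 1" for i
    proof -
      have "x $ i \<in> {-1<..<1}" using that by (simp add: unit_cube_def)
      then show ?thesis by (simp add: abs_le_iff)
    qed
    then have "x $ i * y $ i \<le> \<bar>y $ i\<bar>" for i
    proof -
      have "x $ i * y $ i \<le> \<bar>x $ i\<bar> * \<bar>y $ i\<bar>"
        by (metis abs_ge_self abs_mult)
      also have "\<dots> \<le> 1 * \<bar>y $ i\<bar>"
        by (rule mult_right_mono) (simp_all add: le1)
      finally show ?thesis by simp
    qed
    then have "x \<bullet> y \<le> (\<Sum>i\<in>UNIV. \<bar>y $ i\<bar>)"
      unfolding inner_vec_def inner_real_def by (rule sum_mono)
    then show ?thesis using y by simp
  qed
  then show "y \<in> polar_set unit_cube" by (auto simp: polar_set_def)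
qed

lemma set_gauge_polar_unit_cube:
  "set_gauge (polar_set unit_cube) (x :: real^'n::finite) = (\<Sum>i\<in>UNIV. \<bar>x $ i\<bar>)"
proof -
  define s where "s = (\<Sum>i\<in>UNIV. \<bar>x $ i\<bar>)"
  have s0: "0 \<le> s" by (simp add: s_def sum_nonneg)
  have eq: "(\<exists>b\<in>polar_set unit_cube. x = t *\<^sub>R b) \<longleftrightarrow> s \<le> t" if t: "t > 0" for t
  proof
    assume "\<exists>b\<in>polar_set unit_cube. x = t *\<^sub>R b"
    then obtain b :: "real^'n" where b: "(\<Sum>i\<in>UNIV. \<bar>b $ i\<bar>) \<le> 1" "x = t *\<^sub>R b"
      by (auto simp: polar_unit_cube)
    have "s = t * (\<Sum>i\<in>UNIV. \<bar>b $ i\<bar>)"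
      using t by (simp add: s_def b(2) abs_mult sum_distrib_left)
    then show "s \<le> t" using b(1) t by (simp add: mult_left_le)
  next
    assume st: "s \<le> t"
    have "(\<Sum>i\<in>UNIV. \<bar>((1 / t) *\<^sub>R x) $ i\<bar>) = s / t"
      using t by (simp add: s_def abs_mult sum_divide_distrib)
    then have "(1 / t) *\<^sub>R x \<in> polar_set unit_cube"
      using st t by (simp add: polar_unit_cube)
    moreover have "x = t *\<^sub>R ((1 / t) *\<^sub>R x)" using t by simp
    ultimately show "\<exists>b\<in>polar_set unit_cube. x = t *\<^sub>R b" by blast
  qed
  have "{t. t > 0 \<and> (\<exists>b\<in>polar_set unit_cube. x = t *\<^sub>R b)} = (if s = 0 then {0<..} else {s..})"
    using eq s0 by (intro set_eqI) (auto simp: conj_commute cong: conj_cong)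
  then show ?thesis
    by (simp add: set_gauge_def s_def [symmetric])
qed

text \<open>
  \<open>\<real>\<^sub>+\<^sup>m \<times> \<real>\<^bsup>d-m\<^esup>\<close>, where \<open>J\<close> is the set of the \<open>m\<close> coordinates that are required to be positive.
\<close>

definition positive_cone :: "'n::finite set \<Rightarrow> (real^'n) set" where
  "positive_cone J = {x. \<forall>i\<in>J. 0 < x $ i}"

definition extremal_class ::
  "(real^'n::finite) set \<Rightarrow> (real^'n) set \<Rightarrow> (real^'n \<Rightarrow> real) set" where
  "extremal_class C K = {f \<in> W_mixed_grad C.
     Linf_norm (lebesgue_on C)
       (\<lambda>x. set_gauge (polar_set K) (distr_gradient C (mixed_deriv C f) x)) \<le> 1}"

end

theory Submission
  imports Defs "HOL-Computational_Algebra.Polynomial" "HOL-Probability.Infinite_Product_Measure"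
begin

text \<open>
  Let \<open>g\<close> be the mixed derivative of a function \<open>f\<close> of the class. The condition that the gradient of \<open>g\<close>
  has \<open>\<ell>\<^sub>1\<close>-norm at most \<open>1\<close> says that \<open>g\<close> is Lipschitz with constant \<open>1\<close> for the maximum norm.

  The upper bounds come from one operator. Divide the mixed difference of \<open>f\<close> at the corners of the box
  \<open>x + [-h, h]\<^sup>d\<close> by the volume of the box; in a coordinate that has to remain positive, use \<open>[0, h]\<close>
  instead of \<open>[-h, h]\<close>. With \<open>m\<close> such coordinates there are \<open>2\<^sup>d\<close> corners and the volume is
  \<open>2\<^bsup>d-m\<^esup> h\<^sup>d\<close>, so the operator has norm at most \<open>2\<^sup>m / h\<^sup>d\<close>.
  The quotient is the mean of \<open>g\<close> over the box, so it differs from \<open>g x\<close> by at most the mean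
  of the maximum norm, which is \<open>h d / (d + 1)\<close> (lemmas \<open>mixed_difference_error\<close> and
  \<open>expectation_max_coords\<close>). Choosing \<open>h\<close> with \<open>2\<^sup>m / h\<^sup>d = N\<close> gives the upper bound for \<open>E\<^sub>N\<close>. For
  observations with error \<open>\<delta>\<close> the total error is at most \<open>h d / (d + 1) + 2\<^sup>m \<delta> / h\<^sup>d\<close>, whose minimum over \<open>h\<close>
  is \<open>(2\<^sup>m (d + 1) \<delta>)\<^bsup>1/(d+1)\<^esup>\<close>.

  The lower bounds come from one function. The pyramid \<open>max 0 (h - \<bar>x\<bar>\<^sub>\<infinity>)\<close> has height \<open>h\<close> and a primitive
  with respect to all variables whose norm on the cone is at most \<open>\<delta> = h\<^bsup>d+1\<^esup> / (2\<^sup>m (d + 1))\<close>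
  (lemmas \<open>pyramid_primitive_mixed_deriv\<close> and \<open>pyramid_primitive_bound\<close>). This bounds the modulus of
  continuity from below by \<open>h\<close>, and the approximation error of any operator of norm at most \<open>N\<close> by
  \<open>h - N \<delta>\<close>. For the values of \<open>h\<close> chosen above, both agree with the upper bounds. Recovery
  cannot beat the modulus of continuity, since the zero observation is compatible with every \<open>f\<close> of norm at most \<open>\<delta>\<close>.

  All derivatives being distributional, the first estimate is proved by duality. Against a nonnegative
  test function \<open>\<phi>\<close>, the mean over a box becomes an average of translates of \<open>\<phi>\<close>, and a difference of two
  translates is a directional derivative of a further test function (lemma
  \<open>smear_directional_derivative\<close>), which is moved onto \<open>g\<close>. The one-sided fundamental lemma of the calculus of
  variations (\<open>fundamental_lemma_nonneg\<close>) turns the resulting inequality between integrals into one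
  that holds almost everywhere.
\<close>

section \<open>Smooth functions and test functions\<close>

text \<open>
  Higher derivatives of bumps and of convolutions never have to be written
  down: in each case it is enough to name a family of differentiable functions that is
  closed under partial derivatives.
\<close>

lemma smooth_coinduct:
  fixes F :: "(real^'n::finite \<Rightarrow> real) set"
  assumes "\<phi> \<in> F" and diff: "\<And>f x. f \<in> F \<Longrightarrow> f differentiable (at x)"
    and partial: "\<And>f i. f \<in> F \<Longrightarrow> partial_deriv i f \<in> F"
  shows "smooth_function \<phi>"
proof -
  have "iterated_partial_deriv is \<phi> \<in> F" for "is"
    using assms(1) by (induction "is") (auto simp: iterated_partial_deriv_def partial)
  then show ?thesis
    using diff by (auto simp: smooth_function_def)
qed

lemma iterated_partial_deriv_simps [simp]:
  "iterated_partial_deriv [] \<phi> = \<phi>"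
  "iterated_partial_deriv (i # is) \<phi> = partial_deriv i (iterated_partial_deriv is \<phi>)"
  by (simp_all add: iterated_partial_deriv_def)

lemma iterated_partial_deriv_append:
  "iterated_partial_deriv (is @ js) \<phi> = iterated_partial_deriv is (iterated_partial_deriv js \<phi>)"
  by (simp add: iterated_partial_deriv_def)

lemma smooth_differentiable: "smooth_function \<phi> \<Longrightarrow> \<phi> differentiable (at x)"
  unfolding smooth_function_def by (metis iterated_partial_deriv_simps(1))

lemma smooth_iterated_partial:
  assumes "smooth_function \<phi>" shows "smooth_function (iterated_partial_deriv is \<phi>)"
  using assms unfolding smooth_function_def
  by (metis iterated_partial_deriv_append)

lemma smooth_partial: "smooth_function \<phi> \<Longrightarrow> smooth_function (partial_deriv i \<phi>)"
  using smooth_iterated_partial[of \<phi> "[i]"] by simp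

lemma smooth_continuous: "smooth_function \<phi> \<Longrightarrow> continuous_on S \<phi>"
  by (meson continuous_at_imp_continuous_on differentiable_imp_continuous_within smooth_differentiable)

lemma frechet_derivative_eq_partials:
  fixes \<phi> :: "real^'n::finite \<Rightarrow> real"
  assumes "\<phi> differentiable (at x)"
  shows "frechet_derivative \<phi> (at x) v = (\<Sum>i\<in>UNIV. v $ i * partial_deriv i \<phi> x)"
proof -
  have lin: "linear (frechet_derivative \<phi> (at x))"
    using assms by (rule linear_frechet_derivative)
  have "v = (\<Sum>i\<in>UNIV. (v $ i) *\<^sub>R axis i 1)"
    by (simp add: vec_eq_iff axis_def if_distrib cong: if_cong)
  then have "frechet_derivative \<phi> (at x) v = frechet_derivative \<phi> (at x) (\<Sum>i\<in>UNIV. (v $ i) *\<^sub>R axis i 1)"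
    by simp
  also have "\<dots> = (\<Sum>i\<in>UNIV. v $ i * partial_deriv i \<phi> x)"
    by (simp add: linear_sum[OF lin] linear_cmul[OF lin] partial_deriv_def)
  finally show ?thesis .
qed

lemma smooth_has_derivative:
  assumes "smooth_function \<phi>"
  shows "(\<phi> has_derivative (\<lambda>v. \<Sum>i\<in>UNIV. v $ i * partial_deriv i \<phi> x)) (at x within S)"
proof -
  have "(\<phi> has_derivative frechet_derivative \<phi> (at x)) (at x)"
    using frechet_derivative_works smooth_differentiable[OF assms] by blast
  moreover have "frechet_derivative \<phi> (at x) = (\<lambda>v. \<Sum>i\<in>UNIV. v $ i * partial_deriv i \<phi> x)"
    using frechet_derivative_eq_partials[OF smooth_differentiable[OF assms]] by blast
  ultimately show ?thesis by (metis has_derivative_at_withinI)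
qed

lemma partial_derivI:
  assumes "(\<phi> has_derivative D) (at x)" shows "partial_deriv i \<phi> x = D (axis i 1)"
  using frechet_derivative_at[OF assms] by (simp add: partial_deriv_def)

text \<open>
  Translation, averaging and taking differences commute with partial derivatives, and this alone makes
  them preserve smoothness.
\<close>

lemma smooth_commuting:
  fixes T :: "(real^'n::finite \<Rightarrow> real) \<Rightarrow> real^'n \<Rightarrow> real"
  assumes T: "\<And>\<phi> x. smooth_function \<phi> \<Longrightarrow>
      (T \<phi> has_derivative (\<lambda>v. \<Sum>i\<in>UNIV. v $ i * T (partial_deriv i \<phi>) x)) (at x)"
    and \<phi>: "smooth_function \<phi>"
  shows "smooth_function (T \<phi>)" and "partial_deriv i (T \<phi>) = T (partial_deriv i \<phi>)"
proof -
  have P: "partial_deriv i (T \<psi>) = T (partial_deriv i \<psi>)" if "smooth_function \<psi>" for \<psi> i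
    by (rule ext, subst partial_derivI[OF T[OF that]])
      (simp add: axis_def if_distrib if_distribR cong: if_cong)
  show "partial_deriv i (T \<phi>) = T (partial_deriv i \<phi>)" by (rule P[OF \<phi>])
  show "smooth_function (T \<phi>)"
  proof (rule smooth_coinduct[where F = "T ` {\<psi>. smooth_function \<psi>}"])
    show "f differentiable (at x)" if "f \<in> T ` {\<psi>. smooth_function \<psi>}" for f x
      using that differentiableI[OF T] by blast
    show "partial_deriv i f \<in> T ` {\<psi>. smooth_function \<psi>}"
      if f: "f \<in> T ` {\<psi>. smooth_function \<psi>}" for f i
    proof -
      obtain \<psi> where "smooth_function \<psi>" "f = T \<psi>" using f by blast
      then show ?thesis
        by (intro image_eqI[of _ _ "partial_deriv i \<psi>"]) (auto simp: P smooth_partial)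
    qed
  qed (use \<phi> in auto)
qed

lemma translate_has_derivative:
  assumes "smooth_function \<phi>"
  shows "((\<lambda>x. \<phi> (x - t)) has_derivative (\<lambda>v. \<Sum>i\<in>UNIV. v $ i * partial_deriv i \<phi> (x - t))) (at x)"
proof -
  have "((\<lambda>x. x - t) has_derivative (\<lambda>v. v)) (at x)"
    by (auto intro!: derivative_eq_intros)
  from has_derivative_compose[OF this smooth_has_derivative[OF assms]] show ?thesis by simp
qed

lemma smooth_translate:
  "smooth_function \<phi> \<Longrightarrow> smooth_function (\<lambda>x. \<phi> (x - t))"
  by (rule smooth_commuting(1)[OF translate_has_derivative])

lemma test_functionI:
  assumes "smooth_function \<phi>" "compact K" "K \<subseteq> C" "\<And>x. \<phi> x \<noteq> 0 \<Longrightarrow> x \<in> K"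
  shows "\<phi> \<in> test_functions C"
proof -
  have "closure {x. \<phi> x \<noteq> 0} \<subseteq> K"
    using assms by (intro closure_minimal) (auto simp: compact_imp_closed)
  moreover from this have "compact (closure {x. \<phi> x \<noteq> 0})"
    using assms(2) by (metis closed_closure compact_Int_closed inf.absorb_iff2)
  ultimately show ?thesis
    using assms by (auto simp: test_functions_def)
qed

lemma test_functionE:
  assumes "\<phi> \<in> test_functions C"
  obtains K where "smooth_function \<phi>" "compact K" "K \<subseteq> C" "\<And>x. x \<notin> K \<Longrightarrow> \<phi> x = 0"
proof (rule that[of "closure {x. \<phi> x \<noteq> 0}"])
  show "\<phi> x = 0" if "x \<notin> closure {x. \<phi> x \<noteq> 0}" for x
    using that closure_subset[of "{x. \<phi> x \<noteq> 0}"] by auto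
qed (use assms in \<open>auto simp: test_functions_def\<close>)

lemma partial_deriv_outside:
  assumes K: "closed K" "\<And>x. x \<notin> K \<Longrightarrow> \<phi> x = 0" and x: "x \<notin> K"
  shows "partial_deriv i \<phi> x = 0"
proof -
  have "((\<lambda>x. 0) has_derivative (\<lambda>v. 0)) (at x)" by simp
  then have "(\<phi> has_derivative (\<lambda>v. 0)) (at x)"
    by (rule has_derivative_transform_within_open[where s = "- K"]) (use assms in auto)
  from partial_derivI[OF this] show ?thesis .
qed

lemma test_partial:
  assumes "\<phi> \<in> test_functions C" shows "partial_deriv i \<phi> \<in> test_functions C"
proof -
  from test_functionE[OF assms] obtain K
    where "smooth_function \<phi>" and K: "compact K" "K \<subseteq> C" "\<And>x. x \<notin> K \<Longrightarrow> \<phi> x = 0"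
    by metis
  then show ?thesis
    using partial_deriv_outside[of K \<phi> _ i, OF compact_imp_closed[OF K(1)] K(3)]
    by (intro test_functionI[of _ K]) (auto simp: smooth_partial)
qed

lemma test_iterated_partial:
  "\<phi> \<in> test_functions C \<Longrightarrow> iterated_partial_deriv is \<phi> \<in> test_functions C"
  by (induction "is") (auto simp: test_partial)

lemma test_mono: "C \<subseteq> D \<Longrightarrow> test_functions C \<subseteq> test_functions D"
  by (auto simp: test_functions_def)

lemma test_translate:
  assumes "\<phi> \<in> test_functions C" "\<And>x. x \<in> C \<Longrightarrow> x + t \<in> C"
  shows "(\<lambda>x. \<phi> (x - t)) \<in> test_functions C"
proof -
  obtain K where K: "smooth_function \<phi>" "compact K" "K \<subseteq> C" "\<And>x. x \<notin> K \<Longrightarrow> \<phi> x = 0"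
    using test_functionE[OF assms(1)] by metis
  show ?thesis
  proof (rule test_functionI[of _ "(+) t ` K"])
    show "compact ((+) t ` K)" using K(2) by (rule compact_translation)
    show "(+) t ` K \<subseteq> C" using K(3) assms(2) by (auto simp: add.commute)
    show "x \<in> (+) t ` K" if "\<phi> (x - t) \<noteq> 0" for x
      using that K(4)[of "x - t"] by (intro image_eqI[of _ _ "x - t"]) auto
  qed (use K smooth_translate in auto)
qed

section \<open>Smooth bumps\<close>

text \<open>
  For \<open>p = 1\<close> this is \<open>exp (- 1 / t)\<close> extended by \<open>0\<close>, the classical smooth function that vanishes to
  infinite order at \<open>0\<close>. The polynomial makes the family closed under differentiation.
\<close>

definition flat :: "real poly \<Rightarrow> real \<Rightarrow> real" where
  "flat p t = (if t > 0 then poly p (1 / t) * exp (- (1 / t)) else 0)"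

lemma poly_exp_tendsto_0: "((\<lambda>s. poly p s * exp (- s)) \<longlongrightarrow> (0::real)) at_top"
proof -
  have "((\<lambda>s. \<Sum>i\<le>degree p. coeff p i * (s ^ i / exp s)) \<longlongrightarrow> (\<Sum>i\<le>degree p. coeff p i * 0)) at_top"
    by (intro tendsto_intros tendsto_power_div_exp_0)
  moreover have "(\<Sum>i\<le>degree p. coeff p i * (s ^ i / exp s)) = poly p s * exp (- s)" for s
    by (simp add: poly_altdef sum_distrib_right exp_minus divide_inverse mult.assoc)
  ultimately show ?thesis by simp
qed

lemma flat_tendsto_0: "(flat p \<longlongrightarrow> 0) (at 0)"
proof -
  have "((\<lambda>t. poly p (inverse t) * exp (- inverse t)) \<longlongrightarrow> 0) (at_right 0)"
    by (rule filterlim_compose[OF poly_exp_tendsto_0 filterlim_inverse_at_top_right])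
  then have "(flat p \<longlongrightarrow> 0) (at_right 0)"
    by (rule Lim_transform_eventually) (auto simp: eventually_at_filter flat_def inverse_eq_divide)
  moreover have "((\<lambda>t. 0::real) \<longlongrightarrow> 0) (at_left (0::real))" by simp
  then have "(flat p \<longlongrightarrow> 0) (at_left 0)"
    by (rule Lim_transform_eventually) (auto simp: eventually_at_filter flat_def)
  ultimately show ?thesis by (simp add: filterlim_split_at)
qed

text \<open>
  For \<open>t > 0\<close> the derivative of \<open>p(1/t) exp(-1/t)\<close> is \<open>(p - p')(1/t) exp(-1/t) / t\<^sup>2\<close>. At \<open>t = 0\<close>
  the difference quotient of \<open>flat p\<close> is the member of the family belonging to \<open>X p\<close>, so it tends
  to \<open>0\<close>.
\<close>

lemma flat_deriv:
  "(flat p has_real_derivative flat (monom 1 2 * (p - pderiv p)) t) (at t)"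
proof -
  consider "t > 0" | "t < 0" | "t = 0" by linarith
  then show ?thesis
  proof cases
    case 1
    have "((\<lambda>t. poly p (1 / t) * exp (- (1 / t))) has_real_derivative
             flat (monom 1 2 * (p - pderiv p)) t) (at t)"
      using 1 by (auto intro!: derivative_eq_intros DERIV_chain'[where g = "poly p"] poly_DERIV
        simp: flat_def poly_monom divide_simps power2_eq_square algebra_simps)
    then show ?thesis
      by (rule has_field_derivative_transform_within_open[where S = "{0<..}"]) (use 1 in \<open>auto simp: flat_def\<close>)
  next
    case 2
    have "((\<lambda>t. 0::real) has_real_derivative 0) (at t)" by simp
    then have "(flat p has_real_derivative 0) (at t)"
      by (rule has_field_derivative_transform_within_open[where S = "{..<0}"]) (use 2 in \<open>auto simp: flat_def\<close>)
    then show ?thesis using 2 by (simp add: flat_def)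
  next
    case 3
    have "((\<lambda>h. flat (monom 1 1 * p) h) \<longlongrightarrow> 0) (at 0)" by (rule flat_tendsto_0)
    moreover have "flat (monom 1 1 * p) h = (flat p (0 + h) - flat p 0) / h" for h
      by (simp add: flat_def poly_monom)
    ultimately show ?thesis
      using 3 by (simp add: DERIV_def) (simp add: flat_def)
  qed
qed

text \<open>
  By the product rule, products of flat functions of single coordinates have sums of such products as
  partial derivatives. This is why sums and constants are included.
\<close>

inductive_set bump_algebra :: "(real^'n::finite \<Rightarrow> real) set" where
  const: "(\<lambda>x. c) \<in> bump_algebra"
| flat: "(\<lambda>x. flat p (c * x $ i + e)) \<in> bump_algebra"
| add: "f \<in> bump_algebra \<Longrightarrow> g \<in> bump_algebra \<Longrightarrow> (\<lambda>x. f x + g x) \<in> bump_algebra"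
| mult: "f \<in> bump_algebra \<Longrightarrow> g \<in> bump_algebra \<Longrightarrow> (\<lambda>x. f x * g x) \<in> bump_algebra"

lemma bump_derivative:
  assumes "f \<in> bump_algebra"
  shows "\<exists>D. (\<forall>x. (f has_derivative D x) (at x)) \<and> (\<forall>i. (\<lambda>x. D x (axis i 1)) \<in> bump_algebra)"
  using assms
proof induction
  case (const c)
  then show ?case by (intro exI[of _ "\<lambda>x v. 0"]) (auto intro: bump_algebra.const)
next
  case (flat p c i e)
  let ?q = "monom 1 2 * (p - pderiv p)"
  have "((\<lambda>x. flat p (c * x $ i + e)) has_derivative (\<lambda>v. flat ?q (c * x $ i + e) * (c * v $ i))) (at x)" for x
    by (rule has_derivative_compose[OF _ flat_deriv[unfolded has_field_derivative_def]])
      (auto intro!: derivative_eq_intros bounded_linear_imp_has_derivative)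
  moreover have "(\<lambda>x. flat ?q (c * x $ i + e) * (c * axis j 1 $ i)) \<in> bump_algebra" for j
    by (intro bump_algebra.mult bump_algebra.flat bump_algebra.const)
  ultimately show ?case
    by (intro exI[of _ "\<lambda>x v. flat ?q (c * x $ i + e) * (c * v $ i)"]) auto
next
  case (add f g)
  then obtain D E where D: "\<And>x. (f has_derivative D x) (at x)" "\<And>i. (\<lambda>x. D x (axis i 1)) \<in> bump_algebra"
    and E: "\<And>x. (g has_derivative E x) (at x)" "\<And>i. (\<lambda>x. E x (axis i 1)) \<in> bump_algebra" by blast
  then show ?case
    by (intro exI[of _ "\<lambda>x v. D x v + E x v"]) (auto intro!: has_derivative_add bump_algebra.add)
next
  case (mult f g)
  then obtain D E where D: "\<And>x. (f has_derivative D x) (at x)" "\<And>i. (\<lambda>x. D x (axis i 1)) \<in> bump_algebra"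
    and E: "\<And>x. (g has_derivative E x) (at x)" "\<And>i. (\<lambda>x. E x (axis i 1)) \<in> bump_algebra" by blast
  then show ?case using mult.hyps
    by (intro exI[of _ "\<lambda>x v. f x * E x v + D x v * g x"])
      (auto intro!: has_derivative_mult bump_algebra.add bump_algebra.mult)
qed

lemma bump_smooth: "f \<in> bump_algebra \<Longrightarrow> smooth_function f"
proof (rule smooth_coinduct[where F = bump_algebra])
  show "f differentiable (at x)" if "f \<in> bump_algebra" for f :: "real^'n \<Rightarrow> real" and x
    using bump_derivative[OF that] by (auto simp: differentiable_def)
  show "partial_deriv i f \<in> bump_algebra" if f: "f \<in> bump_algebra" for f :: "real^'n \<Rightarrow> real" and i
  proof -
    obtain D where D: "\<And>x. (f has_derivative D x) (at x)" "\<And>i. (\<lambda>x. D x (axis i 1)) \<in> bump_algebra"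
      using bump_derivative[OF f] by blast
    then have "partial_deriv i f = (\<lambda>x. D x (axis i 1))"
      using partial_derivI by blast
    then show ?thesis using D by simp
  qed
qed

lemma bump_prod:
  "finite I \<Longrightarrow> (\<And>i. i \<in> I \<Longrightarrow> f i \<in> bump_algebra) \<Longrightarrow> (\<lambda>x. \<Prod>i\<in>I. f i x) \<in> bump_algebra"
  by (induction I rule: finite_induct) (auto intro: bump_algebra.intros)

lemma bump_one_minus: "f \<in> bump_algebra \<Longrightarrow> (\<lambda>x. 1 - f x) \<in> bump_algebra"
  using bump_algebra.add[OF bump_algebra.const[of 1] bump_algebra.mult[OF bump_algebra.const[of "-1"]]]
  by simp

text \<open>
  Since \<open>flat 1 (n t)\<close> tends to \<open>1\<close> for every \<open>t > 0\<close> and never exceeds \<open>1\<close>, enlarging the slope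
  \<open>n\<close> turns one bump into an approximation of the indicator of a box, without any normalisation.
\<close>

definition box_bump :: "nat \<Rightarrow> real^'n::finite \<Rightarrow> real^'n \<Rightarrow> real^'n \<Rightarrow> real" where
  "box_bump n a b x = (\<Prod>i\<in>UNIV. flat 1 (real n * (x $ i - a $ i)) * flat 1 (real n * (b $ i - x $ i)))"

lemma flat_1_bounds: "0 \<le> flat 1 t" "flat 1 t \<le> 1"
  by (auto simp: flat_def)

lemma box_bump_bounds: "0 \<le> box_bump n a b x" "box_bump n a b x \<le> 1"
  unfolding box_bump_def
  by (auto intro!: prod_nonneg prod_le_1 mult_nonneg_nonneg mult_le_one flat_1_bounds)

lemma box_bump_algebra:
  fixes a b :: "real^'n::finite"
  shows "box_bump n a b \<in> bump_algebra"
proof -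
  have "(\<lambda>x :: real^'n. flat 1 (real n * x $ i + - (real n * a $ i)) * flat 1 ((- real n) * x $ i + real n * b $ i)) \<in> bump_algebra" for i
    by (rule bump_algebra.mult[OF bump_algebra.flat bump_algebra.flat])
  moreover have "flat 1 (real n * x $ i + - (real n * a $ i)) = flat 1 (real n * (x $ i - a $ i))"
    "flat 1 ((- real n) * x $ i + real n * b $ i) = flat 1 (real n * (b $ i - x $ i))" for x :: "real^'n" and i
    by (simp_all add: right_diff_distrib)
  ultimately have "(\<lambda>x. flat 1 (real n * (x $ i - a $ i)) * flat 1 (real n * (b $ i - x $ i))) \<in> bump_algebra" for i
    by simp
  then show ?thesis
    unfolding box_bump_def[abs_def] by (intro bump_prod) auto
qed

lemma box_bump_outside:
  fixes a b x :: "real^'n::finite"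
  assumes "x \<notin> cbox a b" shows "box_bump n a b x = 0"
proof -
  obtain i where "x $ i < a $ i \<or> b $ i < x $ i"
    using assms by (auto simp: mem_box_cart not_le)
  then have "flat 1 (real n * (x $ i - a $ i)) * flat 1 (real n * (b $ i - x $ i)) = 0"
    by (auto simp: flat_def mult_less_0_iff zero_less_mult_iff)
  then show ?thesis unfolding box_bump_def by (intro prod_zero) auto
qed

lemma flat_1_scaled_tendsto:
  assumes "t > 0" shows "(\<lambda>n. flat 1 (real n * t)) \<longlonglongrightarrow> 1"
proof -
  have "(\<lambda>n. exp (- (1 / t * (1 / real n)))) \<longlonglongrightarrow> exp (- (1 / t * 0))"
    by (intro tendsto_intros lim_1_over_n)
  then have "(\<lambda>n. exp (- (1 / t * (1 / real n)))) \<longlonglongrightarrow> 1" by simp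
  then show ?thesis
    by (rule Lim_transform_eventually)
      (use assms in \<open>auto simp: flat_def field_simps intro!: eventually_mono[OF eventually_gt_at_top[of 0]]\<close>)
qed

lemma box_bump_tendsto:
  fixes a b x :: "real^'n::finite"
  assumes "x \<in> box a b" shows "(\<lambda>n. box_bump n a b x) \<longlonglongrightarrow> 1"
proof -
  have "(\<lambda>n. box_bump n a b x) \<longlonglongrightarrow> (\<Prod>i\<in>(UNIV::'n set). 1 * 1)"
    unfolding box_bump_def
    by (intro tendsto_prod tendsto_mult flat_1_scaled_tendsto) (use assms in \<open>auto simp: mem_box_cart\<close>)
  then show ?thesis by simp
qed

text \<open>
  The open boxes must cover \<open>U\<close>, because the bumps are positive only there; their closures must stay in
  \<open>U\<close>, because these carry the supports.
\<close>

lemma open_countable_Union_boxes: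
  fixes U :: "(real^'n::finite) set"
  assumes "open U"
  shows "\<exists>a b :: nat \<Rightarrow> real^'n. (\<forall>k. cbox (a k) (b k) \<subseteq> U) \<and> U \<subseteq> (\<Union>k. box (a k) (b k))"
proof -
  let ?F = "{box a b | a b :: real^'n. cbox a b \<subseteq> U}"
  obtain F where F: "F \<subseteq> ?F" "countable F" "\<Union>F = \<Union>?F"
    using Lindelof[of ?F] open_box by force
  have cover: "U \<subseteq> \<Union>F"
  proof
    fix x assume "x \<in> U"
    from open_contains_cbox[OF assms this] obtain a b where "cbox a b \<subseteq> U" "x \<in> box a b" by metis
    then show "x \<in> \<Union>F" unfolding F(3) by blast
  qed
  \<comment> \<open>The degenerate box \<open>box 1 0\<close> makes the family nonempty, so that it can be enumerated.\<close>
  have empty: "box 1 0 = ({} :: (real^'n) set)" "cbox 1 0 = ({} :: (real^'n) set)"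
    by (simp_all add: interval_eq_empty_cart)
  have "\<exists>a b. from_nat_into (insert {} F) k = box a b \<and> cbox a b \<subseteq> U" for k
    using from_nat_into[of "insert {} F" k] F(1) empty by blast
  then obtain a b where ab: "\<And>k. from_nat_into (insert {} F) k = box (a k) (b k)" "\<And>k. cbox (a k) (b k) \<subseteq> U"
    by metis
  have "(\<Union>k. box (a k) (b k)) = \<Union>F"
    using range_from_nat_into[of "insert {} F"] F(2) unfolding ab(1)[symmetric] by simp
  then show ?thesis using ab(2) cover by (intro exI[of _ a] exI[of _ b]) auto
qed

text \<open>
  Bumps on overlapping boxes are combined by \<open>1 - \<Prod>\<^sub>k (1 - \<phi>\<^sub>k)\<close>, a smooth substitute for their
  maximum: it stays in \<open>[0, 1]\<close> and tends to \<open>1\<close> wherever a single \<open>\<phi>\<^sub>k\<close> does.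
\<close>

lemma test_functions_approx_open:
  fixes U :: "(real^'n::finite) set"
  assumes "open U"
  obtains \<phi> where "\<And>n. \<phi> n \<in> test_functions U" "\<And>n x. 0 \<le> \<phi> n x" "\<And>n x. \<phi> n x \<le> 1"
    "\<And>x. (\<lambda>n. \<phi> n x) \<longlonglongrightarrow> indicator U x"
proof -
  obtain a b :: "nat \<Rightarrow> real^'n" where ab: "\<And>k. cbox (a k) (b k) \<subseteq> U" "U \<subseteq> (\<Union>k. box (a k) (b k))"
    using open_countable_Union_boxes[OF assms] by blast
  define \<phi> where "\<phi> n x = 1 - (\<Prod>k<n. 1 - box_bump n (a k) (b k) x)" for n x
  have le1: "0 \<le> (\<Prod>k<n. 1 - box_bump n (a k) (b k) x)" "(\<Prod>k<n. 1 - box_bump n (a k) (b k) x) \<le> 1" for n x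
    by (auto intro!: prod_nonneg prod_le_1 simp: box_bump_bounds)
  show thesis
  proof (rule that)
    fix n show "\<phi> n \<in> test_functions U"
    proof (rule test_functionI[of _ "\<Union>k<n. cbox (a k) (b k)"])
      show "smooth_function (\<phi> n)"
        unfolding \<phi>_def by (intro bump_smooth bump_one_minus bump_prod box_bump_algebra) auto
      show "x \<in> (\<Union>k<n. cbox (a k) (b k))" if "\<phi> n x \<noteq> 0" for x
      proof (rule ccontr)
        assume "x \<notin> (\<Union>k<n. cbox (a k) (b k))"
        then have "\<phi> n x = 0" by (simp add: \<phi>_def box_bump_outside)
        with that show False by simp
      qed
    qed (use ab in auto)
  next
    fix x
    show "(\<lambda>n. \<phi> n x) \<longlonglongrightarrow> indicator U x"
    proof (cases "x \<in> U")
      case False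
      then have "x \<notin> cbox (a k) (b k)" for k using ab by auto
      then show ?thesis using False by (simp add: \<phi>_def box_bump_outside)
    next
      case True
      then obtain k where k: "x \<in> box (a k) (b k)" using ab by auto
      have lim: "(\<lambda>n. 1 - box_bump n (a k) (b k) x) \<longlonglongrightarrow> 1 - 1"
        by (intro tendsto_intros box_bump_tendsto k)
      have "(\<lambda>n. \<Prod>k<n. 1 - box_bump n (a k) (b k) x) \<longlonglongrightarrow> 0"
      proof (rule tendsto_sandwich[OF _ _ tendsto_const])
        show "(\<lambda>n. 1 - box_bump n (a k) (b k) x) \<longlonglongrightarrow> 0" using lim by simp
        show "\<forall>\<^sub>F n in sequentially. (\<Prod>k<n. 1 - box_bump n (a k) (b k) x) \<le> 1 - box_bump n (a k) (b k) x"
          using eventually_gt_at_top[of k]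
        proof eventually_elim
          case (elim n)
          have "(\<Prod>k<n. 1 - box_bump n (a k) (b k) x) = (1 - box_bump n (a k) (b k) x) * (\<Prod>k\<in>{..<n} - {k}. 1 - box_bump n (a k) (b k) x)"
            using elim by (intro prod.remove) auto
          also have "\<dots> \<le> (1 - box_bump n (a k) (b k) x) * 1"
            by (intro mult_left_mono prod_le_1) (auto simp: box_bump_bounds)
          finally show ?case by simp
        qed
      qed (use le1 in auto)
      then have "(\<lambda>n. \<phi> n x) \<longlonglongrightarrow> 1 - 0" unfolding \<phi>_def by (intro tendsto_intros)
      then show ?thesis using True by simp
    qed
  qed (use le1 in \<open>auto simp: \<phi>_def\<close>)
qed

section \<open>Integration against test functions\<close>

lemma
  fixes t :: "'a::euclidean_space"
  shows lebesgue_measurable_translation: "(\<lambda>x. x + t) \<in> lebesgue \<rightarrow>\<^sub>M lebesgue"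
    and lebesgue_distr_translation: "distr lebesgue lebesgue (\<lambda>x. x + t) = lebesgue"
proof -
  have T: "(\<lambda>x. t + (\<Sum>j\<in>Basis. (1 * (x \<bullet> j)) *\<^sub>R j)) = (\<lambda>x. x + t)"
    by (simp add: euclidean_representation add.commute)
  show "(\<lambda>x. x + t) \<in> lebesgue \<rightarrow>\<^sub>M lebesgue"
    using lebesgue_affine_measurable[of "\<lambda>_. 1" t] unfolding T by simp
  have "lebesgue = density (distr lebesgue lebesgue (\<lambda>x. x + t)) (\<lambda>_. 1)"
    using lebesgue_affine_euclidean[of "\<lambda>_. 1" t] unfolding T by simp
  then show "distr lebesgue lebesgue (\<lambda>x. x + t) = lebesgue"
    by (simp add: density_1)
qed

lemma integral_lebesgue_translate:
  fixes f :: "'a::euclidean_space \<Rightarrow> real"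
  shows "(LINT x|lebesgue. f (x + t)) = (LINT x|lebesgue. f x)"
proof (cases "f \<in> borel_measurable lebesgue")
  case True
  show ?thesis
    using integral_distr[OF lebesgue_measurable_translation True, of t]
    by (simp add: lebesgue_distr_translation)
next
  case False
  have "(\<lambda>x. f (x + t)) \<notin> borel_measurable lebesgue"
  proof
    assume "(\<lambda>x. f (x + t)) \<in> borel_measurable lebesgue"
    from measurable_compose[OF lebesgue_measurable_translation[of "-t"] this] False show False by simp
  qed
  then show ?thesis using False by (metis borel_measurable_integrable not_integrable_integral_eq)
qed

lemma integrable_lebesgue_translate:
  fixes f :: "'a::euclidean_space \<Rightarrow> real"
  assumes "integrable lebesgue f"
  shows "integrable lebesgue (\<lambda>x. f (x + t))"
  using integrable_distr[OF lebesgue_measurable_translation, of t f] assms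
  by (simp add: lebesgue_distr_translation)

lemma AE_lebesgue_translate:
  fixes P :: "'a::euclidean_space \<Rightarrow> bool"
  assumes "AE x in lebesgue. P x"
  shows "AE x in lebesgue. P (x + t)"
proof -
  have "AE x in distr lebesgue lebesgue (\<lambda>x. x + t). P x"
    using assms by (simp only: lebesgue_distr_translation)
  then show ?thesis
    by (rule AE_distrD[OF lebesgue_measurable_translation])
qed

lemma integral_lebesgue_on_eq:
  fixes f :: "real^'n::finite \<Rightarrow> real"
  assumes "C \<in> sets lebesgue" "\<And>x. x \<notin> C \<Longrightarrow> f x = 0"
  shows "(LINT x|lebesgue_on C. f x) = (LINT x|lebesgue. f x)"
proof -
  have "(\<lambda>x. indicator C x *\<^sub>R f x) = f"
    using assms(2) by (force simp: indicator_def fun_eq_iff)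
  then show ?thesis using assms(1) by (simp only: integral_restrict_space sets.Int_space_eq2)
qed

text \<open>
  The support of a test function lies in \<open>C\<close>, so pairings may be computed over the whole space, where
  Lebesgue measure is invariant under translations.
\<close>

lemma integral_test_eq:
  assumes "C \<in> sets lebesgue" "\<phi> \<in> test_functions C"
  shows "(LINT x|lebesgue_on C. f x * \<phi> x) = (LINT x|lebesgue. f x * \<phi> x)"
proof (rule integral_lebesgue_on_eq[OF assms(1)])
  show "f x * \<phi> x = 0" if "x \<notin> C" for x
    using that test_functionE[OF assms(2)] by (metis mult_zero_right subsetD)
qed

lemma open_in_lebesgue [simp]: "open C \<Longrightarrow> C \<in> sets lebesgue"
  by (simp add: borel_open)

lemma has_distr_deriv_iff:
  assumes "open C"
  shows "has_distr_deriv C is f g \<longleftrightarrow> locally_integrable C f \<and> locally_integrable C g \<and>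
     (\<forall>\<phi>\<in>test_functions C.
        (LINT x|lebesgue. f x * iterated_partial_deriv is \<phi> x) =
        (-1) ^ length is * (LINT x|lebesgue. g x * \<phi> x))"
  unfolding has_distr_deriv_def
  by (simp add: integral_test_eq[OF open_in_lebesgue[OF assms]] test_iterated_partial cong: conj_cong ball_cong)

lemma has_distr_deriv_append:
  assumes "has_distr_deriv C is f g" "has_distr_deriv C js g k"
  shows "has_distr_deriv C (is @ js) f k"
  using assms
  by (auto simp: has_distr_deriv_def iterated_partial_deriv_append test_iterated_partial power_add)

lemma integrable_test:
  assumes f: "locally_integrable C f" and \<phi>: "\<phi> \<in> test_functions C"
  shows "integrable lebesgue (\<lambda>x. f x * \<phi> x)"
proof -
  obtain K where K: "smooth_function \<phi>" "compact K" "K \<subseteq> C" "\<And>x. x \<notin> K \<Longrightarrow> \<phi> x = 0"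
    using test_functionE[OF \<phi>] by metis
  have Ks: "K \<in> sets lebesgue"
    using K(2) by (simp add: borel_compact)
  have "integrable (lebesgue_on K) f"
    using f K by (auto simp: locally_integrable_def)
  then have int: "integrable lebesgue (\<lambda>x. indicator K x * f x)"
    using Ks by (simp add: integrable_restrict_space)
  have "compact (\<phi> ` K)"
    using smooth_continuous[OF K(1)] K(2) by (rule compact_continuous_image)
  then obtain B where B: "\<And>x. x \<in> K \<Longrightarrow> \<bar>\<phi> x\<bar> \<le> B"
    unfolding compact_eq_bounded_closed bounded_iff by auto
  have "continuous_on UNIV \<phi>" using K(1) by (rule smooth_continuous)
  then have meas: "\<phi> \<in> borel_measurable lebesgue"
    by (simp add: borel_measurable_continuous_onI measurable_completion)
  have eq: "f x * \<phi> x = indicator K x * f x * \<phi> x" for x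
    using K(4) by (cases "x \<in> K") auto
  have "integrable lebesgue (\<lambda>x. indicator K x * f x * \<phi> x)"
  proof (rule Bochner_Integration.integrable_bound)
    show "integrable lebesgue (\<lambda>x. B * (indicator K x * f x))"
      using int by simp
    show "(\<lambda>x. indicator K x * f x * \<phi> x) \<in> borel_measurable lebesgue"
      using borel_measurable_times[OF borel_measurable_integrable[OF int] meas] .
    show "AE x in lebesgue. norm (indicator K x * f x * \<phi> x) \<le> norm (B * (indicator K x * f x))"
    proof (intro AE_I2)
      fix x
      show "norm (indicator K x * f x * \<phi> x) \<le> norm (B * (indicator K x * f x))"
      proof (cases "x \<in> K")
        case True
        then have "\<bar>\<phi> x\<bar> \<le> \<bar>B\<bar>" using B by fastforce
        then have "\<bar>f x\<bar> * \<bar>\<phi> x\<bar> \<le> \<bar>f x\<bar> * \<bar>B\<bar>" by (intro mult_left_mono) auto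
        then show ?thesis using True by (simp add: abs_mult mult.commute)
      qed auto
    qed
  qed
  then show ?thesis by (simp add: eq[symmetric])
qed

lemma locally_integrable_measurable:
  fixes f :: "real^'n::finite \<Rightarrow> real"
  assumes C: "open C" and f: "locally_integrable C f"
  shows "f \<in> borel_measurable (lebesgue_on C)"
proof -
  obtain a b :: "nat \<Rightarrow> real^'n" where ab: "\<And>k. cbox (a k) (b k) \<subseteq> C" "C \<subseteq> (\<Union>k. box (a k) (b k))"
    using open_countable_Union_boxes[OF C] by blast
  show ?thesis
  proof (rule measurable_piecewise_restrict[of "range (\<lambda>k. cbox (a k) (b k))"])
    show "space (lebesgue_on C) \<subseteq> \<Union> (range (\<lambda>k. cbox (a k) (b k)))"
      using ab(2) box_subset_cbox by fastforce
    show "X \<inter> space (lebesgue_on C) \<in> sets (lebesgue_on C)" if "X \<in> range (\<lambda>k. cbox (a k) (b k))" for X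
      using that C by (auto simp: sets_restrict_space image_iff)
    show "f \<in> borel_measurable (restrict_space (lebesgue_on C) X)" if X': "X \<in> range (\<lambda>k. cbox (a k) (b k))" for X
    proof -
      obtain k where X: "X = cbox (a k) (b k)" using X' by auto
      have "C \<inter> X = X" using X ab(1) by auto
      moreover have "integrable (lebesgue_on X) f"
        using f ab(1) X by (auto simp: locally_integrable_def)
      ultimately show ?thesis
        using C X by (simp add: restrict_restrict_space borel_measurable_integrable)
    qed
  qed auto
qed

lemma locally_integrable_diff:
  "locally_integrable C f \<Longrightarrow> locally_integrable C g \<Longrightarrow> locally_integrable C (\<lambda>x. f x - g x)"
  by (simp add: locally_integrable_def)

lemma locally_integrable_add:
  "locally_integrable C f \<Longrightarrow> locally_integrable C g \<Longrightarrow> locally_integrable C (\<lambda>x. f x + g x)"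
  by (simp add: locally_integrable_def)

lemma locally_integrable_cmult:
  "locally_integrable C f \<Longrightarrow> locally_integrable C (\<lambda>x. c * f x)"
  by (simp add: locally_integrable_def)

lemma AE_lebesgue_on_iff:
  "C \<in> sets lebesgue \<Longrightarrow> (AE x in lebesgue_on C. P x) \<longleftrightarrow> (AE x in lebesgue. x \<in> C \<longrightarrow> P x)"
  by (rule AE_restrict_space_iff) simp

lemma locally_integrable_bounded:
  fixes f :: "real^'n::finite \<Rightarrow> real"
  assumes C: "C \<in> sets lebesgue" and f: "f \<in> borel_measurable (lebesgue_on C)"
    and b: "AE x in lebesgue_on C. \<bar>f x\<bar> \<le> B"
  shows "locally_integrable C f"
  unfolding locally_integrable_def
proof safe
  fix K :: "(real^'n) set" assume K: "compact K" "K \<subseteq> C"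
  have Ks: "K \<in> sets lebesgue" using K(1) by (simp add: borel_compact)
  have "emeasure lebesgue K < \<infinity>"
    using emeasure_compact_finite[OF K(1)] borel_compact[OF K(1)] by simp
  then interpret finite_measure "lebesgue_on K"
    using Ks by (intro finite_measureI) (simp add: emeasure_restrict_space)
  show "integrable (lebesgue_on K) f"
  proof (rule integrable_const_bound)
    have "restrict_space (lebesgue_on C) K = lebesgue_on K"
      using C Ks K(2) by (simp add: restrict_restrict_space Int_absorb1)
    then show "f \<in> borel_measurable (lebesgue_on K)"
      using measurable_restrict_space1[OF f, of K] by simp
    show "AE x in lebesgue_on K. norm (f x) \<le> B"
      using b K(2) C Ks by (auto simp: AE_lebesgue_on_iff elim!: eventually_mono)
  qed
qed

section \<open>The fundamental lemma of the calculus of variations\<close>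

lemma integral_open_nonneg:
  fixes w :: "real^'n::finite \<Rightarrow> real"
  assumes w: "locally_integrable C w"
    and pos: "\<And>\<phi>. \<phi> \<in> test_functions C \<Longrightarrow> (\<And>x. 0 \<le> \<phi> x) \<Longrightarrow> 0 \<le> (LINT x|lebesgue. w x * \<phi> x)"
    and U: "open U" "U \<subseteq> K" "compact K" "K \<subseteq> C"
  shows "0 \<le> (LINT x|lebesgue. w x * indicator U x)"
proof -
  obtain \<phi> where \<phi>: "\<And>n. \<phi> n \<in> test_functions U" "\<And>n x. 0 \<le> \<phi> n x" "\<And>n x. \<phi> n x \<le> 1"
    "\<And>x. (\<lambda>n. \<phi> n x) \<longlonglongrightarrow> indicator U x"
    using test_functions_approx_open[OF U(1)] by metis
  have \<phi>C: "\<phi> n \<in> test_functions C" for n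
    using \<phi>(1) test_mono[of U C] U by blast
  have Ks: "K \<in> sets lebesgue" using U by (simp add: borel_compact)
  have "integrable (lebesgue_on K) w"
    using w U by (auto simp: locally_integrable_def)
  then have int: "integrable lebesgue (\<lambda>x. indicator K x * w x)"
    using Ks by (simp add: integrable_restrict_space)
  have zero: "\<phi> n x = 0" if "x \<notin> U" for n x
    using that test_functionE[OF \<phi>(1)] by (metis subsetD)
  have "(\<lambda>n. LINT x|lebesgue. w x * \<phi> n x) \<longlonglongrightarrow> (LINT x|lebesgue. w x * indicator U x)"
  proof (rule integral_dominated_convergence)
    show "(\<lambda>x. w x * indicator U x) \<in> borel_measurable lebesgue"
    proof -
      have "(\<lambda>x. indicator K x * w x * indicator U x) \<in> borel_measurable lebesgue"
        using U(1) by (intro borel_measurable_times[OF borel_measurable_integrable[OF int]] borel_measurable_indicator) simp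
      moreover have "indicator K x * w x * indicator U x = w x * indicator U x" for x
        using U(2) by (auto simp: indicator_def)
      ultimately show ?thesis by simp
    qed
    show "(\<lambda>x. w x * \<phi> n x) \<in> borel_measurable lebesgue" for n
      using integrable_test[OF w \<phi>C] by (rule borel_measurable_integrable)
    show "integrable lebesgue (\<lambda>x. \<bar>indicator K x * w x\<bar>)" using int by simp
    show "AE x in lebesgue. (\<lambda>n. w x * \<phi> n x) \<longlonglongrightarrow> w x * indicator U x"
      by (intro AE_I2 tendsto_intros \<phi>)
    show "AE x in lebesgue. norm (w x * \<phi> n x) \<le> \<bar>indicator K x * w x\<bar>" for n
    proof (intro AE_I2)
      fix x show "norm (w x * \<phi> n x) \<le> \<bar>indicator K x * w x\<bar>"
      proof (cases "x \<in> U")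
        case True
        then show ?thesis using U(2) \<phi>(2,3)[of n x] by (auto simp: abs_mult mult_left_le)
      qed (simp add: zero)
    qed
  qed
  then show ?thesis
    by (rule LIMSEQ_le_const) (use pos[OF \<phi>C \<phi>(2)] in auto)
qed

text \<open>
  The set \<open>A\<close> where \<open>w < 0\<close> is, up to a null set, the limit of a decreasing sequence of open sets. The
  integrals of \<open>w\<close> over these are nonnegative, hence so is the integral over \<open>A\<close>, which makes \<open>A\<close> a
  null set.
\<close>

lemma AE_nonneg_on_box:
  fixes w :: "real^'n::finite \<Rightarrow> real"
  assumes C: "open C" and w: "locally_integrable C w"
    and pos: "\<And>\<phi>. \<phi> \<in> test_functions C \<Longrightarrow> (\<And>x. 0 \<le> \<phi> x) \<Longrightarrow> 0 \<le> (LINT x|lebesgue. w x * \<phi> x)"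
    and ab: "cbox a b \<subseteq> C"
  shows "AE x in lebesgue. x \<in> box a b \<longrightarrow> 0 \<le> w x"
proof -
  let ?K = "cbox a b"
  define v where "v x = indicator ?K x * w x" for x
  have "integrable (lebesgue_on ?K) w"
    using w ab by (auto simp: locally_integrable_def)
  then have int: "integrable lebesgue v"
    by (simp add: integrable_restrict_space v_def[abs_def])
  then have v[measurable]: "v \<in> borel_measurable lebesgue" by (rule borel_measurable_integrable)
  define A where "A = {x. v x < 0} \<inter> box a b"
  have "{x \<in> space lebesgue. v x < 0} \<in> sets lebesgue" by measurable
  then have A[measurable]: "A \<in> sets lebesgue" unfolding A_def by (intro sets.Int) auto
  obtain G T where GT: "gdelta G" "T \<in> null_sets lebesgue" "A \<union> T = G" "disjnt A T"
    using lebesgue_set_almost_gdelta[OF A] by metis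
  obtain F :: "nat \<Rightarrow> (real^'n) set" where F: "\<And>n. open (F n)" "G = (\<Inter>n. F n)"
    using GT(1) by (auto elim!: gdelta.cases)
  \<comment> \<open>Finite intersections keep the sets open and make them decrease to \<open>G \<inter> box a b\<close>.\<close>
  define U where "U n = (\<Inter>k\<le>n. F k) \<inter> box a b" for n
  have U: "open (U n)" for n
    unfolding U_def using F(1) by (intro open_Int open_INT) auto
  have "(\<lambda>n. LINT x|lebesgue. w x * indicator (U n) x) \<longlonglongrightarrow> (LINT x|lebesgue. v x * indicator A x)"
  proof (rule integral_dominated_convergence)
    show "(\<lambda>x. v x * indicator A x) \<in> borel_measurable lebesgue" by measurable
    have eq: "w x * indicator (U n) x = v x * indicator (U n) x" for x n
      using box_subset_cbox[of a b] by (auto simp: v_def U_def indicator_def)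
    have [measurable]: "U n \<in> sets lebesgue" for n using U by simp
    show "(\<lambda>x. w x * indicator (U n) x) \<in> borel_measurable lebesgue" for n
      unfolding eq by measurable
    show "integrable lebesgue (\<lambda>x. \<bar>v x\<bar>)" using int by simp
    show "AE x in lebesgue. norm (w x * indicator (U n) x) \<le> \<bar>v x\<bar>" for n
      unfolding eq by (auto simp: indicator_def)
    have "AE x in lebesgue. x \<notin> T" using GT(2) by (rule AE_not_in)
    then show "AE x in lebesgue. (\<lambda>n. w x * indicator (U n) x) \<longlonglongrightarrow> v x * indicator A x"
    proof eventually_elim
      case (elim x)
      have "\<forall>\<^sub>F n in sequentially. indicator A x = (indicator (U n) x :: real)"
      proof (cases "x \<in> A")
        case True
        then have "x \<in> U n" for n using GT(3) F(2) by (auto simp: U_def A_def)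
        then show ?thesis using True by simp
      next
        case False
        show ?thesis
        proof (cases "x \<in> box a b")
          case True
          have "x \<notin> G" using False elim GT(3) by auto
          then obtain k where k: "x \<notin> F k" using F(2) by auto
          show ?thesis using eventually_ge_at_top[of k]
            by eventually_elim (use False k in \<open>auto simp: U_def indicator_def\<close>)
        qed (use False in \<open>simp add: U_def\<close>)
      qed
      then have "\<forall>\<^sub>F n in sequentially. v x * indicator A x = w x * indicator (U n) x"
        by eventually_elim (simp add: eq)
      then show ?case by (rule tendsto_eventually[OF eventually_mono]) simp
    qed
  qed
  moreover have "0 \<le> (LINT x|lebesgue. w x * indicator (U n) x)" for n
    using U box_subset_cbox[of a b] ab
    by (intro integral_open_nonneg[OF w pos, of _ ?K]) (auto simp: U_def)
  ultimately have ge: "0 \<le> (LINT x|lebesgue. v x * indicator A x)"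
    by (intro LIMSEQ_le_const) auto
  have le: "v x * indicator A x \<le> 0" for x
    by (auto simp: A_def indicator_def)
  have intA: "integrable lebesgue (\<lambda>x. v x * indicator A x)"
    by (rule Bochner_Integration.integrable_bound[OF int]) (auto simp: indicator_def)
  have "(LINT x|lebesgue. - (v x * indicator A x)) = 0"
    using ge Bochner_Integration.integral_nonneg[of lebesgue "\<lambda>x. - (v x * indicator A x)"] le
    by (simp add: antisym)
  then have "AE x in lebesgue. - (v x * indicator A x) = 0"
    using integral_nonneg_eq_0_iff_AE[of lebesgue "\<lambda>x. - (v x * indicator A x)"] intA le by simp
  then show ?thesis
  proof eventually_elim
    case (elim x)
    show ?case
    proof
      assume x: "x \<in> box a b"
      then have "v x = w x" using box_subset_cbox[of a b] by (auto simp: v_def)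
      moreover have "\<not> v x < 0"
        using elim x by (auto simp: A_def)
      ultimately show "0 \<le> w x" by simp
    qed
  qed
qed

text \<open>
  This one-sided form turns an inequality between integrals against nonnegative test functions into
  an inequality almost everywhere. It yields both the uniqueness of distributional derivatives and the
  pointwise error bound for the mixed difference.
\<close>

lemma fundamental_lemma_nonneg:
  fixes w :: "real^'n::finite \<Rightarrow> real"
  assumes C: "open C" and w: "locally_integrable C w"
    and pos: "\<And>\<phi>. \<phi> \<in> test_functions C \<Longrightarrow> (\<And>x. 0 \<le> \<phi> x) \<Longrightarrow> 0 \<le> (LINT x|lebesgue. w x * \<phi> x)"
  shows "AE x in lebesgue_on C. 0 \<le> w x"
proof -
  obtain a b :: "nat \<Rightarrow> real^'n" where ab: "\<And>k. cbox (a k) (b k) \<subseteq> C" "C \<subseteq> (\<Union>k. box (a k) (b k))"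
    using open_countable_Union_boxes[OF C] by blast
  have "AE x in lebesgue. \<forall>k. x \<in> box (a k) (b k) \<longrightarrow> 0 \<le> w x"
    unfolding AE_all_countable by (intro allI AE_nonneg_on_box[OF C w _ ab(1)] pos)
  then have "AE x in lebesgue. x \<in> C \<longrightarrow> 0 \<le> w x"
    by eventually_elim (use ab(2) in blast)
  then show ?thesis using C by (simp add: AE_lebesgue_on_iff)
qed

lemma fundamental_lemma:
  fixes g k :: "real^'n::finite \<Rightarrow> real"
  assumes C: "open C" and g: "locally_integrable C g" and k: "locally_integrable C k"
    and eq: "\<And>\<phi>. \<phi> \<in> test_functions C \<Longrightarrow> (LINT x|lebesgue. g x * \<phi> x) = (LINT x|lebesgue. k x * \<phi> x)"
  shows "AE x in lebesgue_on C. g x = k x"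
proof -
  have nonneg: "AE x in lebesgue_on C. 0 \<le> u x - v x"
    if u: "locally_integrable C u" and v: "locally_integrable C v"
      and uv: "\<And>\<phi>. \<phi> \<in> test_functions C \<Longrightarrow> (LINT x|lebesgue. u x * \<phi> x) = (LINT x|lebesgue. v x * \<phi> x)"
    for u v :: "real^'n \<Rightarrow> real"
  proof (rule fundamental_lemma_nonneg[OF C locally_integrable_diff[OF u v]])
    fix \<phi> :: "real^'n \<Rightarrow> real" assume \<phi>: "\<phi> \<in> test_functions C"
    show "0 \<le> (LINT x|lebesgue. (u x - v x) * \<phi> x)"
      by (simp add: left_diff_distrib integrable_test[OF u \<phi>] integrable_test[OF v \<phi>] uv[OF \<phi>])
  qed
  have "AE x in lebesgue_on C. 0 \<le> g x - k x" "AE x in lebesgue_on C. 0 \<le> k x - g x"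
    using nonneg[OF g k eq] nonneg[OF k g eq[symmetric]] by auto
  then show ?thesis by eventually_elim simp
qed

lemma distr_deriv_unique:
  assumes "open C" "has_distr_deriv C is f g" "has_distr_deriv C is f k"
  shows "AE x in lebesgue_on C. g x = k x"
proof (rule fundamental_lemma[OF assms(1)])
  fix \<phi> :: "real^'a \<Rightarrow> real" assume \<phi>: "\<phi> \<in> test_functions C"
  have "(LINT x|lebesgue. f x * iterated_partial_deriv is \<phi> x) = (- 1) ^ length is * (LINT x|lebesgue. g x * \<phi> x)"
    "(LINT x|lebesgue. f x * iterated_partial_deriv is \<phi> x) = (- 1) ^ length is * (LINT x|lebesgue. k x * \<phi> x)"
    using assms(2,3) \<phi> unfolding has_distr_deriv_iff[OF assms(1)] by blast+
  then show "(LINT x|lebesgue. g x * \<phi> x) = (LINT x|lebesgue. k x * \<phi> x)" by simp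
qed (use assms in \<open>auto simp: has_distr_deriv_def\<close>)

lemma has_distr_deriv_distr_deriv:
  assumes "has_distr_deriv C is f g" shows "has_distr_deriv C is f (distr_deriv C is f)"
  unfolding distr_deriv_def by (rule someI[of _ g]) (rule assms)

lemma integral_AE_cong_test:
  assumes C: "open C" and \<phi>: "\<phi> \<in> test_functions C" and eq: "AE x in lebesgue_on C. f x = g x"
    and f: "locally_integrable C f" and g: "locally_integrable C g"
  shows "(LINT x|lebesgue. f x * \<phi> x) = (LINT x|lebesgue. g x * \<phi> x)"
proof (rule integral_cong_AE)
  obtain K where K: "K \<subseteq> C" "\<And>x. x \<notin> K \<Longrightarrow> \<phi> x = 0"
    using test_functionE[OF \<phi>] by metis
  have "AE x in lebesgue. x \<in> C \<longrightarrow> f x = g x" using eq C by (simp add: AE_lebesgue_on_iff)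
  then show "AE x in lebesgue. f x * \<phi> x = g x * \<phi> x"
    by eventually_elim (use K in force)
qed (use integrable_test[OF _ \<phi>] f g in \<open>auto intro!: borel_measurable_integrable\<close>)

section \<open>The norm of essentially bounded functions\<close>

lemma Linf_norm_leI:
  "f \<in> borel_measurable M \<Longrightarrow> AE x in M. \<bar>f x\<bar> \<le> c \<Longrightarrow> Linf_norm M f \<le> ereal c"
  unfolding Linf_norm_def by (rule esssup_I) auto

lemma Linf_norm_AE: "Linf_norm M f \<le> ereal c \<Longrightarrow> AE x in M. \<bar>f x\<bar> \<le> c"
proof -
  assume le: "Linf_norm M f \<le> ereal c"
  have "AE x in M. ereal \<bar>f x\<bar> \<le> Linf_norm M f" unfolding Linf_norm_def by (rule esssup_AE)
  then show ?thesis
  proof eventually_elim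
    case (elim x)
    then have "ereal \<bar>f x\<bar> \<le> ereal c" using le by (rule order_trans)
    then show ?case by simp
  qed
qed

lemma Linf_AE_bound:
  assumes "f \<in> Linf M" obtains B where "0 \<le> B" "AE x in M. \<bar>f x\<bar> \<le> B"
proof -
  have "Linf_norm M f < \<infinity>" using assms by (simp add: Linf_def)
  then obtain B where "Linf_norm M f \<le> ereal B"
    by (cases "Linf_norm M f") (auto intro: that)
  then have "AE x in M. \<bar>f x\<bar> \<le> B" by (rule Linf_norm_AE)
  then have "AE x in M. \<bar>f x\<bar> \<le> max B 0" by eventually_elim simp
  then show thesis by (intro that[of "max B 0"]) auto
qed

lemma LinfI: "f \<in> borel_measurable M \<Longrightarrow> AE x in M. \<bar>f x\<bar> \<le> c \<Longrightarrow> f \<in> Linf M"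
  using Linf_norm_leI[of f M c] by (auto simp: Linf_def intro: le_less_trans)

lemma Linf_measurable: "f \<in> Linf M \<Longrightarrow> f \<in> borel_measurable M"
  by (simp add: Linf_def)

lemma Linf_norm_cong_AE:
  assumes "f \<in> borel_measurable M" "g \<in> borel_measurable M" "AE x in M. f x = g x"
  shows "Linf_norm M f = Linf_norm M g"
  unfolding Linf_norm_def using assms by (intro esssup_AE_cong) auto

section \<open>Averages of test functions along segments\<close>

text \<open>
  Integration of \<open>\<phi>\<close> over the translates along a segment in direction \<open>v\<close>. Along an axis it is the
  primitive that inverts a partial derivative; along a general vector it interpolates between two
  translates of \<open>\<phi>\<close>.
\<close>

definition smear :: "real \<Rightarrow> real \<Rightarrow> real^'n::finite \<Rightarrow> (real^'n \<Rightarrow> real) \<Rightarrow> real^'n \<Rightarrow> real" where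
  "smear a b v \<phi> y = integral {a..b} (\<lambda>s. \<phi> (y - s *\<^sub>R v))"

lemma continuous_along_line:
  "smooth_function \<phi> \<Longrightarrow> continuous_on S (\<lambda>s. \<phi> (y - s *\<^sub>R v))"
  by (rule continuous_on_compose2[OF smooth_continuous[of _ UNIV]]) (auto intro!: continuous_intros)

text \<open>
  Differentiation under the integral sign. The derivative is assembled from the partial derivatives as
  an operator-valued integrand, so that full differentiability of the average is obtained at once.
\<close>

lemma smear_has_derivative:
  fixes \<phi> :: "real^'n::finite \<Rightarrow> real"
  assumes \<phi>: "smooth_function \<phi>"
  shows "(smear a b v \<phi> has_derivative (\<lambda>u. \<Sum>i\<in>UNIV. u $ i * smear a b v (partial_deriv i \<phi>) y)) (at y)"
proof -
  define f where "f y s = \<phi> (y - s *\<^sub>R v)" for y s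
  define fx where "fx y s = (\<Sum>i\<in>UNIV. partial_deriv i \<phi> (y - s *\<^sub>R v) *\<^sub>R blinfun_inner_left (axis i 1 :: real^'n))" for y s
  have fx_apply: "blinfun_apply (fx y s) = (\<lambda>u. \<Sum>i\<in>UNIV. u $ i * partial_deriv i \<phi> (y - s *\<^sub>R v))" for y s
    by (rule ext) (simp add: fx_def blinfun.sum_left blinfun.scaleR_left inner_axis mult.commute)
  have "((\<lambda>y. integral (cbox a b) (f y)) has_derivative blinfun_apply (integral (cbox a b) (fx y))) (at y within UNIV)"
  proof (rule leibniz_rule)
    show "((\<lambda>x. f x t) has_derivative blinfun_apply (fx x t)) (at x within UNIV)" for x t
    proof -
      have "((\<lambda>x. x - t *\<^sub>R v) has_derivative (\<lambda>u. u)) (at x)"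
        by (auto intro!: derivative_eq_intros)
      from has_derivative_compose[OF this smooth_has_derivative[OF \<phi>]]
      show ?thesis unfolding f_def fx_apply by simp
    qed
    show "f x integrable_on cbox a b" for x
      unfolding f_def using continuous_along_line[OF \<phi>] by (intro integrable_continuous)
    have "continuous_on (UNIV \<times> cbox a b) (\<lambda>p. partial_deriv i \<phi> (fst p - snd p *\<^sub>R v))" for i
      by (rule continuous_on_compose2[OF smooth_continuous[OF smooth_partial[OF \<phi>], of UNIV]])
        (auto intro!: continuous_intros)
    then show "continuous_on (UNIV \<times> cbox a b) (\<lambda>(x, t). fx x t)"
      unfolding fx_def split_beta by (intro continuous_intros) auto
  qed auto
  moreover have "integral (cbox a b) (fx y) = (\<Sum>i\<in>UNIV. smear a b v (partial_deriv i \<phi>) y *\<^sub>R blinfun_inner_left (axis i 1 :: real^'n))"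
    unfolding fx_def smear_def cbox_interval
    by (intro integral_unique has_integral_sum has_integral_scaleR_left integrable_integral
        integrable_continuous_interval continuous_along_line smooth_partial \<phi>) simp
  moreover have "blinfun_apply (\<Sum>i\<in>UNIV. smear a b v (partial_deriv i \<phi>) y *\<^sub>R blinfun_inner_left (axis i 1 :: real^'n))
      = (\<lambda>u. \<Sum>i\<in>UNIV. u $ i * smear a b v (partial_deriv i \<phi>) y)"
    by (rule ext) (simp add: blinfun.sum_left blinfun.scaleR_left inner_axis mult.commute)
  ultimately show ?thesis
    by (simp add: smear_def[abs_def] f_def[abs_def])
qed

lemma smear_smooth: "smooth_function \<phi> \<Longrightarrow> smooth_function (smear a b v \<phi>)"
  by (rule smooth_commuting(1)[OF smear_has_derivative])

lemma smear_partial: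
  "smooth_function \<phi> \<Longrightarrow> partial_deriv i (smear a b v \<phi>) = smear a b v (partial_deriv i \<phi>)"
  by (rule smooth_commuting(2)[OF smear_has_derivative])

text \<open>
  The fundamental theorem of calculus on the segment: a difference of two translates of a test function
  is a directional derivative of another test function, and can therefore be moved onto a weakly
  differentiable function.
\<close>

lemma smear_directional_derivative:
  assumes \<phi>: "smooth_function \<phi>" and "a \<le> b"
  shows "(\<Sum>i\<in>UNIV. v $ i * partial_deriv i (smear a b v \<phi>) y) = \<phi> (y - a *\<^sub>R v) - \<phi> (y - b *\<^sub>R v)"
proof -
  let ?d = "\<lambda>s. \<Sum>i\<in>UNIV. v $ i * partial_deriv i \<phi> (y - s *\<^sub>R v)"
  have "((\<lambda>s. - \<phi> (y - s *\<^sub>R v)) has_vector_derivative ?d s) (at s within {a..b})" for s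
  proof -
    have "((\<lambda>s. y - s *\<^sub>R v) has_derivative (\<lambda>u. - (u *\<^sub>R v))) (at s within {a..b})"
      by (auto intro!: derivative_eq_intros)
    from has_derivative_compose[OF this smooth_has_derivative[OF \<phi>]]
    have "((\<lambda>s. \<phi> (y - s *\<^sub>R v)) has_derivative (\<lambda>u. u * - ?d s)) (at s within {a..b})"
      by (simp add: sum_distrib_left sum_negf mult.assoc)
    then have "((\<lambda>s. \<phi> (y - s *\<^sub>R v)) has_vector_derivative - ?d s) (at s within {a..b})"
      by (simp add: has_vector_derivative_def)
    from has_vector_derivative_minus[OF this] show ?thesis by simp
  qed
  then have "(?d has_integral (- \<phi> (y - b *\<^sub>R v) - - \<phi> (y - a *\<^sub>R v))) {a..b}"
    using assms(2) by (intro fundamental_theorem_of_calculus) auto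
  moreover have "(?d has_integral (\<Sum>i\<in>UNIV. v $ i * smear a b v (partial_deriv i \<phi>) y)) {a..b}"
    unfolding smear_def
    by (intro has_integral_sum has_integral_mult_right integrable_integral
        integrable_continuous_interval continuous_along_line smooth_partial \<phi>) simp
  ultimately have "- \<phi> (y - b *\<^sub>R v) - - \<phi> (y - a *\<^sub>R v) = (\<Sum>i\<in>UNIV. v $ i * smear a b v (partial_deriv i \<phi>) y)"
    by (rule has_integral_unique)
  then show ?thesis by (simp add: smear_partial[OF \<phi>])
qed

lemma smear_test:
  assumes \<phi>: "\<phi> \<in> test_functions C" and shift: "\<And>x s. x \<in> C \<Longrightarrow> a \<le> s \<Longrightarrow> s \<le> b \<Longrightarrow> x + s *\<^sub>R v \<in> C"
  shows "smear a b v \<phi> \<in> test_functions C"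
proof -
  obtain K where K: "smooth_function \<phi>" "compact K" "K \<subseteq> C" "\<And>x. x \<notin> K \<Longrightarrow> \<phi> x = 0"
    using test_functionE[OF \<phi>] by metis
  let ?L = "(\<lambda>p. fst p + snd p *\<^sub>R v) ` (K \<times> {a..b})"
  show ?thesis
  proof (rule test_functionI[of _ ?L])
    show "compact ?L"
      using K(2) by (intro compact_continuous_image compact_Times) (auto intro!: continuous_intros)
    show "?L \<subseteq> C" using K(3) shift by auto
    show "y \<in> ?L" if "smear a b v \<phi> y \<noteq> 0" for y
    proof (rule ccontr)
      assume y: "y \<notin> ?L"
      have "\<phi> (y - s *\<^sub>R v) = 0" if s: "s \<in> {a..b}" for s
      proof (rule K(4), rule notI)
        assume "y - s *\<^sub>R v \<in> K"
        then have "y \<in> ?L" using s by (intro image_eqI[of _ _ "(y - s *\<^sub>R v, s)"]) auto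
        with y show False ..
      qed
      then have "smear a b v \<phi> y = integral {a..b} (\<lambda>s. 0)"
        unfolding smear_def by (intro integral_cong) auto
      then show False using that by simp
    qed
  qed (simp add: smear_smooth[OF K(1)])
qed

lemma smear_nonneg:
  "smooth_function \<phi> \<Longrightarrow> (\<And>x. 0 \<le> \<phi> x) \<Longrightarrow> 0 \<le> smear a b v \<phi> y"
  unfolding smear_def
  by (intro integral_nonneg integrable_continuous_interval continuous_along_line) auto

lemma smooth_borel: "smooth_function \<phi> \<Longrightarrow> \<phi> \<in> borel_measurable borel"
  by (intro borel_measurable_continuous_onI smooth_continuous)

lemma integrable_test_function:
  "\<phi> \<in> test_functions C \<Longrightarrow> integrable lebesgue \<phi>"
  "\<phi> \<in> test_functions C \<Longrightarrow> integrable lborel \<phi>"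
proof -
  assume \<phi>: "\<phi> \<in> test_functions C"
  have "locally_integrable UNIV (\<lambda>_::real^'a. 1)"
    by (rule locally_integrable_bounded[of _ _ 1]) auto
  moreover have "\<phi> \<in> test_functions UNIV" using \<phi> test_mono[of C UNIV] by auto
  ultimately show 1: "integrable lebesgue \<phi>"
    using integrable_test[of UNIV "\<lambda>_. 1" \<phi>] by simp
  have "\<phi> \<in> borel_measurable borel" using \<phi> by (intro smooth_borel) (auto simp: test_functions_def)
  then show "integrable lborel \<phi>" using 1 by (simp add: integrable_completion)
qed

lemma nn_integral_lborel_translate:
  fixes f :: "'a::euclidean_space \<Rightarrow> ennreal"
  assumes [measurable]: "f \<in> borel_measurable borel"
  shows "(\<integral>\<^sup>+y. f (y - t) \<partial>lborel) = (\<integral>\<^sup>+y. f y \<partial>lborel)"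
proof -
  have "(\<integral>\<^sup>+y. f y \<partial>lborel) = (\<integral>\<^sup>+y. f y \<partial>(distr lborel borel ((+) (-t))))"
    by (simp add: lborel_distr_plus)
  also have "\<dots> = (\<integral>\<^sup>+y. f (-t + y) \<partial>lborel)" by (intro nn_integral_distr) auto
  finally show ?thesis by simp
qed

lemma integral_smear:
  assumes \<phi>: "\<phi> \<in> test_functions C" and nonneg: "\<And>x. 0 \<le> \<phi> x"
    and shift: "\<And>x s. x \<in> C \<Longrightarrow> 0 \<le> s \<Longrightarrow> s \<le> 1 \<Longrightarrow> x + s *\<^sub>R v \<in> C"
  shows "(LINT y|lebesgue. smear 0 1 v \<phi> y) = (LINT y|lebesgue. \<phi> y)"
proof -
  have sm: "smooth_function \<phi>" using \<phi> by (simp add: test_functions_def)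
  have [measurable]: "\<phi> \<in> borel_measurable borel" using sm by (rule smooth_borel)
  have eq: "ennreal (smear 0 1 v \<phi> y) = (\<integral>\<^sup>+s. ennreal (\<phi> (y - s *\<^sub>R v)) * indicator {0..1} s \<partial>lborel)" for y
  proof -
    have "((\<lambda>s. \<phi> (y - s *\<^sub>R v)) has_integral smear 0 1 v \<phi> y) {0..1}"
      unfolding smear_def
      by (intro integrable_integral integrable_continuous_interval continuous_along_line sm)
    then have "((\<lambda>s. if s \<in> {0..1} then \<phi> (y - s *\<^sub>R v) else 0) has_integral smear 0 1 v \<phi> y) UNIV"
      by (simp only: has_integral_restrict_UNIV)
    then have "(\<integral>\<^sup>+s. ennreal (if s \<in> {0..1} then \<phi> (y - s *\<^sub>R v) else 0) \<partial>lborel) = ennreal (smear 0 1 v \<phi> y)"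
      by (intro nn_integral_has_integral_lborel) (auto simp: nonneg)
    moreover have "ennreal (if s \<in> {0..1} then \<phi> (y - s *\<^sub>R v) else 0) = ennreal (\<phi> (y - s *\<^sub>R v)) * indicator {0..1} s" for s
      by (simp add: indicator_def)
    ultimately show ?thesis by simp
  qed
  have "(\<integral>\<^sup>+y. ennreal (smear 0 1 v \<phi> y) \<partial>lborel)
      = (\<integral>\<^sup>+s. \<integral>\<^sup>+y. ennreal (\<phi> (y - s *\<^sub>R v)) * indicator {0..1} s \<partial>lborel \<partial>lborel)"
    unfolding eq by (rule lborel_pair.Fubini'[symmetric]) measurable
  also have "\<dots> = (\<integral>\<^sup>+s. (\<integral>\<^sup>+y. ennreal (\<phi> y) \<partial>lborel) * indicator {0..1} s \<partial>(lborel :: real measure))"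
  proof (rule nn_integral_cong)
    fix s
    have "(\<integral>\<^sup>+y. ennreal (\<phi> (y - s *\<^sub>R v)) * indicator {0..1} s \<partial>lborel)
        = (\<integral>\<^sup>+y. ennreal (\<phi> (y - s *\<^sub>R v)) \<partial>lborel) * indicator {0..1} s"
      by (rule nn_integral_multc) measurable
    then show "(\<integral>\<^sup>+y. ennreal (\<phi> (y - s *\<^sub>R v)) * indicator {0..1} s \<partial>lborel)
        = (\<integral>\<^sup>+y. ennreal (\<phi> y) \<partial>lborel) * indicator {0..1} s"
      using nn_integral_lborel_translate[of "\<lambda>y. ennreal (\<phi> y)"] by simp
  qed
  also have "\<dots> = (\<integral>\<^sup>+y. ennreal (\<phi> y) \<partial>lborel)"
    by (simp add: nn_integral_cmult_indicator)
  finally have "(\<integral>\<^sup>+y. ennreal (smear 0 1 v \<phi> y) \<partial>lborel) = (\<integral>\<^sup>+y. ennreal (\<phi> y) \<partial>lborel)" .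
  then have "(\<integral>\<^sup>+y. ennreal (smear 0 1 v \<phi> y) \<partial>lebesgue) = (\<integral>\<^sup>+y. ennreal (\<phi> y) \<partial>lebesgue)"
    by (simp add: nn_integral_completion)
  moreover have "smear 0 1 v \<phi> \<in> borel_measurable lebesgue" "\<phi> \<in> borel_measurable lebesgue"
    using integrable_test_function[OF smear_test[OF \<phi> shift]] integrable_test_function[OF \<phi>]
    by (auto intro: borel_measurable_integrable)
  ultimately show ?thesis
    by (simp add: integral_eq_nn_integral nonneg smear_nonneg[OF sm])
qed

text \<open>
  Dual form of the statement that a function whose gradient has \<open>\<ell>\<^sub>1\<close>-norm at most \<open>1\<close> is Lipschitz with
  constant \<open>1\<close> for the maximum norm. As \<open>\<phi> - \<phi>(\<cdot> - v)\<close> is the derivative in direction \<open>v\<close> of the average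
  \<open>\<Phi> = smear 0 1 v \<phi>\<close>, the pairing equals that of \<open>- (\<Sum>\<^sub>i v\<^sub>i h\<^sub>i)\<close> with \<open>\<Phi>\<close>, and \<open>\<Phi>\<close> has the same integral
  as \<open>\<phi>\<close>.
\<close>

lemma weak_lipschitz_bound:
  fixes g :: "real^'n::finite \<Rightarrow> real"
  assumes C: "open C" and h: "\<And>i. has_distr_deriv C [i] g (h i)"
    and h1: "AE x in lebesgue_on C. (\<Sum>i\<in>UNIV. \<bar>h i x\<bar>) \<le> 1"
    and \<phi>: "\<phi> \<in> test_functions C" and nonneg: "\<And>x. 0 \<le> \<phi> x"
    and shift: "\<And>x s. x \<in> C \<Longrightarrow> 0 \<le> s \<Longrightarrow> s \<le> 1 \<Longrightarrow> x + s *\<^sub>R v \<in> C"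
    and v: "\<And>i. \<bar>v $ i\<bar> \<le> r"
  shows "\<bar>(LINT x|lebesgue. g x * \<phi> x) - (LINT x|lebesgue. g x * \<phi> (x - v))\<bar> \<le> r * (LINT x|lebesgue. \<phi> x)"
proof -
  have sm: "smooth_function \<phi>" using \<phi> by (simp add: test_functions_def)
  have r0: "0 \<le> r" using v abs_ge_zero order_trans by blast
  have g: "locally_integrable C g" and hi: "\<And>i. locally_integrable C (h i)"
    using h by (auto simp: has_distr_deriv_def)
  have \<phi>v: "(\<lambda>x. \<phi> (x - v)) \<in> test_functions C"
    using shift[of _ 1] by (intro test_translate \<phi>) auto
  define \<Phi> where "\<Phi> = smear 0 1 v \<phi>"
  have \<Phi>: "\<Phi> \<in> test_functions C" unfolding \<Phi>_def by (rule smear_test[OF \<phi> shift])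
  have \<Phi>0: "0 \<le> \<Phi> x" for x unfolding \<Phi>_def by (rule smear_nonneg[OF sm nonneg])
  have int\<Phi>: "integrable lebesgue (\<lambda>x. h i x * \<Phi> x)" for i by (rule integrable_test[OF hi \<Phi>])
  have "(LINT x|lebesgue. g x * \<phi> x) - (LINT x|lebesgue. g x * \<phi> (x - v))
      = (LINT x|lebesgue. g x * \<phi> x - g x * \<phi> (x - v))"
    using integrable_test[OF g \<phi>] integrable_test[OF g \<phi>v] by simp
  also have "\<dots> = (LINT x|lebesgue. (\<Sum>i\<in>UNIV. v $ i * (g x * partial_deriv i \<Phi> x)))"
  proof (rule Bochner_Integration.integral_cong[OF refl])
    fix x
    have "\<phi> x - \<phi> (x - v) = (\<Sum>i\<in>UNIV. v $ i * partial_deriv i \<Phi> x)"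
      using smear_directional_derivative[OF sm, of 0 1 v x] by (simp add: \<Phi>_def)
    then have "g x * (\<phi> x - \<phi> (x - v)) = g x * (\<Sum>i\<in>UNIV. v $ i * partial_deriv i \<Phi> x)" by simp
    then show "g x * \<phi> x - g x * \<phi> (x - v) = (\<Sum>i\<in>UNIV. v $ i * (g x * partial_deriv i \<Phi> x))"
      by (simp add: right_diff_distrib sum_distrib_left mult.left_commute)
  qed
  also have "\<dots> = (\<Sum>i\<in>UNIV. v $ i * (LINT x|lebesgue. g x * partial_deriv i \<Phi> x))"
    using integrable_test[OF g test_partial[OF \<Phi>]] by simp
  also have "\<dots> = (\<Sum>i\<in>UNIV. v $ i * - (LINT x|lebesgue. h i x * \<Phi> x))"
    using h \<Phi> by (simp add: has_distr_deriv_iff[OF C])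
  also have "\<dots> = - (LINT x|lebesgue. (\<Sum>i\<in>UNIV. v $ i * (h i x * \<Phi> x)))"
    using int\<Phi> by (simp add: sum_negf)
  finally have eq: "(LINT x|lebesgue. g x * \<phi> x) - (LINT x|lebesgue. g x * \<phi> (x - v))
    = - (LINT x|lebesgue. (\<Sum>i\<in>UNIV. v $ i * (h i x * \<Phi> x)))" .
  have "\<bar>LINT x|lebesgue. (\<Sum>i\<in>UNIV. v $ i * (h i x * \<Phi> x))\<bar>
      \<le> (LINT x|lebesgue. \<bar>\<Sum>i\<in>UNIV. v $ i * (h i x * \<Phi> x)\<bar>)"
    by (rule integral_abs_bound)
  also have "\<dots> \<le> (LINT x|lebesgue. r * \<Phi> x)"
  proof (rule integral_mono_AE)
    have zero: "\<Phi> x = 0" if "x \<notin> C" for x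
      using that test_functionE[OF \<Phi>] by (metis subsetD)
    have "AE x in lebesgue. x \<in> C \<longrightarrow> (\<Sum>i\<in>UNIV. \<bar>h i x\<bar>) \<le> 1"
      using h1 C by (simp add: AE_lebesgue_on_iff)
    then show "AE x in lebesgue. \<bar>\<Sum>i\<in>UNIV. v $ i * (h i x * \<Phi> x)\<bar> \<le> r * \<Phi> x"
    proof eventually_elim
      case (elim x)
      show ?case
      proof (cases "x \<in> C")
        case True
        have "\<bar>\<Sum>i\<in>UNIV. v $ i * (h i x * \<Phi> x)\<bar> \<le> (\<Sum>i\<in>UNIV. \<bar>v $ i * (h i x * \<Phi> x)\<bar>)"
          by (rule sum_abs)
        also have "\<dots> \<le> (\<Sum>i\<in>UNIV. r * (\<bar>h i x\<bar> * \<Phi> x))"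
          by (intro sum_mono) (simp add: abs_mult \<Phi>0 mult_right_mono v)
        also have "\<dots> = r * \<Phi> x * (\<Sum>i\<in>UNIV. \<bar>h i x\<bar>)"
          by (simp add: sum_distrib_left sum_distrib_right ac_simps)
        also have "\<dots> \<le> r * \<Phi> x * 1"
          using elim True r0 \<Phi>0[of x] by (intro mult_left_mono) auto
        finally show ?thesis by simp
      qed (simp add: zero)
    qed
  qed (use int\<Phi> integrable_test_function[OF \<Phi>] in auto)
  also have "\<dots> = r * (LINT x|lebesgue. \<phi> x)"
    using integral_smear[OF \<phi> nonneg shift] by (simp add: \<Phi>_def)
  finally show ?thesis unfolding eq by simp
qed

section \<open>Mixed differences\<close>

text \<open>
  The averages and the differences \<open>backward_diff\<close> act on test functions, the differences
  \<open>forward_diff\<close> on essentially bounded functions. The two differences are adjoint to each other up to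
  sign. Passing to the adjoint reverses the order of composition, so a \<open>fold\<close> over the coordinates on
  one side corresponds to a \<open>foldr\<close> on the other.
\<close>

definition axis_smear :: "('n::finite \<Rightarrow> real) \<Rightarrow> ('n \<Rightarrow> real) \<Rightarrow> 'n \<Rightarrow> (real^'n \<Rightarrow> real) \<Rightarrow> real^'n \<Rightarrow> real" where
  "axis_smear a b i = smear (a i) (b i) (axis i 1)"

definition backward_diff :: "('n::finite \<Rightarrow> real) \<Rightarrow> ('n \<Rightarrow> real) \<Rightarrow> 'n \<Rightarrow> (real^'n \<Rightarrow> real) \<Rightarrow> real^'n \<Rightarrow> real" where
  "backward_diff a b i \<phi> y = \<phi> (y - axis i (a i)) - \<phi> (y - axis i (b i))"

definition forward_diff :: "('n::finite \<Rightarrow> real) \<Rightarrow> ('n \<Rightarrow> real) \<Rightarrow> 'n \<Rightarrow> (real^'n \<Rightarrow> real) \<Rightarrow> real^'n \<Rightarrow> real" where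
  "forward_diff a b i f x = f (x + axis i (b i)) - f (x + axis i (a i))"

lemma scaleR_axis_1: "s *\<^sub>R axis i (1::real) = axis i s"
  by (simp add: vec_eq_iff axis_def)

lemma partial_axis_smear:
  assumes "smooth_function \<phi>" "a i \<le> b i"
  shows "partial_deriv i (axis_smear a b i \<phi>) = backward_diff a b i \<phi>"
proof
  fix y
  have "partial_deriv i (axis_smear a b i \<phi>) y = (\<Sum>j\<in>UNIV. axis i 1 $ j * partial_deriv j (axis_smear a b i \<phi>) y)"
    by (simp add: axis_def if_distrib if_distribR cong: if_cong)
  also have "\<dots> = backward_diff a b i \<phi> y"
    using smear_directional_derivative[OF assms, of "axis i 1" y]
    by (simp add: axis_smear_def backward_diff_def scaleR_axis_1)
  finally show "partial_deriv i (axis_smear a b i \<phi>) y = backward_diff a b i \<phi> y" .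
qed

lemma backward_diff_has_derivative:
  assumes "smooth_function \<phi>"
  shows "(backward_diff a b i \<phi> has_derivative
    (\<lambda>v. \<Sum>j\<in>UNIV. v $ j * backward_diff a b i (partial_deriv j \<phi>) y)) (at y)"
  unfolding backward_diff_def[abs_def] right_diff_distrib sum_subtractf
  by (intro has_derivative_diff translate_has_derivative assms)

lemma backward_diff_smooth:
  "smooth_function \<phi> \<Longrightarrow> smooth_function (backward_diff a b i \<phi>)"
  by (rule smooth_commuting(1)[OF backward_diff_has_derivative])

lemma backward_diff_partial:
  "smooth_function \<phi> \<Longrightarrow> partial_deriv j (backward_diff a b i \<phi>) = backward_diff a b i (partial_deriv j \<phi>)"
  by (rule smooth_commuting(2)[OF backward_diff_has_derivative])

lemma fold_backward_diff_partial:
  "smooth_function \<phi> \<Longrightarrow> partial_deriv j (fold (backward_diff a b) is \<phi>) = fold (backward_diff a b) is (partial_deriv j \<phi>)"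
  by (induction "is" arbitrary: \<phi>) (auto simp: backward_diff_smooth backward_diff_partial)

text \<open>
  Each partial derivative undoes the average in its own coordinate and leaves a difference; it commutes
  with everything done in the other coordinates.
\<close>

lemma iterated_partial_axis_smear:
  assumes "smooth_function \<phi>" "\<And>i. a i \<le> b i"
  shows "iterated_partial_deriv is (fold (axis_smear a b) is \<phi>) = fold (backward_diff a b) is \<phi>"
  using assms(1)
proof (induction "is" arbitrary: \<phi>)
  case (Cons i "is")
  have sm: "smooth_function (axis_smear a b i \<phi>)"
    using Cons.prems by (simp add: axis_smear_def smear_smooth)
  show ?case
    by (simp add: Cons.IH[OF sm] fold_backward_diff_partial[OF sm] partial_axis_smear[OF Cons.prems assms(2)])
qed simp

lemma fold_axis_smear_test:
  assumes "\<phi> \<in> test_functions C" and "\<And>i x s. x \<in> C \<Longrightarrow> a i \<le> s \<Longrightarrow> s \<le> b i \<Longrightarrow> x + axis i s \<in> C"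
  shows "fold (axis_smear a b) is \<phi> \<in> test_functions C"
  using assms(1)
proof (induction "is" arbitrary: \<phi>)
  case (Cons i "is")
  have "axis_smear a b i \<phi> \<in> test_functions C"
    unfolding axis_smear_def by (rule smear_test[OF Cons.prems]) (simp add: scaleR_axis_1 assms(2))
  then show ?case using Cons.IH by simp
qed simp

lemma AE_lebesgue_on_translate:
  fixes C :: "(real^'n::finite) set"
  assumes C: "C \<in> sets lebesgue" and shift: "\<And>x. x \<in> C \<Longrightarrow> x + t \<in> C"
    and P: "AE x in lebesgue_on C. P x"
  shows "AE x in lebesgue_on C. P (x + t)"
proof -
  have "AE x in lebesgue. x \<in> C \<longrightarrow> P x" using P C by (simp add: AE_lebesgue_on_iff)
  from AE_lebesgue_translate[OF this, of t] have "AE x in lebesgue. x \<in> C \<longrightarrow> P (x + t)"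
    by eventually_elim (use shift in blast)
  then show ?thesis using C by (simp add: AE_lebesgue_on_iff)
qed

lemma measurable_lebesgue_on_translate:
  fixes C :: "(real^'n::finite) set"
  assumes C: "C \<in> sets lebesgue" and shift: "\<And>x. x \<in> C \<Longrightarrow> x + t \<in> C"
    and f: "f \<in> borel_measurable (lebesgue_on C)"
  shows "(\<lambda>x. f (x + t)) \<in> borel_measurable (lebesgue_on C)"
proof -
  have "(\<lambda>x. x + t) \<in> lebesgue_on C \<rightarrow>\<^sub>M lebesgue_on C"
    using shift by (intro measurable_restrict_space3[OF lebesgue_measurable_translation]) auto
  from measurable_compose[OF this f] show ?thesis .
qed

text \<open>
  A difference of two values at most doubles a bound; over all coordinates this produces the number
  \<open>2\<^sup>d\<close> of corners of a box.
\<close>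

lemma forward_diff_Linf:
  fixes C :: "(real^'n::finite) set"
  assumes C: "C \<in> sets lebesgue" and shift: "\<And>i x s. x \<in> C \<Longrightarrow> a i \<le> s \<Longrightarrow> s \<le> b i \<Longrightarrow> x + axis i s \<in> C"
    and ab: "\<And>i. a i \<le> b i"
    and f: "f \<in> borel_measurable (lebesgue_on C)" "AE x in lebesgue_on C. \<bar>f x\<bar> \<le> B"
  shows "forward_diff a b i f \<in> borel_measurable (lebesgue_on C)"
    and "AE x in lebesgue_on C. \<bar>forward_diff a b i f x\<bar> \<le> 2 * B"
proof -
  have s: "x + axis i (a i) \<in> C" "x + axis i (b i) \<in> C" if "x \<in> C" for x
    using shift[OF that] ab[of i] by auto
  show "forward_diff a b i f \<in> borel_measurable (lebesgue_on C)"
    unfolding forward_diff_def[abs_def]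
    by (intro borel_measurable_diff measurable_lebesgue_on_translate C f s)
  have "AE x in lebesgue_on C. \<bar>f (x + axis i (a i))\<bar> \<le> B" "AE x in lebesgue_on C. \<bar>f (x + axis i (b i))\<bar> \<le> B"
    by (intro AE_lebesgue_on_translate[where P = "\<lambda>x. \<bar>f x\<bar> \<le> B"] C f s; assumption)+
  then show "AE x in lebesgue_on C. \<bar>forward_diff a b i f x\<bar> \<le> 2 * B"
    by eventually_elim (auto simp: forward_diff_def)
qed

lemma foldr_forward_diff_Linf:
  fixes C :: "(real^'n::finite) set"
  assumes C: "C \<in> sets lebesgue" and shift: "\<And>i x s. x \<in> C \<Longrightarrow> a i \<le> s \<Longrightarrow> s \<le> b i \<Longrightarrow> x + axis i s \<in> C"
    and ab: "\<And>i. a i \<le> b i"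
    and f: "f \<in> borel_measurable (lebesgue_on C)" "AE x in lebesgue_on C. \<bar>f x\<bar> \<le> B"
  shows "foldr (forward_diff a b) is f \<in> borel_measurable (lebesgue_on C) \<and>
    (AE x in lebesgue_on C. \<bar>foldr (forward_diff a b) is f x\<bar> \<le> 2 ^ length is * B)"
proof (induction "is")
  case (Cons i "is")
  then show ?case
    using forward_diff_Linf[OF C shift ab, where f = "foldr (forward_diff a b) is f" and B = "2 ^ length is * B" and i = i]
    by (simp add: mult.assoc)
qed (use f in simp)

lemma integral_backward_diff:
  fixes C :: "(real^'n::finite) set"
  assumes C: "C \<in> sets lebesgue" and shift: "\<And>i x s. x \<in> C \<Longrightarrow> a i \<le> s \<Longrightarrow> s \<le> b i \<Longrightarrow> x + axis i s \<in> C"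
    and ab: "\<And>i. a i \<le> b i"
    and f: "locally_integrable C f" and \<phi>: "\<phi> \<in> test_functions C"
  shows "(LINT x|lebesgue. f x * backward_diff a b i \<phi> x) = - (LINT x|lebesgue. forward_diff a b i f x * \<phi> x)"
proof -
  have s: "x + axis i (a i) \<in> C" "x + axis i (b i) \<in> C" if "x \<in> C" for x
    using shift[OF that] ab[of i] by auto
  have *: "integrable lebesgue (\<lambda>x. f x * \<phi> (x - t))" "integrable lebesgue (\<lambda>x. f (x + t) * \<phi> x)"
    "(LINT x|lebesgue. f x * \<phi> (x - t)) = (LINT x|lebesgue. f (x + t) * \<phi> x)"
    if t: "\<And>x. x \<in> C \<Longrightarrow> x + t \<in> C" for t
  proof -
    show int: "integrable lebesgue (\<lambda>x. f x * \<phi> (x - t))"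
      using test_translate[OF \<phi> t] by (intro integrable_test[OF f]) auto
    show "integrable lebesgue (\<lambda>x. f (x + t) * \<phi> x)"
      using integrable_lebesgue_translate[OF int, of t] by simp
    show "(LINT x|lebesgue. f x * \<phi> (x - t)) = (LINT x|lebesgue. f (x + t) * \<phi> x)"
      using integral_lebesgue_translate[of "\<lambda>x. f x * \<phi> (x - t)" t] by simp
  qed
  show ?thesis
    unfolding backward_diff_def forward_diff_def
    using *[OF s(1)] *[OF s(2)] by (simp add: left_diff_distrib right_diff_distrib)
qed

lemma backward_diff_test:
  assumes \<phi>: "\<phi> \<in> test_functions C"
    and shift: "\<And>i x s. x \<in> C \<Longrightarrow> a i \<le> s \<Longrightarrow> s \<le> b i \<Longrightarrow> x + axis i s \<in> C"
    and ab: "\<And>i. a i \<le> b i"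
  shows "backward_diff a b i \<phi> \<in> test_functions C"
proof -
  have "(\<lambda>x. \<phi> (x - axis i (a i))) \<in> test_functions C" "(\<lambda>x. \<phi> (x - axis i (b i))) \<in> test_functions C"
    using ab by (auto intro!: test_translate \<phi> shift)
  then obtain K L where K: "compact K" "K \<subseteq> C" "\<And>x. x \<notin> K \<Longrightarrow> \<phi> (x - axis i (a i)) = 0"
    and L: "compact L" "L \<subseteq> C" "\<And>x. x \<notin> L \<Longrightarrow> \<phi> (x - axis i (b i)) = 0"
    by (auto elim!: test_functionE)
  have "smooth_function \<phi>" using \<phi> by (simp add: test_functions_def)
  then show ?thesis
    using K(1,2) L(1,2) K(3) L(3)
    by (intro test_functionI[of _ "K \<union> L"] backward_diff_smooth) (auto simp: backward_diff_def, metis)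
qed

lemma integral_fold_backward_diff:
  fixes C :: "(real^'n::finite) set"
  assumes C: "C \<in> sets lebesgue" and shift: "\<And>i x s. x \<in> C \<Longrightarrow> a i \<le> s \<Longrightarrow> s \<le> b i \<Longrightarrow> x + axis i s \<in> C"
    and ab: "\<And>i. a i \<le> b i"
    and f: "f \<in> Linf (lebesgue_on C)" and \<phi>: "\<phi> \<in> test_functions C"
  shows "(LINT x|lebesgue. f x * fold (backward_diff a b) is \<phi> x)
    = (-1) ^ length is * (LINT x|lebesgue. foldr (forward_diff a b) is f x * \<phi> x)"
  using \<phi>
proof (induction "is" arbitrary: \<phi>)
  case (Cons i "is")
  obtain B where B: "AE x in lebesgue_on C. \<bar>f x\<bar> \<le> B" using Linf_AE_bound[OF f] by metis
  have "foldr (forward_diff a b) is f \<in> borel_measurable (lebesgue_on C) \<and>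
    (AE x in lebesgue_on C. \<bar>foldr (forward_diff a b) is f x\<bar> \<le> 2 ^ length is * B)"
    by (rule foldr_forward_diff_Linf[OF C shift ab Linf_measurable[OF f] B])
  then have "locally_integrable C (foldr (forward_diff a b) is f)"
    by (auto intro: locally_integrable_bounded[OF C])
  then have "(LINT x|lebesgue. foldr (forward_diff a b) is f x * backward_diff a b i \<phi> x)
     = - (LINT x|lebesgue. foldr (forward_diff a b) (i # is) f x * \<phi> x)"
    using integral_backward_diff[OF C shift ab _ Cons.prems] by simp
  moreover have "backward_diff a b i \<phi> \<in> test_functions C"
    by (rule backward_diff_test[OF Cons.prems shift ab])
  ultimately show ?case
    using Cons.IH[of "backward_diff a b i \<phi>"] by simp
qed simp

text \<open>
  For a list of all coordinates this is the weak form of the \<open>d\<close>-dimensional fundamental theorem of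
  calculus: the integral of the mixed derivative over a box is the mixed difference at its corners.
\<close>

lemma integral_mixed_deriv_smear:
  fixes C :: "(real^'n::finite) set"
  assumes C: "open C" and shift: "\<And>i x s. x \<in> C \<Longrightarrow> a i \<le> s \<Longrightarrow> s \<le> b i \<Longrightarrow> x + axis i s \<in> C"
    and ab: "\<And>i. a i \<le> b i"
    and f: "f \<in> Linf (lebesgue_on C)" and g: "has_distr_deriv C is f g" and \<phi>: "\<phi> \<in> test_functions C"
  shows "(LINT x|lebesgue. g x * fold (axis_smear a b) is \<phi> x) = (LINT x|lebesgue. foldr (forward_diff a b) is f x * \<phi> x)"
proof -
  have sm: "smooth_function \<phi>" using \<phi> by (simp add: test_functions_def)
  have T: "fold (axis_smear a b) is \<phi> \<in> test_functions C" by (rule fold_axis_smear_test[OF \<phi> shift])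
  have "(LINT x|lebesgue. f x * iterated_partial_deriv is (fold (axis_smear a b) is \<phi>) x)
     = (-1) ^ length is * (LINT x|lebesgue. g x * fold (axis_smear a b) is \<phi> x)"
    using g T unfolding has_distr_deriv_iff[OF C] by blast
  then have "(-1) ^ length is * (LINT x|lebesgue. g x * fold (axis_smear a b) is \<phi> x)
     = (LINT x|lebesgue. f x * fold (backward_diff a b) is \<phi> x)"
    by (simp only: iterated_partial_axis_smear[OF sm ab])
  also have "\<dots> = (-1) ^ length is * (LINT x|lebesgue. foldr (forward_diff a b) is f x * \<phi> x)"
    by (rule integral_fold_backward_diff[OF open_in_lebesgue[OF C] shift ab f \<phi>])
  finally show ?thesis by simp
qed

section \<open>The mixed difference as an average over a random box\<close>

definition uniform_coords :: "('n \<Rightarrow> real) \<Rightarrow> ('n \<Rightarrow> real) \<Rightarrow> 'n set \<Rightarrow> ('n \<Rightarrow> real) measure" where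
  "uniform_coords a b I = PiM I (\<lambda>i. uniform_measure lborel {a i..b i})"

lemma prob_space_uniform_interval: "a < b \<Longrightarrow> prob_space (uniform_measure lborel {a..b::real})"
  by (intro prob_space_uniform_measure) auto

lemma prob_space_uniform_coords:
  assumes "\<And>i. a i < b i" shows "prob_space (uniform_coords a b I)"
  unfolding uniform_coords_def by (intro prob_space_PiM prob_space_uniform_interval assms)

lemma AE_uniform_coords:
  fixes a b :: "'n::finite \<Rightarrow> real"
  assumes ab: "\<And>i. a i < b i"
  shows "AE t in uniform_coords a b UNIV. \<forall>i. a i \<le> t i \<and> t i \<le> b i"
  unfolding AE_all_countable
proof
  fix i
  have "AE s in uniform_measure lborel {a i..b i}. a i \<le> s \<and> s \<le> b i"
    by (intro AE_uniform_measureI) auto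
  then show "AE t in uniform_coords a b UNIV. a i \<le> t i \<and> t i \<le> b i"
    unfolding uniform_coords_def
    by (intro AE_PiM_component[of UNIV _ i] prob_space_uniform_interval ab) auto
qed

lemma integral_uniform_interval:
  fixes f :: "real \<Rightarrow> real"
  assumes ab: "a < b" and f: "continuous_on UNIV f"
  shows "integral {a..b} f = (b - a) * (\<integral>s. f s \<partial>uniform_measure lborel {a..b})"
proof -
  have [measurable]: "f \<in> borel_measurable borel" using f by (rule borel_measurable_continuous_onI)
  have "uniform_measure lborel {a..b} = density lborel (\<lambda>s. ennreal (indicator {a..b} s / (b - a)))"
    unfolding uniform_measure_def using ab
    by (intro density_cong) (auto simp: indicator_def divide_ennreal[symmetric])
  then have "(\<integral>s. f s \<partial>uniform_measure lborel {a..b}) = (\<integral>s. indicator {a..b} s / (b - a) * f s \<partial>lborel)"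
    using ab by (simp add: integral_density)
  also have "\<dots> = (\<integral>s. (indicator {a..b} s * f s) / (b - a) \<partial>lborel)" by simp
  also have "\<dots> = (LINT s:{a..b}|lborel. f s) / (b - a)"
    by (simp add: set_lebesgue_integral_def)
  also have "(LINT s:{a..b}|lborel. f s) = integral {a..b} f"
    by (intro set_borel_integral_eq_integral borel_integrable_atLeastAtMost')
      (use f continuous_on_subset in blast)
  finally show ?thesis using ab by simp
qed

lemma test_function_bounded:
  assumes "\<phi> \<in> test_functions C" obtains B where "0 \<le> B" "\<And>x. \<bar>\<phi> x\<bar> \<le> B"
proof -
  obtain K where K: "smooth_function \<phi>" "compact K" "\<And>x. x \<notin> K \<Longrightarrow> \<phi> x = 0"
    using test_functionE[OF assms] by metis
  have "compact (\<phi> ` K)"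
    using smooth_continuous[OF K(1)] K(2) by (rule compact_continuous_image)
  then obtain B where B: "\<And>x. x \<in> K \<Longrightarrow> \<bar>\<phi> x\<bar> \<le> B"
    unfolding compact_eq_bounded_closed bounded_iff by auto
  have "\<bar>\<phi> x\<bar> \<le> max B 0" for x
    using B[of x] K(3)[of x] by (cases "x \<in> K") auto
  then show thesis by (intro that[of "max B 0"]) auto
qed

lemma measurable_sum_axis:
  fixes I :: "'n::finite set"
  shows "(\<lambda>t. \<Sum>i\<in>I. axis i (t i) :: real^'n) \<in> borel_measurable (uniform_coords a b I)"
proof (rule borel_measurable_sum)
  fix i assume i: "i \<in> I"
  have "continuous_on UNIV (\<lambda>s::real. s *\<^sub>R axis i 1 :: real^'n)"
    by (intro continuous_intros)
  then have "(\<lambda>s::real. axis i s :: real^'n) \<in> borel_measurable borel"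
    unfolding scaleR_axis_1 by (rule borel_measurable_continuous_onI)
  moreover have "(\<lambda>t. t i) \<in> uniform_coords a b I \<rightarrow>\<^sub>M borel"
    using measurable_component_singleton[OF i, of "\<lambda>i. uniform_measure lborel {a i..b i}"]
    by (simp add: uniform_coords_def cong: measurable_cong_sets)
  ultimately show "(\<lambda>t. axis i (t i) :: real^'n) \<in> borel_measurable (uniform_coords a b I)"
    by (rule measurable_compose[rotated])
qed

text \<open>
  Up to the volume of the box, successive averaging over all coordinates is the expectation over a
  random translation with independent uniform coordinates. In this form the error of the average can be
  estimated translation by translation.
\<close>

lemma fold_axis_smear_expectation:
  fixes a b :: "'n::finite \<Rightarrow> real"
  assumes ab: "\<And>i. a i < b i" and "distinct is" and "\<phi> \<in> test_functions UNIV"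
  shows "fold (axis_smear a b) is \<phi> y
    = (\<Prod>i\<in>set is. b i - a i) * (\<integral>t. \<phi> (y - (\<Sum>i\<in>set is. axis i (t i))) \<partial>uniform_coords a b (set is))"
  using assms(2,3)
proof (induction "is" arbitrary: \<phi> y)
  case Nil
  then show ?case by (simp add: uniform_coords_def PiM_empty lebesgue_integral_count_space_finite)
next
  case (Cons i "is")
  let ?U = "\<lambda>i. uniform_measure lborel {a i..b i}"
  have i: "i \<notin> set is" and d: "distinct is" using Cons.prems by auto
  have sm: "smooth_function \<phi>" using Cons.prems by (simp add: test_functions_def)
  interpret U: prob_space "?U j" for j using ab by (intro prob_space_uniform_interval)
  interpret product_sigma_finite ?U ..
  interpret P: prob_space "uniform_coords a b (set (i # is))" by (rule prob_space_uniform_coords[OF ab])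
  have Ti: "axis_smear a b i \<phi> \<in> test_functions UNIV"
    unfolding axis_smear_def by (rule smear_test[OF Cons.prems(2)]) simp
  have T: "axis_smear a b i \<phi> z = (b i - a i) * (\<integral>s. \<phi> (z - axis i s) \<partial>?U i)" for z
    using integral_uniform_interval[OF ab[of i] continuous_along_line[OF sm, of _ z "axis i 1"]]
    by (simp add: axis_smear_def smear_def scaleR_axis_1)
  obtain B where B: "\<And>x. \<bar>\<phi> x\<bar> \<le> B" using test_function_bounded[OF Cons.prems(2)] by metis
  have int: "integrable (uniform_coords a b (set (i # is))) (\<lambda>t. \<phi> (y - (\<Sum>j\<in>set (i # is). axis j (t j))))"
  proof (rule P.integrable_const_bound[of _ B])
    have "(\<lambda>t. y - (\<Sum>j\<in>set (i # is). axis j (t j))) \<in> borel_measurable (uniform_coords a b (set (i # is)))"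
      by (intro borel_measurable_diff measurable_sum_axis) auto
    from measurable_compose[OF this smooth_borel[OF sm]]
    show "(\<lambda>t. \<phi> (y - (\<Sum>j\<in>set (i # is). axis j (t j)))) \<in> borel_measurable (uniform_coords a b (set (i # is)))" .
  qed (simp add: B)
  have "fold (axis_smear a b) (i # is) \<phi> y
     = (\<Prod>j\<in>set is. b j - a j) * (\<integral>t. axis_smear a b i \<phi> (y - (\<Sum>j\<in>set is. axis j (t j))) \<partial>uniform_coords a b (set is))"
    using Cons.IH[OF d Ti] by simp
  also have "(\<integral>t. axis_smear a b i \<phi> (y - (\<Sum>j\<in>set is. axis j (t j))) \<partial>uniform_coords a b (set is))
     = (b i - a i) * (\<integral>t. (\<integral>s. \<phi> (y - (\<Sum>j\<in>set is. axis j (t j)) - axis i s) \<partial>?U i) \<partial>uniform_coords a b (set is))"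
    unfolding T by simp
  also have "(\<integral>t. (\<integral>s. \<phi> (y - (\<Sum>j\<in>set is. axis j (t j)) - axis i s) \<partial>?U i) \<partial>uniform_coords a b (set is))
     = (\<integral>t. (\<integral>s. \<phi> (y - (\<Sum>j\<in>set (i # is). axis j ((t(i := s)) j))) \<partial>?U i) \<partial>uniform_coords a b (set is))"
  proof -
    have "(\<Sum>j\<in>set is. axis j (t j)) = (\<Sum>j\<in>set is. axis j ((t(i := s)) j) :: real^'n)" for t :: "'n \<Rightarrow> real" and s
      using i by (intro sum.cong) auto
    then show ?thesis using i by (simp add: algebra_simps)
  qed
  also have "\<dots> = (\<integral>t. \<phi> (y - (\<Sum>j\<in>set (i # is). axis j (t j))) \<partial>uniform_coords a b (set (i # is)))"
    using product_integral_insert[OF finite_set i int[unfolded uniform_coords_def list.set]]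
    by (simp add: uniform_coords_def)
  finally show ?case using i by (simp add: mult_ac)
qed

lemma sigma_finite_lebesgue: "sigma_finite_measure (lebesgue :: 'a::euclidean_space measure)"
proof
  obtain A :: "'a set set" where "countable A" "A \<subseteq> sets lborel" "\<Union>A = space lborel" "\<forall>a\<in>A. emeasure lborel a \<noteq> \<infinity>"
    using lborel.sigma_finite_countable by blast
  then show "\<exists>A. countable A \<and> A \<subseteq> sets lebesgue \<and> \<Union>A = space (lebesgue :: 'a measure) \<and> (\<forall>a\<in>A. emeasure lebesgue a \<noteq> \<infinity>)"
    by (intro exI[of _ A]) (auto simp: sets_completionI_sets)
qed

text \<open>
  By Fubini, the pairing with an average of translates is the average of the pairings, so a bound for
  every translation vector integrates to a bound for the average.
\<close>

lemma smeared_pairing_bound: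
  fixes a b :: "'n::finite \<Rightarrow> real"
  assumes ab: "\<And>i. a i < b i"
    and C: "open C" and shift: "\<And>x v. x \<in> C \<Longrightarrow> (\<And>i. a i \<le> v $ i \<and> v $ i \<le> b i) \<Longrightarrow> x + v \<in> C"
    and g: "locally_integrable C g" and \<phi>: "\<phi> \<in> test_functions C"
  defines "P \<equiv> uniform_coords a b UNIV" and "w \<equiv> (\<lambda>t. \<Sum>i\<in>UNIV. axis i (t i) :: real^'n)"
  assumes r: "integrable P r"
    and bound: "\<And>t. (\<And>i. a i \<le> t i \<and> t i \<le> b i) \<Longrightarrow>
      \<bar>(LINT y|lebesgue. g y * \<phi> y) - (LINT y|lebesgue. g y * \<phi> (y - w t))\<bar> \<le> r t"
  shows "\<bar>(LINT y|lebesgue. g y * \<phi> y) - (LINT y|lebesgue. g y * (\<integral>t. \<phi> (y - w t) \<partial>P))\<bar> \<le> (\<integral>t. r t \<partial>P)"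
proof -
  interpret P: prob_space P unfolding P_def by (rule prob_space_uniform_coords[OF ab])
  interpret L: sigma_finite_measure "lebesgue :: (real^'n) measure" by (rule sigma_finite_lebesgue)
  interpret LP: pair_sigma_finite "lebesgue :: (real^'n) measure" P ..
  have AE: "AE t in P. \<forall>i. a i \<le> t i \<and> t i \<le> b i" unfolding P_def by (rule AE_uniform_coords[OF ab])
  obtain K where K: "smooth_function \<phi>" "compact K" "K \<subseteq> C" "\<And>x. x \<notin> K \<Longrightarrow> \<phi> x = 0"
    using test_functionE[OF \<phi>] by metis
  obtain B where B: "0 \<le> B" "\<And>x. \<bar>\<phi> x\<bar> \<le> B" using test_function_bounded[OF \<phi>] by metis
  let ?box = "cbox (\<chi> i. a i) (\<chi> i. b i)"
  \<comment> \<open>All translates of \<open>\<phi>\<close> by vectors of the box are supported in \<open>L\<close>; cutting \<open>g\<close> off there makes it integrable.\<close>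
  define L where "L = (\<lambda>p. fst p + snd p) ` (K \<times> ?box)"
  have L: "compact L" unfolding L_def
    using K(2) by (intro compact_continuous_image compact_Times compact_cbox) (auto intro!: continuous_intros)
  have LC: "L \<subseteq> C" unfolding L_def using K(3) shift by (auto simp: mem_box_cart)
  have Ls: "L \<in> sets lebesgue" using L by (simp add: borel_compact)
  define g' where "g' y = indicator L y * g y" for y
  have g': "integrable lebesgue g'"
    using g L LC Ls unfolding locally_integrable_def g'_def by (auto simp: integrable_restrict_space)
  have w: "w t $ i = t i" for t i
    by (simp add: w_def axis_def if_distrib cong: if_cong)
  have eq: "g y * \<phi> (y - w t) = g' y * \<phi> (y - w t)" if t: "\<forall>i. a i \<le> t i \<and> t i \<le> b i" for y t
  proof (cases "y - w t \<in> K")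
    case True
    then have "y \<in> L" unfolding L_def using t
      by (intro image_eqI[of _ _ "(y - w t, w t)"]) (auto simp: mem_box_cart w)
    then show ?thesis by (simp add: g'_def)
  qed (simp add: K(4))
  have wm: "w \<in> borel_measurable P" unfolding w_def P_def by (rule measurable_sum_axis)
  define F where "F y t = g' y * \<phi> (y - w t)" for y t
  have intF: "integrable (lebesgue \<Otimes>\<^sub>M P) (case_prod F)"
  proof (rule Bochner_Integration.integrable_bound)
    have "integrable (distr (lebesgue \<Otimes>\<^sub>M P) lebesgue fst) g'"
      using g' by (simp add: P.distr_pair_fst)
    then show "integrable (lebesgue \<Otimes>\<^sub>M P) (\<lambda>p. B * g' (fst p))"
      by (intro integrable_mult_right) (rule integrable_distr[OF measurable_fst])
    have "(\<lambda>p. fst p - w (snd p)) \<in> borel_measurable (lebesgue \<Otimes>\<^sub>M P)"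
    proof (intro borel_measurable_diff)
      have "(\<lambda>x::real^'n. x) \<in> borel_measurable lebesgue" by (intro measurable_completion) simp
      then show "(\<lambda>p. fst p :: real^'n) \<in> borel_measurable (lebesgue \<Otimes>\<^sub>M P)"
        by (rule measurable_compose[OF measurable_fst])
    qed (rule measurable_compose[OF measurable_snd wm])
    from measurable_compose[OF this smooth_borel[OF K(1)]]
    show "case_prod F \<in> borel_measurable (lebesgue \<Otimes>\<^sub>M P)"
      using measurable_compose[OF measurable_fst borel_measurable_integrable[OF g'], of P]
      unfolding F_def split_beta by (intro borel_measurable_times) auto
    show "AE p in lebesgue \<Otimes>\<^sub>M P. norm (case p of (y, t) \<Rightarrow> F y t) \<le> norm (B * g' (fst p))"
      using B by (intro AE_I2) (auto simp: F_def abs_mult split_beta mult.commute[of "\<bar>g' _\<bar>"] intro!: mult_right_mono)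
  qed
  define G where "G t = (LINT y|lebesgue. F y t)" for t
  have G: "integrable P G"
    unfolding G_def using LP.integrable_snd[OF intF] .
  have "(LINT y|lebesgue. g y * (\<integral>t. \<phi> (y - w t) \<partial>P)) = (LINT y|lebesgue. (\<integral>t. F y t \<partial>P))"
  proof (rule Bochner_Integration.integral_cong[OF refl])
    fix y
    have m: "(\<lambda>t. \<phi> (y - w t)) \<in> borel_measurable P"
      using wm by (intro measurable_compose[OF _ smooth_borel[OF K(1)]] borel_measurable_diff) auto
    have "g y * (\<integral>t. \<phi> (y - w t) \<partial>P) = (\<integral>t. g y * \<phi> (y - w t) \<partial>P)" by simp
    also have "\<dots> = (\<integral>t. F y t \<partial>P)"
    proof (rule integral_cong_AE)
      show "AE t in P. g y * \<phi> (y - w t) = F y t"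
        using AE by eventually_elim (simp add: F_def eq)
    qed (use m in \<open>auto simp: F_def\<close>)
    finally show "g y * (\<integral>t. \<phi> (y - w t) \<partial>P) = (\<integral>t. F y t \<partial>P)" .
  qed
  also have "\<dots> = (\<integral>t. G t \<partial>P)"
    unfolding G_def by (rule LP.Fubini_integral[OF intF, symmetric])
  finally have avg: "(LINT y|lebesgue. g y * (\<integral>t. \<phi> (y - w t) \<partial>P)) = (\<integral>t. G t \<partial>P)" .
  define c where "c = (LINT y|lebesgue. g y * \<phi> y)"
  have "\<bar>c - (\<integral>t. G t \<partial>P)\<bar> = \<bar>\<integral>t. c - G t \<partial>P\<bar>"
    using G by (simp add: P.prob_space)
  also have "\<dots> \<le> (\<integral>t. \<bar>c - G t\<bar> \<partial>P)" by (rule integral_abs_bound)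
  also have "\<dots> \<le> (\<integral>t. r t \<partial>P)"
  proof (rule integral_mono_AE)
    show "AE t in P. \<bar>c - G t\<bar> \<le> r t"
      using AE
    proof eventually_elim
      case (elim t)
      have "G t = (LINT y|lebesgue. g y * \<phi> (y - w t))"
        unfolding G_def F_def by (simp only: eq[OF elim])
      then show ?case using bound[of t] elim by (simp add: c_def)
    qed
  qed (use G r in auto)
  finally show ?thesis unfolding avg c_def .
qed

text \<open>
  Every \<open>\<bar>t\<^sub>i\<bar>\<close> is uniform on \<open>[0, h]\<close>, whether \<open>t\<^sub>i\<close> ranges over \<open>[-h, h]\<close> or over \<open>[0, h]\<close>. Hence the
  maximum exceeds \<open>u\<close> with probability \<open>1 - (u/h)\<^sup>d\<close>, and integrating this over \<open>[0, h]\<close> gives its mean.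
\<close>

lemma expectation_max_coords:
  fixes J :: "'n::finite set"
  assumes h: "h > 0"
  defines "a \<equiv> (\<lambda>i. if i \<in> J then 0 else - h)"
  defines "P \<equiv> uniform_coords a (\<lambda>_. h) UNIV"
  defines "r \<equiv> (\<lambda>t :: 'n \<Rightarrow> real. Max (range (\<lambda>i. \<bar>t i\<bar>)))"
  shows "integrable P r" and "(\<integral>t. r t \<partial>P) = h * real CARD('n) / (real CARD('n) + 1)"
proof -
  let ?U = "\<lambda>i. uniform_measure lborel {a i..h}"
  let ?d = "CARD('n)"
  have ah: "a i < h" for i using h by (simp add: a_def)
  interpret U: prob_space "?U j" for j using ah by (intro prob_space_uniform_interval)
  interpret product_sigma_finite ?U ..
  interpret P: prob_space P unfolding P_def by (rule prob_space_uniform_coords[OF ah])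
  interpret LP: pair_sigma_finite P "lborel :: real measure" ..
  have comp[measurable]: "(\<lambda>t. t i) \<in> borel_measurable P" for i
    using measurable_component_singleton[of i UNIV "?U"]
    by (simp add: P_def uniform_coords_def cong: measurable_cong_sets)
  have r0: "0 \<le> r t" for t
    unfolding r_def by (subst Max_ge_iff) auto
  have rle: "r t \<le> u \<longleftrightarrow> (\<forall>i. \<bar>t i\<bar> \<le> u)" for t u
    unfolding r_def by (subst Max_le_iff) auto
  have rm[measurable]: "r \<in> borel_measurable P"
    unfolding borel_measurable_iff_le rle by measurable
  have "AE t in P. \<forall>i. a i \<le> t i \<and> t i \<le> h" unfolding P_def by (rule AE_uniform_coords[OF ah])
  then have AEr: "AE t in P. r t \<le> h"
  proof eventually_elim
    case (elim t)
    have "- h \<le> a i" for i using h by (simp add: a_def)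
    then show ?case unfolding rle abs_le_iff using elim by (metis minus_le_iff order_trans)
  qed
  show int: "integrable P r"
    using AEr r0 by (intro P.integrable_const_bound[of _ h]) auto
  have cdf: "emeasure P {t \<in> space P. r t \<le> u} = ennreal ((u / h) ^ ?d)" if u: "0 \<le> u" "u \<le> h" for u
  proof -
    have "{t \<in> space P. r t \<le> u} = Pi\<^sub>E UNIV (\<lambda>i. {-u..u})"
      by (auto simp: rle P_def uniform_coords_def space_PiM PiE_UNIV_domain Pi_iff abs_le_iff minus_le_iff)
    then have "emeasure P {t \<in> space P. r t \<le> u} = (\<Prod>i\<in>UNIV. emeasure (?U i) {-u..u})"
      unfolding P_def uniform_coords_def by (simp add: emeasure_PiM)
    also have "\<dots> = (\<Prod>i\<in>(UNIV::'n set). ennreal (u / h))"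
    proof (rule prod.cong[OF refl])
      fix i
      have "{a i..h} \<inter> {-u..u} = {max (a i) (-u)..u}" using u by auto
      then show "emeasure (?U i) {-u..u} = ennreal (u / h)"
        using u h by (auto simp: a_def divide_ennreal field_simps max_def)
    qed
    also have "\<dots> = ennreal ((u / h) ^ ?d)"
      using u h by (simp add: ennreal_power)
    finally show ?thesis .
  qed
  have tail: "emeasure P {t \<in> space P. u < r t} = ennreal (1 - (u / h) ^ ?d)" if u: "0 \<le> u" "u \<le> h" for u
  proof -
    have "{t \<in> space P. u < r t} = space P - {t \<in> space P. r t \<le> u}" by auto
    then have "emeasure P {t \<in> space P. u < r t} = 1 - ennreal ((u / h) ^ ?d)"
      using cdf[OF u] by (subst emeasure_compl[symmetric] | simp add: P.emeasure_space_1 emeasure_compl)+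
    also have "\<dots> = ennreal (1 - (u / h) ^ ?d)"
      using u h by (subst ennreal_minus[symmetric]) auto
    finally show ?thesis .
  qed
  have layer: "ennreal (r t) = (\<integral>\<^sup>+u. indicator {0..h} u * indicator {u. u < r t} u \<partial>lborel)" if "r t \<le> h" for t
  proof -
    have "(\<integral>\<^sup>+u. indicator {0..h} u * indicator {u. u < r t} u \<partial>lborel) = (\<integral>\<^sup>+u. indicator {0..<r t} u \<partial>lborel)"
      using that by (intro nn_integral_cong) (auto simp: indicator_def)
    also have "\<dots> = ennreal (r t)" using r0[of t] by simp
    finally show ?thesis ..
  qed
  have "(\<integral>\<^sup>+t. ennreal (r t) \<partial>P) = (\<integral>\<^sup>+t. (\<integral>\<^sup>+u. indicator {0..h} u * indicator {u. u < r t} u \<partial>lborel) \<partial>P)"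
    using AEr by (intro nn_integral_cong_AE) (auto elim!: eventually_mono simp: layer)
  also have "\<dots> = (\<integral>\<^sup>+u. (\<integral>\<^sup>+t. indicator {0..h} u * indicator {u. u < r t} u \<partial>P) \<partial>lborel)"
    by (rule LP.Fubini'[symmetric]) (simp add: split_beta)
  also have "\<dots> = (\<integral>\<^sup>+u. ennreal (indicator {0..h} u * (1 - (u / h) ^ ?d)) \<partial>lborel)"
  proof (rule nn_integral_cong)
    fix u :: real
    have "(\<integral>\<^sup>+t. indicator {0..h} u * indicator {u. u < r t} u \<partial>P)
       = (\<integral>\<^sup>+t. indicator {0..h} u * indicator {t \<in> space P. u < r t} t \<partial>P)"
      by (intro nn_integral_cong) (auto simp: indicator_def)
    also have "\<dots> = indicator {0..h} u * emeasure P {t \<in> space P. u < r t}"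
      by (subst nn_integral_cmult_indicator) auto
    also have "\<dots> = ennreal (indicator {0..h} u * (1 - (u / h) ^ ?d))"
      by (cases "u \<in> {0..h}") (simp_all add: tail)
    finally show "(\<integral>\<^sup>+t. indicator {0..h} u * indicator {u. u < r t} u \<partial>P) = ennreal (indicator {0..h} u * (1 - (u / h) ^ ?d))" .
  qed
  also have "\<dots> = ennreal (h * real ?d / (real ?d + 1))"
  proof (rule nn_integral_has_integral_lborel)
    have "((\<lambda>u. 1 - (u / h) ^ ?d) has_integral ((h - h * (h / h) ^ Suc ?d / Suc ?d) - (0 - h * (0 / h) ^ Suc ?d / Suc ?d))) {0..h}"
      using h by (intro fundamental_theorem_of_calculus)
        (auto intro!: derivative_eq_intros simp: has_real_derivative_iff_has_vector_derivative[symmetric] simp del: of_nat_Suc power_Suc)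
    moreover have "(h - h * (h / h) ^ Suc ?d / Suc ?d) - (0 - h * (0 / h) ^ Suc ?d / Suc ?d) = h * real ?d / (real ?d + 1)"
      using h by (simp add: field_simps)
    ultimately have "((\<lambda>u. if u \<in> {0..h} then 1 - (u / h) ^ ?d else 0) has_integral h * real ?d / (real ?d + 1)) UNIV"
      by (simp only: has_integral_restrict_UNIV)
    moreover have "indicator {0..h} u * (1 - (u / h) ^ ?d) = (if u \<in> {0..h} then 1 - (u / h) ^ ?d else 0)" for u
      by (simp add: indicator_def)
    ultimately show "((\<lambda>u. indicator {0..h} u * (1 - (u / h) ^ ?d)) has_integral h * real ?d / (real ?d + 1)) UNIV"
      by simp
    show "0 \<le> indicator {0..h} u * (1 - (u / h) ^ ?d)" for u
      using h by (auto simp: indicator_def power_le_one)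
  qed measurable
  finally have "(\<integral>\<^sup>+t. ennreal (r t) \<partial>P) = ennreal (h * real ?d / (real ?d + 1))" .
  then show "(\<integral>t. r t \<partial>P) = h * real ?d / (real ?d + 1)"
    using h r0 by (simp add: integral_eq_nn_integral)
qed

text \<open>
  The mixed difference divided by the volume is the average of \<open>g\<close> over \<open>x\<close> plus a box. Its deviation
  from \<open>g x\<close> is at most the mean of the maximum norm over the box, because \<open>g\<close> is Lipschitz with
  constant \<open>1\<close> for that norm. The argument runs on the dual side, against test functions.
\<close>

lemma mixed_difference_error:
  fixes J :: "'n::finite set" and C :: "(real^'n) set"
  assumes h: "h > 0"
  defines "a \<equiv> (\<lambda>i. if i \<in> J then 0 else - h)" and "b \<equiv> (\<lambda>_. h)"
  assumes C: "open C" and shift: "\<And>x v. x \<in> C \<Longrightarrow> (\<And>i. a i \<le> v $ i \<and> v $ i \<le> h) \<Longrightarrow> x + v \<in> C"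
    and f: "f \<in> Linf (lebesgue_on C)" and g: "has_distr_deriv C all_coords f g"
    and k: "\<And>i. has_distr_deriv C [i] g (k i)"
    and k1: "AE x in lebesgue_on C. (\<Sum>i\<in>UNIV. \<bar>k i x\<bar>) \<le> 1"
  shows "AE x in lebesgue_on C. \<bar>g x - foldr (forward_diff a b) all_coords f x / (\<Prod>i\<in>UNIV. b i - a i)\<bar>
    \<le> h * real CARD('n) / (real CARD('n) + 1)"
proof -
  define V where "V = (\<Prod>i\<in>UNIV. b i - a i)"
  define R where "R = h * real CARD('n) / (real CARD('n) + 1)"
  define q where "q x = foldr (forward_diff a b) all_coords f x / V" for x
  define P where "P = uniform_coords a b UNIV"
  define w where "w t = (\<Sum>i\<in>UNIV. axis i (t i) :: real^'n)" for t :: "'n \<Rightarrow> real"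
  have w: "w t $ i = t i" for t i
    by (simp add: w_def axis_def if_distrib cong: if_cong)
  have ab: "a i < b i" for i using h by (simp add: a_def b_def)
  have V: "V > 0" unfolding V_def using ab by (intro prod_pos) auto
  have shift1: "x + axis i s \<in> C" if "x \<in> C" "a i \<le> s" "s \<le> b i" for x i s
    using that h by (intro shift) (auto simp: axis_def a_def b_def)
  have Cs: "C \<in> sets lebesgue" using C by simp
  have gl: "locally_integrable C g" using g by (auto simp: has_distr_deriv_def)
  obtain B where B: "AE x in lebesgue_on C. \<bar>f x\<bar> \<le> B" using Linf_AE_bound[OF f] by metis
  let ?D = "foldr (forward_diff a b) all_coords f"
  have "?D \<in> borel_measurable (lebesgue_on C) \<and>
    (AE x in lebesgue_on C. \<bar>?D x\<bar> \<le> 2 ^ length (all_coords :: 'n list) * B)"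
    by (rule foldr_forward_diff_Linf[OF Cs shift1 less_imp_le[OF ab] Linf_measurable[OF f] B])
  then have "locally_integrable C ?D"
    by (auto intro: locally_integrable_bounded[OF Cs])
  then have ql: "locally_integrable C q"
    using locally_integrable_cmult[of C ?D "1 / V"] by (simp add: q_def[abs_def])
  have main: "\<bar>(LINT x|lebesgue. g x * \<phi> x) - (LINT x|lebesgue. q x * \<phi> x)\<bar> \<le> R * (LINT x|lebesgue. \<phi> x)"
    if \<phi>: "\<phi> \<in> test_functions C" and nonneg: "\<And>x. 0 \<le> \<phi> x" for \<phi>
  proof -
    have \<phi>U: "\<phi> \<in> test_functions UNIV" using \<phi> test_mono[of C UNIV] by auto
    have "(LINT x|lebesgue. q x * \<phi> x) = (LINT x|lebesgue. ?D x * \<phi> x) / V"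
      by (simp add: q_def)
    also have "\<dots> = (LINT x|lebesgue. g x * fold (axis_smear a b) all_coords \<phi> x) / V"
      using integral_mixed_deriv_smear[OF C shift1 _ f g \<phi>] ab by (simp add: less_imp_le)
    also have "\<dots> = (LINT x|lebesgue. g x * (\<integral>t. \<phi> (x - w t) \<partial>P))"
    proof -
      have "fold (axis_smear a b) all_coords \<phi> x = V * (\<integral>t. \<phi> (x - w t) \<partial>P)" for x
        using fold_axis_smear_expectation[OF ab all_coords(1) \<phi>U, where y = x]
        by (simp add: all_coords(2) V_def P_def w_def)
      then show ?thesis using V by (simp add: mult.left_commute[of _ V])
    qed
    finally have q: "(LINT x|lebesgue. q x * \<phi> x) = (LINT x|lebesgue. g x * (\<integral>t. \<phi> (x - w t) \<partial>P))" .
    let ?r = "\<lambda>t :: 'n \<Rightarrow> real. Max (range (\<lambda>i. \<bar>t i\<bar>))"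
    have r: "integrable P ?r" "(\<integral>t. ?r t \<partial>P) = R"
      using expectation_max_coords[OF h, of J] unfolding P_def a_def b_def R_def by auto
    have "\<bar>(LINT x|lebesgue. g x * \<phi> x) - (LINT x|lebesgue. g x * (\<integral>t. \<phi> (x - w t) \<partial>P))\<bar>
        \<le> (\<integral>t. ?r t * (LINT x|lebesgue. \<phi> x) \<partial>P)"
      unfolding P_def w_def
    proof (rule smeared_pairing_bound[OF ab C _ gl \<phi>])
      show "x + v \<in> C" if "x \<in> C" "\<And>i. a i \<le> v $ i \<and> v $ i \<le> b i" for x v
        using shift that by (simp add: b_def)
      show "integrable (uniform_coords a b UNIV) (\<lambda>t. ?r t * (LINT x|lebesgue. \<phi> x))"
        using r(1) by (simp add: P_def)
      fix t :: "'n \<Rightarrow> real" assume t: "\<And>i. a i \<le> t i \<and> t i \<le> b i"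
      show "\<bar>(LINT y|lebesgue. g y * \<phi> y) - (LINT y|lebesgue. g y * \<phi> (y - (\<Sum>i\<in>UNIV. axis i (t i))))\<bar>
          \<le> ?r t * (LINT x|lebesgue. \<phi> x)"
      proof (rule weak_lipschitz_bound[OF C k k1 \<phi> nonneg])
        show "\<bar>(\<Sum>i\<in>UNIV. axis i (t i) :: real^'n) $ i\<bar> \<le> ?r t" for i
          using w[of t i] by (simp add: w_def)
        show "x + s *\<^sub>R (\<Sum>i\<in>UNIV. axis i (t i)) \<in> C" if x: "x \<in> C" and s: "0 \<le> s" "s \<le> 1" for x s
        proof (rule shift[OF x])
          fix i
          have "s * a i \<le> s * t i" "s * t i \<le> s * b i" using t[of i] s by (auto intro: mult_left_mono)
          moreover have "a i \<le> s * a i" "s * b i \<le> h"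
            using s h by (auto simp: a_def b_def mult_left_le_one_le)
          ultimately show "a i \<le> (s *\<^sub>R (\<Sum>i\<in>UNIV. axis i (t i) :: real^'n)) $ i \<and> (s *\<^sub>R (\<Sum>i\<in>UNIV. axis i (t i) :: real^'n)) $ i \<le> h"
            using w[of t i] by (simp add: w_def)
        qed
      qed
    qed
    then show ?thesis unfolding q using r(2) by simp
  qed
  have "AE x in lebesgue_on C. 0 \<le> R - (g x - q x)" "AE x in lebesgue_on C. 0 \<le> R + (g x - q x)"
  proof -
    have R: "locally_integrable C (\<lambda>_. R)" by (rule locally_integrable_bounded[OF Cs, of _ "\<bar>R\<bar>"]) auto
    have gq: "locally_integrable C (\<lambda>x. g x - q x)" by (rule locally_integrable_diff[OF gl ql])
    show "AE x in lebesgue_on C. 0 \<le> R - (g x - q x)"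
    proof (rule fundamental_lemma_nonneg[OF C locally_integrable_diff[OF R gq]])
      fix \<phi> :: "real^'n \<Rightarrow> real" assume \<phi>: "\<phi> \<in> test_functions C" "\<And>x. 0 \<le> \<phi> x"
      show "0 \<le> (LINT x|lebesgue. (R - (g x - q x)) * \<phi> x)"
        using main[OF \<phi>] integrable_test[OF gl \<phi>(1)] integrable_test[OF ql \<phi>(1)] integrable_test_function[OF \<phi>(1)]
        by (simp add: left_diff_distrib)
    qed
    show "AE x in lebesgue_on C. 0 \<le> R + (g x - q x)"
    proof (rule fundamental_lemma_nonneg[OF C locally_integrable_add[OF R gq]])
      fix \<phi> :: "real^'n \<Rightarrow> real" assume \<phi>: "\<phi> \<in> test_functions C" "\<And>x. 0 \<le> \<phi> x"
      show "0 \<le> (LINT x|lebesgue. (R + (g x - q x)) * \<phi> x)"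
        using main[OF \<phi>] integrable_test[OF gl \<phi>(1)] integrable_test[OF ql \<phi>(1)] integrable_test_function[OF \<phi>(1)]
        by (simp add: left_diff_distrib distrib_right)
    qed
  qed
  then show ?thesis
    by eventually_elim (simp add: q_def V_def R_def abs_le_iff)
qed

section \<open>Weak derivatives from almost everywhere derivatives\<close>

lemma continuous_on_axis [continuous_intros]:
  fixes f :: "'a::topological_space \<Rightarrow> real"
  assumes "continuous_on S f" shows "continuous_on S (\<lambda>x. axis i (f x) :: real^'n::finite)"
proof -
  have "(\<lambda>x. axis i (f x) :: real^'n) = (\<lambda>x. f x *\<^sub>R axis i 1)" by (simp add: scaleR_axis_1)
  then show ?thesis using assms by (simp only:) (intro continuous_intros)
qed

lemma axis_0: "axis i (0::real) = 0"
  by (simp add: axis_eq_0_iff)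

lemma smooth_axis_derivative:
  assumes "smooth_function \<phi>"
  shows "((\<lambda>s. \<phi> (x + axis i s)) has_real_derivative partial_deriv i \<phi> (x + axis i s)) (at s)"
proof -
  have "((\<lambda>s. x + s *\<^sub>R axis i (1::real)) has_derivative (\<lambda>u. u *\<^sub>R axis i 1)) (at s)"
    by (auto intro!: derivative_eq_intros)
  from has_derivative_compose[OF this smooth_has_derivative[OF assms]]
  have "((\<lambda>s. \<phi> (x + axis i s)) has_derivative (\<lambda>u. \<Sum>j\<in>UNIV. (u *\<^sub>R axis i 1) $ j * partial_deriv j \<phi> (x + axis i s))) (at s)"
    by (simp add: scaleR_axis_1)
  moreover have "(\<Sum>j\<in>UNIV. (u *\<^sub>R axis i 1) $ j * partial_deriv j \<phi> (x + axis i s)) = partial_deriv i \<phi> (x + axis i s) * u" for u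
    by (simp add: axis_def if_distrib if_distribR mult.commute cong: if_cong)
  ultimately show ?thesis by (simp add: has_field_derivative_def)
qed

lemma difference_quotient_limit:
  assumes "((\<lambda>s. f (x + axis i s)) has_real_derivative D) (at 0)" "t \<longlonglongrightarrow> 0" "\<And>n. t n \<noteq> 0"
  shows "(\<lambda>n. (f (x + axis i (t n)) - f x) / t n) \<longlonglongrightarrow> D"
proof -
  have "((\<lambda>h. (f (x + axis i h) - f x) / h) \<longlongrightarrow> D) (at 0)"
    using assms(1) by (simp add: DERIV_def axis_0)
  moreover have "filterlim t (at 0) sequentially"
    using assms(2,3) by (simp add: filterlim_at)
  ultimately show ?thesis by (rule filterlim_compose)
qed

text \<open>
  Translation invariance moves a difference quotient from the test function to \<open>f\<close>. On both sides the
  step tends to \<open>0\<close> under dominated convergence, the Lipschitz bound dominating the quotients of \<open>f\<close>.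
\<close>

lemma distr_deriv_of_ae_deriv:
  fixes f k :: "real^'n::finite \<Rightarrow> real"
  assumes C: "open C"
    and f: "f \<in> borel_measurable lebesgue" "\<And>x. \<bar>f x\<bar> \<le> B"
    and k: "k \<in> borel_measurable lebesgue" "\<And>x. \<bar>k x\<bar> \<le> L"
    and lip: "\<And>x s. \<bar>f (x + axis i s) - f x\<bar> \<le> L * \<bar>s\<bar>"
    and deriv: "AE x in lebesgue. ((\<lambda>s. f (x + axis i s)) has_real_derivative k x) (at 0)"
  shows "has_distr_deriv C [i] f k"
proof -
  have Cs: "C \<in> sets lebesgue" using C by simp
  have fl: "locally_integrable D f" and kl: "locally_integrable D k" if "open D" for D
    using f k that measurable_restrict_space1[of _ lebesgue borel D]
    by (auto intro!: locally_integrable_bounded)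
  define t where "t n = inverse (real (Suc n))" for n
  have t: "t \<longlonglongrightarrow> 0" "\<And>n. 0 < t n" "\<And>n. t n \<le> 1"
    using LIMSEQ_inverse_real_of_nat by (auto simp: t_def[abs_def] inverse_le_1_iff)
  have "(LINT x|lebesgue. f x * partial_deriv i \<phi> x) = - (LINT x|lebesgue. k x * \<phi> x)"
    if \<phi>C: "\<phi> \<in> test_functions C" for \<phi>
  proof -
    have \<phi>: "\<phi> \<in> test_functions UNIV" using \<phi>C test_mono[of C UNIV] by auto
    obtain K where K: "smooth_function \<phi>" "compact K" "K \<subseteq> UNIV" "\<And>x. x \<notin> K \<Longrightarrow> \<phi> x = 0"
      using test_functionE[OF \<phi>] by metis
    have \<phi>t: "(\<lambda>x. \<phi> (x + v)) \<in> test_functions UNIV" for v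
      using test_translate[OF \<phi>, of "-v"] by simp
    note int = integrable_test[OF fl[OF open_UNIV]]
    obtain M where M: "0 \<le> M" "\<And>x. \<bar>partial_deriv i \<phi> x\<bar> \<le> M"
      using test_function_bounded[OF test_partial[OF \<phi>]] by metis
    have eq: "(LINT x|lebesgue. f x * ((\<phi> (x + axis i s) - \<phi> x) / s))
       = (LINT x|lebesgue. (f (x + axis i (- s)) - f x) / s * \<phi> x)" for s
    proof -
      have neg: "axis i (- s) = - axis i s" by (simp add: vec_eq_iff axis_def)
      have shift: "(LINT x|lebesgue. f x * \<phi> (x + axis i s)) = (LINT x|lebesgue. f (x - axis i s) * \<phi> x)"
        using integral_lebesgue_translate[of "\<lambda>x. f x * \<phi> (x + axis i s)" "- axis i s"] by simp
      have int2: "integrable lebesgue (\<lambda>x. f (x - axis i s) * \<phi> x)"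
        using integrable_lebesgue_translate[OF int[OF \<phi>t[of "axis i s"]], of "- axis i s"] by simp
      have "(LINT x|lebesgue. f x * ((\<phi> (x + axis i s) - \<phi> x) / s))
         = ((LINT x|lebesgue. f x * \<phi> (x + axis i s)) - (LINT x|lebesgue. f x * \<phi> x)) / s"
        using int[OF \<phi>] int[OF \<phi>t[of "axis i s"]] by (simp add: right_diff_distrib)
      also have "\<dots> = (LINT x|lebesgue. (f (x + axis i (- s)) - f x) / s * \<phi> x)"
        unfolding shift neg using int[OF \<phi>] int2 by (simp add: left_diff_distrib)
      finally show ?thesis .
    qed
    have lim1: "(\<lambda>n. LINT x|lebesgue. f x * ((\<phi> (x + axis i (t n)) - \<phi> x) / t n))
        \<longlonglongrightarrow> (LINT x|lebesgue. f x * partial_deriv i \<phi> x)"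
    proof (rule integral_dominated_convergence)
      \<comment> \<open>All translates \<open>\<phi>(\<cdot> + axis i s)\<close> with \<open>s \<in> [0, 1]\<close> are supported in this compact set.\<close>
      let ?L = "(\<lambda>p. fst p - axis i (snd p)) ` (K \<times> {0..1})"
      have "compact ?L"
        using K(2) by (intro compact_continuous_image compact_Times) (auto intro!: continuous_intros)
      then have Ls: "?L \<in> sets lebesgue" "emeasure lebesgue ?L < \<infinity>"
        using emeasure_compact_finite[of ?L] borel_compact[of ?L] by auto
      then show "integrable lebesgue (\<lambda>x. \<bar>B\<bar> * M * indicator ?L x)" by simp
      show "(\<lambda>x. f x * partial_deriv i \<phi> x) \<in> borel_measurable lebesgue"
        by (rule borel_measurable_integrable[OF int[OF test_partial[OF \<phi>]]])
      show "(\<lambda>x. f x * ((\<phi> (x + axis i (t n)) - \<phi> x) / t n)) \<in> borel_measurable lebesgue" for n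
        using f(1) borel_measurable_integrable[OF integrable_test_function(1)[OF \<phi>]]
          borel_measurable_integrable[OF integrable_test_function(1)[OF \<phi>t]] by simp
      show "AE x in lebesgue. (\<lambda>n. f x * ((\<phi> (x + axis i (t n)) - \<phi> x) / t n)) \<longlonglongrightarrow> f x * partial_deriv i \<phi> x"
      proof (intro AE_I2 tendsto_mult tendsto_const difference_quotient_limit)
        show "((\<lambda>s. \<phi> (x + axis i s)) has_real_derivative partial_deriv i \<phi> x) (at 0)" for x
          using smooth_axis_derivative[OF K(1), of x i 0] by (simp add: axis_0)
        show "t n \<noteq> 0" for n using t(2)[of n] by simp
      qed (rule t)
      show "AE x in lebesgue. norm (f x * ((\<phi> (x + axis i (t n)) - \<phi> x) / t n)) \<le> \<bar>B\<bar> * M * indicator ?L x" for n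
      proof (intro AE_I2)
        fix x
        show "norm (f x * ((\<phi> (x + axis i (t n)) - \<phi> x) / t n)) \<le> \<bar>B\<bar> * M * indicator ?L x"
        proof (cases "x \<in> ?L")
          case True
          obtain z where "\<phi> (x + axis i (t n)) - \<phi> (x + axis i 0) = (t n - 0) * partial_deriv i \<phi> (x + axis i z)"
            using MVT2[of 0 "t n" "\<lambda>s. \<phi> (x + axis i s)" "\<lambda>s. partial_deriv i \<phi> (x + axis i s)"]
              smooth_axis_derivative[OF K(1)] t(2)[of n] by metis
          then have "(\<phi> (x + axis i (t n)) - \<phi> x) / t n = partial_deriv i \<phi> (x + axis i z)"
            using t(2)[of n] by (simp add: axis_0)
          moreover have "\<bar>f x\<bar> \<le> \<bar>B\<bar>" using f(2)[of x] by linarith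
          ultimately show ?thesis using True M by (auto simp: abs_mult intro!: mult_mono)
        next
          case False
          have "x + axis i s \<notin> K" if "0 \<le> s" "s \<le> 1" for s
          proof
            assume "x + axis i s \<in> K"
            then have "x \<in> ?L" using that by (intro image_eqI[of _ _ "(x + axis i s, s)"]) auto
            with False show False ..
          qed
          from this[of 0] this[of "t n"] have "\<phi> x = 0" "\<phi> (x + axis i (t n)) = 0"
            using t(2,3)[of n] K(4) by (auto simp: axis_0)
          then show ?thesis using M by simp
        qed
      qed
    qed
    have lim2: "(\<lambda>n. LINT x|lebesgue. (f (x + axis i (- t n)) - f x) / t n * \<phi> x)
        \<longlonglongrightarrow> (LINT x|lebesgue. - k x * \<phi> x)"
    proof (rule integral_dominated_convergence)
      show "integrable lebesgue (\<lambda>x. L * \<bar>\<phi> x\<bar>)" using integrable_test_function(1)[OF \<phi>] by simp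
      note \<phi>m[measurable] = borel_measurable_integrable[OF integrable_test_function(1)[OF \<phi>]]
      note f(1)[measurable] k(1)[measurable]
      show "(\<lambda>x. - k x * \<phi> x) \<in> borel_measurable lebesgue" by simp
      show "(\<lambda>x. (f (x + axis i (- t n)) - f x) / t n * \<phi> x) \<in> borel_measurable lebesgue" for n
        using measurable_compose[OF lebesgue_measurable_translation f(1)] by simp
      show "AE x in lebesgue. (\<lambda>n. (f (x + axis i (- t n)) - f x) / t n * \<phi> x) \<longlonglongrightarrow> - k x * \<phi> x"
        using deriv
      proof eventually_elim
        case (elim x)
        have "(\<lambda>n. (f (x + axis i (- t n)) - f x) / (- t n)) \<longlonglongrightarrow> k x"
          using t(2) tendsto_minus[OF t(1)] by (intro difference_quotient_limit[OF elim]) (auto simp: less_imp_neq[symmetric])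
        from tendsto_minus[OF this] have "(\<lambda>n. (f (x + axis i (- t n)) - f x) / t n) \<longlonglongrightarrow> - k x" by simp
        then show ?case by (intro tendsto_mult tendsto_const)
      qed
      show "AE x in lebesgue. norm ((f (x + axis i (- t n)) - f x) / t n * \<phi> x) \<le> L * \<bar>\<phi> x\<bar>" for n
      proof (intro AE_I2)
        fix x
        have "\<bar>f (x + axis i (- t n)) - f x\<bar> / t n \<le> L"
          using lip[of x "- t n"] t(2)[of n] by (simp add: divide_le_eq)
        then have "\<bar>f (x + axis i (- t n)) - f x\<bar> / t n * \<bar>\<phi> x\<bar> \<le> L * \<bar>\<phi> x\<bar>"
          by (rule mult_right_mono) simp
        then show "norm ((f (x + axis i (- t n)) - f x) / t n * \<phi> x) \<le> L * \<bar>\<phi> x\<bar>"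
          using t(2)[of n] by (simp add: abs_mult)
      qed
    qed
    show ?thesis
      using LIMSEQ_unique[OF lim1 lim2[folded eq]] by simp
  qed
  then show ?thesis
    unfolding has_distr_deriv_iff[OF C] using fl kl C by simp
qed

section \<open>Superposition of weak derivatives\<close>

lemma integrable_pair_of_bounded:
  fixes q :: "'a \<Rightarrow> 'b \<Rightarrow> real"
  assumes M: "sigma_finite_measure M" and U: "finite_measure U"
    and q: "(\<lambda>p. q (fst p) (snd p)) \<in> borel_measurable (M \<Otimes>\<^sub>M U)"
    and b: "\<And>x u. x \<in> space M \<Longrightarrow> u \<in> space U \<Longrightarrow> \<bar>q x u\<bar> \<le> B" and \<psi>: "integrable M \<psi>"
  shows "integrable (M \<Otimes>\<^sub>M U) (\<lambda>p. q (fst p) (snd p) * \<psi> (fst p))"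
proof -
  interpret M: sigma_finite_measure M by fact
  interpret U: finite_measure U by fact
  interpret pair_sigma_finite M U ..
  have \<psi>m: "(\<lambda>p. \<psi> (fst p)) \<in> borel_measurable (M \<Otimes>\<^sub>M U)"
    by (rule measurable_compose[OF measurable_fst borel_measurable_integrable[OF \<psi>]])
  have "integrable (M \<Otimes>\<^sub>M U) (\<lambda>p. \<psi> (fst p))"
  proof (rule Fubini_integrable[OF \<psi>m])
    show "integrable M (\<lambda>x. \<integral>y. norm (\<psi> (fst (x, y))) \<partial>U)"
      using \<psi> by simp
  qed simp
  then show ?thesis
  proof (rule Bochner_Integration.integrable_bound[OF integrable_mult_right[of "\<bar>B\<bar>"]])
    show "(\<lambda>p. q (fst p) (snd p) * \<psi> (fst p)) \<in> borel_measurable (M \<Otimes>\<^sub>M U)"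
      using q \<psi>m by (rule borel_measurable_times)
    have le: "\<bar>q (fst p) (snd p)\<bar> \<le> \<bar>B\<bar>" if "p \<in> space (M \<Otimes>\<^sub>M U)" for p
      using b[of "fst p" "snd p"] that by (auto simp: space_pair_measure)
    show "AE p in M \<Otimes>\<^sub>M U. norm (q (fst p) (snd p) * \<psi> (fst p)) \<le> norm (\<bar>B\<bar> * \<psi> (fst p))"
      by (intro AE_I2) (auto simp: abs_mult intro!: mult_right_mono le)
  qed
qed

lemma has_distr_deriv_superposition:
  fixes q r :: "real^'n::finite \<Rightarrow> 'b \<Rightarrow> real"
  assumes C: "open C" and U: "finite_measure U"
    and q: "(\<lambda>p. q (fst p) (snd p)) \<in> borel_measurable (lebesgue \<Otimes>\<^sub>M U)" "\<And>x u. u \<in> space U \<Longrightarrow> \<bar>q x u\<bar> \<le> B"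
    and r: "(\<lambda>p. r (fst p) (snd p)) \<in> borel_measurable (lebesgue \<Otimes>\<^sub>M U)" "\<And>x u. u \<in> space U \<Longrightarrow> \<bar>r x u\<bar> \<le> B"
    and d: "\<And>u. u \<in> space U \<Longrightarrow> has_distr_deriv C is (\<lambda>x. q x u) (\<lambda>x. r x u)"
  shows "has_distr_deriv C is (\<lambda>x. \<integral>u. q x u \<partial>U) (\<lambda>x. \<integral>u. r x u \<partial>U)"
proof -
  interpret U: finite_measure U by fact
  interpret L: sigma_finite_measure "lebesgue :: (real^'n) measure" by (rule sigma_finite_lebesgue)
  interpret pair_sigma_finite "lebesgue :: (real^'n) measure" U ..
  have *: "locally_integrable C (\<lambda>x. \<integral>u. q x u \<partial>U)"
    "\<And>\<psi>. \<psi> \<in> test_functions C \<Longrightarrow> (LINT x|lebesgue. (\<integral>u. q x u \<partial>U) * \<psi> x) = (\<integral>u. (LINT x|lebesgue. q x u * \<psi> x) \<partial>U)"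
    if q: "(\<lambda>p. q (fst p) (snd p)) \<in> borel_measurable (lebesgue \<Otimes>\<^sub>M U)" "\<And>x u. u \<in> space U \<Longrightarrow> \<bar>q x u\<bar> \<le> B"
    for q :: "real^'n \<Rightarrow> 'b \<Rightarrow> real"
  proof -
    have "(\<lambda>x. \<integral>u. q x u \<partial>U) \<in> borel_measurable lebesgue"
      using U.borel_measurable_lebesgue_integral[of "\<lambda>x u. q x u" lebesgue] q(1) by (simp add: split_beta)
    moreover have "\<bar>\<integral>u. q x u \<partial>U\<bar> \<le> \<bar>B\<bar> * measure U (space U)" for x
    proof -
      have "\<bar>\<integral>u. q x u \<partial>U\<bar> \<le> (\<integral>u. \<bar>q x u\<bar> \<partial>U)" by (rule integral_abs_bound)
      also have "\<dots> \<le> (\<integral>u. \<bar>B\<bar> \<partial>U)"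
        using order_trans[OF q(2)[of _ x] abs_ge_self] by (intro Bochner_Integration.integral_mono') auto
      finally show ?thesis by (simp add: mult.commute)
    qed
    ultimately show "locally_integrable C (\<lambda>x. \<integral>u. q x u \<partial>U)"
      using C measurable_restrict_space1[of _ lebesgue borel C]
      by (intro locally_integrable_bounded) auto
    fix \<psi> assume \<psi>: "\<psi> \<in> test_functions C"
    have "integrable (lebesgue \<Otimes>\<^sub>M U) (\<lambda>(x, u). q x u * \<psi> x)"
      unfolding split_beta
      by (rule integrable_pair_of_bounded[OF L.sigma_finite_measure_axioms U q(1) _ integrable_test_function(1)[OF \<psi>]])
        (rule q(2))
    from Fubini_integral[OF this]
    show "(LINT x|lebesgue. (\<integral>u. q x u \<partial>U) * \<psi> x) = (\<integral>u. (LINT x|lebesgue. q x u * \<psi> x) \<partial>U)"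
      by simp
  qed
  have "(LINT x|lebesgue. (\<integral>u. q x u \<partial>U) * iterated_partial_deriv is \<phi> x)
      = (-1) ^ length is * (LINT x|lebesgue. (\<integral>u. r x u \<partial>U) * \<phi> x)" if \<phi>: "\<phi> \<in> test_functions C" for \<phi>
  proof -
    have "(\<integral>u. (LINT x|lebesgue. q x u * iterated_partial_deriv is \<phi> x) \<partial>U)
       = (\<integral>u. (-1) ^ length is * (LINT x|lebesgue. r x u * \<phi> x) \<partial>U)"
      using d \<phi> by (intro Bochner_Integration.integral_cong refl) (simp add: has_distr_deriv_iff[OF C])
    then show ?thesis
      by (simp add: *(2)[OF q test_iterated_partial[OF \<phi>]] *(2)[OF r \<phi>])
  qed
  then show ?thesis
    unfolding has_distr_deriv_iff[OF C] using *(1)[OF q] *(1)[OF r] by simp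
qed

section \<open>The extremal function\<close>

text \<open>
  The factor in coordinate \<open>i\<close> of the layer at height \<open>u\<close>; \<open>S\<close> is the set of the coordinates in which
  the derivative has already been taken. The derivative of the truncation to \<open>[-u, u]\<close> is the indicator
  of \<open>\<bar>s\<bar> < u\<close>. In a coordinate of \<open>J\<close> only \<open>s > 0\<close> matters, where the truncation takes values in \<open>[0, u]\<close>;
  subtracting the constant \<open>u / 2\<close> halves its maximal modulus without changing the derivative.
\<close>

definition profile :: "'n set \<Rightarrow> 'n set \<Rightarrow> real \<Rightarrow> 'n \<Rightarrow> real \<Rightarrow> real" where
  "profile J S u i s = (if i \<in> S then of_bool (\<bar>s\<bar> < u)
     else max (- u) (min u s) - (if i \<in> J then u / 2 else 0))"

definition profile_prod :: "'n::finite set \<Rightarrow> 'n set \<Rightarrow> real^'n \<Rightarrow> real \<Rightarrow> real" where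
  "profile_prod J S x u = (\<Prod>i\<in>UNIV. profile J S u i (x $ i))"

lemma abs_prod_le_power:
  fixes f :: "'n::finite \<Rightarrow> real"
  assumes "\<And>i. \<bar>f i\<bar> \<le> M" "1 \<le> M"
  shows "\<bar>\<Prod>i\<in>A. f i\<bar> \<le> M ^ CARD('n)"
proof -
  have "\<bar>\<Prod>i\<in>A. f i\<bar> \<le> (\<Prod>i\<in>A. M)"
    unfolding abs_prod by (intro prod_mono) (auto simp: assms)
  also have "\<dots> \<le> M ^ CARD('n)"
    using assms(2) by (simp add: power_increasing card_mono)
  finally show ?thesis .
qed

lemma profile_bound:
  assumes "0 \<le> u" "u \<le> h" shows "\<bar>profile J S u i s\<bar> \<le> 1 + 2 * h"
  using assms by (auto simp: profile_def)

lemma profile_prod_bound: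
  fixes x :: "real^'n::finite"
  assumes "0 \<le> u" "u \<le> h" shows "\<bar>profile_prod J S x u\<bar> \<le> (1 + 2 * h) ^ CARD('n)"
  unfolding profile_prod_def using assms by (intro abs_prod_le_power profile_bound) auto

lemma component_measurable [measurable]:
  "(\<lambda>x. x $ i) \<in> borel_measurable (lebesgue :: (real^'n::finite) measure)"
  by (intro measurable_completion) (simp add: borel_measurable_continuous_onI continuous_intros)

lemma profile_prod_measurable:
  fixes J :: "'n::finite set"
  assumes U: "sets U = sets (restrict_space borel A)"
  shows "(\<lambda>p. profile_prod J S (fst p) (snd p)) \<in> borel_measurable (lebesgue \<Otimes>\<^sub>M U)"
proof -
  have c[measurable]: "(\<lambda>p. (fst p :: real^'n) $ i) \<in> borel_measurable (lebesgue \<Otimes>\<^sub>M U)" for i :: 'n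
    by (rule measurable_compose[OF measurable_fst component_measurable])
  have "(\<lambda>u. u) \<in> borel_measurable U"
    unfolding measurable_cong_sets[OF U refl] by (rule measurable_restrict_space1) simp
  then have [measurable]: "snd \<in> borel_measurable ((lebesgue :: (real^'n) measure) \<Otimes>\<^sub>M U)"
    using measurable_compose[OF measurable_snd[of "lebesgue :: (real^'n) measure" U]] by auto
  show ?thesis
    unfolding profile_prod_def profile_def by measurable
qed

lemma axis_component: "axis i s $ j = (if j = i then s else (0::real))"
  by (simp add: axis_def)

lemma profile_prod_split:
  fixes x :: "real^'n::finite"
  shows "profile_prod J S (x + axis i s) u = profile J S u i (x $ i + s) * (\<Prod>j\<in>UNIV - {i}. profile J S u j (x $ j))"
  unfolding profile_prod_def
  by (subst prod.remove[of UNIV i]) (auto simp: axis_component intro!: prod.cong)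

lemma AE_component_neq:
  fixes c :: real and i :: "'n::finite"
  shows "AE x in lebesgue. (x :: real^'n) $ i \<noteq> c"
proof -
  have "negligible {x :: real^'n. axis i 1 \<bullet> x = c}"
    by (rule negligible_hyperplane) (simp add: axis_eq_0_iff)
  then have "AE x in lebesgue. x \<notin> {x :: real^'n. axis i 1 \<bullet> x = c}"
    unfolding negligible_iff_null_sets by (rule AE_not_in)
  then show ?thesis by (simp add: inner_axis')
qed

lemma AE_component_neq_component:
  fixes i j :: "'n::finite"
  assumes "i \<noteq> j"
  shows "AE x in lebesgue. \<bar>(x :: real^'n) $ i\<bar> \<noteq> \<bar>x $ j\<bar>"
proof -
  have ne: "axis i 1 + c *\<^sub>R axis j 1 \<noteq> (0 :: real^'n)" for c
  proof
    assume "axis i 1 + c *\<^sub>R axis j 1 = (0 :: real^'n)"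
    then have "(axis i 1 + c *\<^sub>R axis j 1 :: real^'n) $ i = 0" by simp
    then show False using assms by (simp add: axis_def)
  qed
  have "AE x in lebesgue. x \<notin> {x :: real^'n. (axis i 1 + c *\<^sub>R axis j 1) \<bullet> x = 0}" for c
    using negligible_hyperplane[of "axis i 1 + c *\<^sub>R axis j 1 :: real^'n" 0] ne[of c]
    unfolding negligible_iff_null_sets by (intro AE_not_in) auto
  from this[of 1] this[of "-1"] show ?thesis
    by eventually_elim (auto simp: inner_add_left inner_diff_left inner_axis' abs_eq_iff)
qed

lemma profile_deriv:
  assumes "i \<notin> S" "\<bar>s\<bar> \<noteq> u" "0 \<le> u"
  shows "((\<lambda>t. profile J S u i (s + t)) has_real_derivative profile J (insert i S) u i s) (at 0)"
proof -
  let ?c = "if i \<in> J then u / 2 else 0"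
  consider "\<bar>s\<bar> < u" | "s > u" | "s < - u" using assms(2) by linarith
  then show ?thesis
  proof cases
    case 1
    have "((\<lambda>t. s + t - ?c) has_real_derivative 1) (at 0)"
      by (auto intro!: derivative_eq_intros)
    then have "((\<lambda>t. profile J S u i (s + t)) has_real_derivative 1) (at 0)"
      by (rule has_field_derivative_transform_within_open[where S = "{- u - s<..<u - s}"])
        (use 1 assms(1) in \<open>auto simp: profile_def\<close>)
    then show ?thesis using 1 by (simp add: profile_def)
  next
    case 2
    have "((\<lambda>t. u - ?c) has_real_derivative 0) (at 0)" by simp
    then have "((\<lambda>t. profile J S u i (s + t)) has_real_derivative 0) (at 0)"
      by (rule has_field_derivative_transform_within_open[where S = "{u - s<..}"])
        (use 2 assms(1,3) in \<open>auto simp: profile_def\<close>)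
    then show ?thesis using 2 assms(3) by (simp add: profile_def)
  next
    case 3
    have "((\<lambda>t. - u - ?c) has_real_derivative 0) (at 0)" by simp
    then have "((\<lambda>t. profile J S u i (s + t)) has_real_derivative 0) (at 0)"
      by (rule has_field_derivative_transform_within_open[where S = "{..<- u - s}"])
        (use 3 assms(1,3) in \<open>auto simp: profile_def\<close>)
    then show ?thesis using 3 assms(3) by (simp add: profile_def)
  qed
qed

lemma profile_lipschitz:
  "i \<notin> S \<Longrightarrow> \<bar>profile J S u i (s + t) - profile J S u i s\<bar> \<le> \<bar>t\<bar>"
  by (auto simp: profile_def)

lemma profile_prod_measurable_x:
  "(\<lambda>x. profile_prod J S (x :: real^'n::finite) u) \<in> borel_measurable lebesgue"
  unfolding profile_prod_def profile_def by measurable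

text \<open>
  Differentiating in coordinate \<open>i\<close> affects one factor only, and this factor is piecewise linear with
  kinks on the null set \<open>\<bar>x\<^sub>i\<bar> = u\<close>.
\<close>

lemma profile_prod_weak_deriv:
  fixes C :: "(real^'n::finite) set"
  assumes C: "open C" and i: "i \<notin> S" and u: "0 \<le> u" "u \<le> h"
  shows "has_distr_deriv C [i] (\<lambda>x. profile_prod J S x u) (\<lambda>x. profile_prod J (insert i S) x u)"
proof (rule distr_deriv_of_ae_deriv[OF C profile_prod_measurable_x profile_prod_bound[OF u] profile_prod_measurable_x profile_prod_bound[OF u]])
  let ?R = "\<lambda>x::real^'n. \<Prod>j\<in>UNIV - {i}. profile J S u j (x $ j)"
  have R: "\<bar>?R x\<bar> \<le> (1 + 2 * h) ^ CARD('n)" for x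
    using u by (intro abs_prod_le_power profile_bound) auto
  have split0: "profile_prod J S x u = profile J S u i (x $ i) * ?R x" for x
    using profile_prod_split[of J S x i 0 u] by (simp add: axis_0)
  have split1: "profile_prod J (insert i S) x u = profile J (insert i S) u i (x $ i) * ?R x" for x
  proof -
    have "(\<Prod>j\<in>UNIV - {i}. profile J (insert i S) u j (x $ j)) = ?R x"
      by (intro prod.cong) (auto simp: profile_def)
    then show ?thesis
      using profile_prod_split[of J "insert i S" x i 0 u] by (simp add: axis_0)
  qed
  show "\<bar>profile_prod J S (x + axis i s) u - profile_prod J S x u\<bar> \<le> (1 + 2 * h) ^ CARD('n) * \<bar>s\<bar>" for x s
  proof -
    have "\<bar>profile_prod J S (x + axis i s) u - profile_prod J S x u\<bar>
        = \<bar>profile J S u i (x $ i + s) - profile J S u i (x $ i)\<bar> * \<bar>?R x\<bar>"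
      unfolding profile_prod_split split0 by (simp add: abs_mult[symmetric] left_diff_distrib)
    also have "\<dots> \<le> \<bar>s\<bar> * (1 + 2 * h) ^ CARD('n)"
      by (intro mult_mono R profile_lipschitz[OF i]) auto
    finally show ?thesis by (simp add: mult.commute)
  qed
  show "AE x in lebesgue. ((\<lambda>s. profile_prod J S (x + axis i s) u) has_real_derivative profile_prod J (insert i S) x u) (at 0)"
    using AE_component_neq[of i u] AE_component_neq[of i "- u"]
  proof eventually_elim
    case (elim x)
    then have "\<bar>x $ i\<bar> \<noteq> u" by auto
    from profile_deriv[OF i this u(1)]
    show ?case unfolding profile_prod_split split1 by (rule DERIV_cmult_right)
  qed
qed

lemma profile_prod_iterated_weak_deriv:
  fixes C :: "(real^'n::finite) set"
  assumes C: "open C" and u: "0 \<le> u" "u \<le> h" and "distinct is"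
  shows "has_distr_deriv C is (\<lambda>x. profile_prod J {} x u) (\<lambda>x. profile_prod J (set is) x u)"
  using assms(4)
proof (induction "is" rule: rev_induct)
  case Nil
  have "locally_integrable C (\<lambda>x. profile_prod J {} x u)"
    using C profile_prod_bound[OF u]
    by (intro locally_integrable_bounded measurable_restrict_space1[OF profile_prod_measurable_x]) auto
  then show ?case by (simp add: has_distr_deriv_def)
next
  case (snoc i "is")
  then have "has_distr_deriv C [i] (\<lambda>x. profile_prod J (set is) x u) (\<lambda>x. profile_prod J (insert i (set is)) x u)"
    by (intro profile_prod_weak_deriv[OF C _ u]) auto
  with snoc show ?case by (intro has_distr_deriv_append) auto
qed

definition max_coord :: "real^'n::finite \<Rightarrow> real" where
  "max_coord x = Max (range (\<lambda>i. \<bar>x $ i\<bar>))"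

definition pyramid :: "real \<Rightarrow> real^'n::finite \<Rightarrow> real" where
  "pyramid h x = max 0 (h - max_coord x)"

text \<open>
  The layer-cake formula writes the pyramid \<open>max 0 (h - \<bar>x\<bar>\<^sub>\<infinity>)\<close> as the integral over \<open>u \<in> [0, h]\<close> of the
  indicators of \<open>\<bar>x\<bar>\<^sub>\<infinity> < u\<close>. Each layer is a product of functions of one variable, so it has an explicit
  primitive with respect to all variables, and these are integrated over \<open>u\<close>.
\<close>

definition pyramid_primitive :: "'n::finite set \<Rightarrow> real \<Rightarrow> real^'n \<Rightarrow> real" where
  "pyramid_primitive J h x = (\<integral>u. profile_prod J {} x u \<partial>restrict_space lborel {0..h})"

lemma max_coord_le_iff: "max_coord (x :: real^'n::finite) \<le> u \<longleftrightarrow> (\<forall>i. \<bar>x $ i\<bar> \<le> u)"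
  unfolding max_coord_def by (subst Max_le_iff) auto

lemma max_coord_less_iff: "max_coord (x :: real^'n::finite) < u \<longleftrightarrow> (\<forall>i. \<bar>x $ i\<bar> < u)"
  unfolding max_coord_def by (subst Max_less_iff) auto

lemma max_coord_nonneg: "0 \<le> max_coord (x :: real^'n::finite)"
  unfolding max_coord_def by (subst Max_ge_iff) auto

lemma pyramid_layers:
  fixes x :: "real^'n::finite"
  assumes "0 \<le> h"
  shows "(\<integral>u. profile_prod J UNIV x u \<partial>restrict_space lborel {0..h}) = pyramid h x"
proof -
  let ?r = "max_coord x"
  have "profile_prod J UNIV x u = of_bool (?r < u)" for u
    unfolding profile_prod_def profile_def max_coord_less_iff by (simp add: prod.neutral prod_zero_iff)
  then have "(\<integral>u. profile_prod J UNIV x u \<partial>restrict_space lborel {0..h}) = (\<integral>u. indicator {0..h} u * of_bool (?r < u) \<partial>lborel)"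
    by (simp add: integral_restrict_space)
  also have "\<dots> = (\<integral>u. indicator {?r<..h} u \<partial>lborel)"
    using max_coord_nonneg[of x] by (intro Bochner_Integration.integral_cong) (auto simp: indicator_def)
  also have "\<dots> = pyramid h x"
    using max_coord_nonneg[of x] by (cases "?r \<le> h") (auto simp: pyramid_def not_le)
  finally show ?thesis .
qed

lemma finite_measure_interval: "finite_measure (restrict_space lborel {0..h::real})"
  by (rule finite_measureI) (simp add: space_restrict_space emeasure_restrict_space emeasure_lborel_Icc_eq)

lemma pyramid_primitive_mixed_deriv:
  fixes C :: "(real^'n::finite) set"
  assumes C: "open C" and h: "0 \<le> h"
  shows "has_distr_deriv C all_coords (pyramid_primitive J h) (pyramid h)"
proof -
  let ?U = "restrict_space lborel {0..h}"
  have m: "(\<lambda>p. profile_prod J S (fst p) (snd p)) \<in> borel_measurable (lebesgue \<Otimes>\<^sub>M ?U)" for S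
    by (rule profile_prod_measurable[where A = "{0..h}"]) (simp add: sets_restrict_space)
  have "has_distr_deriv C all_coords (\<lambda>x. \<integral>u. profile_prod J {} x u \<partial>?U) (\<lambda>x. \<integral>u. profile_prod J (set all_coords) x u \<partial>?U)"
    by (rule has_distr_deriv_superposition[OF C finite_measure_interval m _ m, where B = "(1 + 2 * h) ^ CARD('n)"])
      (auto simp: space_restrict_space intro!: profile_prod_bound profile_prod_iterated_weak_deriv[OF C _ _ all_coords(1)])
  then show ?thesis
    by (simp add: all_coords(2) pyramid_layers[OF h] pyramid_primitive_def[abs_def])
qed

text \<open>
  On the cone the factors of a layer are bounded by \<open>u\<close>, and by \<open>u / 2\<close> for the coordinates in \<open>J\<close>. The
  integral of \<open>u\<^sup>d / 2\<^bsup>card J\<^esup>\<close> over \<open>[0, h]\<close> is the bound.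
\<close>

lemma pyramid_primitive_bound:
  fixes x :: "real^'n::finite"
  assumes h: "0 \<le> h" and x: "\<And>i. i \<in> J \<Longrightarrow> 0 < x $ i"
  shows "\<bar>pyramid_primitive J h x\<bar> \<le> h ^ (CARD('n) + 1) / (2 ^ card J * (real CARD('n) + 1))"
proof -
  let ?U = "restrict_space lborel {0..h}"
  let ?d = "CARD('n)"
  interpret U: finite_measure ?U by (rule finite_measure_interval)
  have pb: "\<bar>profile_prod J {} x u\<bar> \<le> u ^ ?d / 2 ^ card J" if u: "0 \<le> u" for u
  proof -
    have "\<bar>profile_prod J {} x u\<bar> \<le> (\<Prod>i\<in>UNIV. u * (if i \<in> J then 1 / 2 else 1))"
      unfolding profile_prod_def abs_prod
    proof (intro prod_mono conjI)
      fix i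
      show "\<bar>profile J {} u i (x $ i)\<bar> \<le> u * (if i \<in> J then 1 / 2 else 1)"
        using u x[of i] by (auto simp: profile_def abs_le_iff min_def max_def)
    qed auto
    also have "\<dots> = u ^ ?d * (1 / 2) ^ card J"
      by (simp add: prod.distrib prod.If_cases)
    finally show ?thesis by (simp add: power_one_over)
  qed
  have int: "((\<lambda>u. u ^ ?d / 2 ^ card J) has_integral (h ^ Suc ?d / (2 ^ card J * real (Suc ?d)) - 0 ^ Suc ?d / (2 ^ card J * real (Suc ?d)))) {0..h}"
    using h by (intro fundamental_theorem_of_calculus)
      (auto intro!: derivative_eq_intros simp: has_real_derivative_iff_has_vector_derivative[symmetric] simp del: of_nat_Suc power_Suc)
  have cont: "continuous_on {0..h} (\<lambda>u::real. u ^ ?d / 2 ^ card J)" by (intro continuous_intros) auto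
  have sint: "set_integrable lborel {0..h} (\<lambda>u::real. u ^ ?d / 2 ^ card J)"
    by (rule borel_integrable_atLeastAtMost'[OF cont])
  have "\<bar>pyramid_primitive J h x\<bar> \<le> (\<integral>u. \<bar>profile_prod J {} x u\<bar> \<partial>?U)"
    unfolding pyramid_primitive_def by (rule integral_abs_bound)
  also have "\<dots> \<le> (\<integral>u. u ^ ?d / 2 ^ card J \<partial>?U)"
    using sint by (intro Bochner_Integration.integral_mono')
      (auto simp: pb space_restrict_space integrable_restrict_space set_integrable_def)
  also have "\<dots> = (LINT u:{0..h}|lborel. u ^ ?d / 2 ^ card J)"
    by (simp add: integral_restrict_space set_lebesgue_integral_def)
  also have "\<dots> = integral {0..h} (\<lambda>u. u ^ ?d / 2 ^ card J)"
    using sint by (rule set_borel_integral_eq_integral)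
  also have "\<dots> = h ^ (?d + 1) / (2 ^ card J * (real ?d + 1))"
    using integral_unique[OF int] by (simp add: add.commute)
  finally show ?thesis .
qed

text \<open>
  Off a null set, the pyramid varies only with the coordinate of strictly largest modulus. At any point at
  most one slope is nonzero, which bounds the \<open>\<ell>\<^sub>1\<close>-norm of the gradient by \<open>1\<close>.
\<close>

definition pyramid_slope :: "real \<Rightarrow> 'n::finite \<Rightarrow> real^'n \<Rightarrow> real" where
  "pyramid_slope h i x = (if \<bar>x $ i\<bar> < h \<and> (\<forall>j. j \<noteq> i \<longrightarrow> \<bar>x $ j\<bar> < \<bar>x $ i\<bar>) then - sgn (x $ i) else 0)"

lemma pyramid_slope_sum: "(\<Sum>i\<in>UNIV. \<bar>pyramid_slope h i x\<bar>) \<le> 1"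
proof (cases "\<exists>i. pyramid_slope h i x \<noteq> 0")
  case True
  then obtain i where i: "pyramid_slope h i x \<noteq> 0" by blast
  then have "\<bar>x $ j\<bar> < \<bar>x $ i\<bar>" if "j \<noteq> i" for j
    using that by (auto simp: pyramid_slope_def split: if_splits)
  then have "pyramid_slope h j x = 0" if "j \<noteq> i" for j
    using that by (fastforce simp: pyramid_slope_def)
  then have "(\<Sum>j\<in>UNIV. \<bar>pyramid_slope h j x\<bar>) = (\<Sum>j\<in>{i}. \<bar>pyramid_slope h j x\<bar>)"
    by (intro sum.mono_neutral_right) auto
  also have "\<dots> \<le> 1" by (auto simp: pyramid_slope_def sgn_if)
  finally show ?thesis .
qed simp

lemma pyramid_bounds: "0 \<le> h \<Longrightarrow> 0 \<le> pyramid h x" "0 \<le> h \<Longrightarrow> pyramid h x \<le> h"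
  using max_coord_nonneg[of x] by (auto simp: pyramid_def)

lemma pyramid_lipschitz:
  fixes x :: "real^'n::finite"
  shows "\<bar>pyramid h (x + axis i s) - pyramid h x\<bar> \<le> \<bar>s\<bar>"
proof -
  let ?r = "max_coord :: real^'n \<Rightarrow> real"
  have le: "\<bar>x $ j\<bar> \<le> ?r x" for x :: "real^'n" and j
    using max_coord_le_iff[of x "?r x"] by simp
  have "?r (x + axis i s) \<le> ?r x + \<bar>s\<bar>"
    unfolding max_coord_le_iff
  proof
    fix j show "\<bar>(x + axis i s) $ j\<bar> \<le> ?r x + \<bar>s\<bar>"
      using le[of x j] by (auto simp: axis_component)
  qed
  moreover have "?r x \<le> ?r (x + axis i s) + \<bar>s\<bar>"
    unfolding max_coord_le_iff[of x]
  proof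
    fix j show "\<bar>x $ j\<bar> \<le> ?r (x + axis i s) + \<bar>s\<bar>"
      using le[of "x + axis i s" j] by (auto simp: axis_component split: if_splits)
  qed
  ultimately show ?thesis unfolding pyramid_def by linarith
qed

text \<open>
  Near a point where the moduli of the coordinates are distinct, the maximum norm is either \<open>\<bar>x\<^sub>i\<bar>\<close> itself or
  a function of another coordinate, and then it is constant in direction \<open>i\<close>.
\<close>

lemma pyramid_deriv:
  fixes x :: "real^'n::finite"
  assumes h: "0 \<le> h" and neq: "\<And>j k. j \<noteq> k \<Longrightarrow> \<bar>x $ j\<bar> \<noteq> \<bar>x $ k\<bar>" and x0: "x $ i \<noteq> 0" and xh: "\<bar>x $ i\<bar> \<noteq> h"
  shows "((\<lambda>s. pyramid h (x + axis i s)) has_real_derivative pyramid_slope h i x) (at 0)"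
proof -
  let ?r = "max_coord :: real^'n \<Rightarrow> real"
  show ?thesis
  proof (cases "\<forall>j. j \<noteq> i \<longrightarrow> \<bar>x $ j\<bar> < \<bar>x $ i\<bar>")
    case True
    \<comment> \<open>Moving coordinate \<open>i\<close> by less than \<open>Min A\<close> changes neither its sign, nor its side of \<open>\<plusminus>h\<close>, nor its dominance.\<close>
    define A where "A = insert \<bar>x $ i\<bar> (insert \<bar>\<bar>x $ i\<bar> - h\<bar> ((\<lambda>j. \<bar>x $ i\<bar> - \<bar>x $ j\<bar>) ` (UNIV - {i})))"
    define e where "e = Min A"
    have A: "finite A" "A \<noteq> {}" by (simp_all add: A_def)
    have e: "e > 0" unfolding e_def Min_gr_iff[OF A] using True x0 xh by (auto simp: A_def)
    have e_le: "e \<le> \<bar>x $ i\<bar>" "e \<le> \<bar>\<bar>x $ i\<bar> - h\<bar>" "\<And>j. j \<noteq> i \<Longrightarrow> e \<le> \<bar>x $ i\<bar> - \<bar>x $ j\<bar>"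
      unfolding e_def by (rule Min_le[OF A(1)], simp add: A_def)+
    have r: "?r (x + axis i s) = \<bar>x $ i + s\<bar>" if s: "\<bar>s\<bar> < e" for s
    proof (rule antisym)
      show "?r (x + axis i s) \<le> \<bar>x $ i + s\<bar>"
        unfolding max_coord_le_iff
      proof
        fix j show "\<bar>(x + axis i s) $ j\<bar> \<le> \<bar>x $ i + s\<bar>"
          using e_le(3)[of j] s by (cases "j = i") (auto simp: axis_component)
      qed
      have "\<bar>(x + axis i s) $ i\<bar> \<le> ?r (x + axis i s)"
        using max_coord_le_iff[of "x + axis i s" "?r (x + axis i s)"] by blast
      then show "\<bar>x $ i + s\<bar> \<le> ?r (x + axis i s)" by (simp add: axis_component)
    qed
    show ?thesis
    proof (cases "\<bar>x $ i\<bar> < h")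
      case less: True
      have "((\<lambda>s. h - sgn (x $ i) * (x $ i + s)) has_real_derivative - sgn (x $ i)) (at 0)"
        by (auto intro!: derivative_eq_intros)
      then have "((\<lambda>s. pyramid h (x + axis i s)) has_real_derivative - sgn (x $ i)) (at 0)"
        by (rule has_field_derivative_transform_within_open[where S = "{-e<..<e}"])
          (use e e_le(1,2) less in \<open>auto simp: pyramid_def r sgn_if\<close>)
      then show ?thesis using True less by (simp add: pyramid_slope_def)
    next
      case ge: False
      have "((\<lambda>s. 0) has_real_derivative 0) (at 0)" by simp
      then have "((\<lambda>s. pyramid h (x + axis i s)) has_real_derivative 0) (at 0)"
        by (rule has_field_derivative_transform_within_open[where S = "{-e<..<e}"])
          (use e e_le(1,2) ge in \<open>auto simp: pyramid_def r\<close>)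
      then show ?thesis using ge by (simp add: pyramid_slope_def)
    qed
  next
    case False
    then obtain j where j: "j \<noteq> i" "\<bar>x $ i\<bar> < \<bar>x $ j\<bar>"
      using neq by (metis linorder_neqE_linordered_idom)
    have r: "?r (x + axis i s) = ?r x" if s: "\<bar>s\<bar> < \<bar>x $ j\<bar> - \<bar>x $ i\<bar>" for s
    proof -
      have "?r (x + axis i s) \<le> u \<longleftrightarrow> ?r x \<le> u" for u
        unfolding max_coord_le_iff
      proof (intro iffI allI)
        fix k assume le: "\<forall>k. \<bar>(x + axis i s) $ k\<bar> \<le> u"
        then have "\<bar>x $ j\<bar> \<le> u" using j(1) le[rule_format, of j] by (simp add: axis_component)
        then show "\<bar>x $ k\<bar> \<le> u" using le[rule_format, of k] j(2) by (cases "k = i") (auto simp: axis_component)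
      next
        fix k assume le: "\<forall>k. \<bar>x $ k\<bar> \<le> u"
        have "\<bar>x $ j\<bar> \<le> u" "\<bar>x $ k\<bar> \<le> u" using le by auto
        then show "\<bar>(x + axis i s) $ k\<bar> \<le> u" using s by (cases "k = i") (auto simp: axis_component)
      qed
      then show ?thesis by (metis order.eq_iff)
    qed
    have "((\<lambda>s. pyramid h x) has_real_derivative 0) (at 0)" by simp
    then have "((\<lambda>s. pyramid h (x + axis i s)) has_real_derivative 0) (at 0)"
      by (rule has_field_derivative_transform_within_open[where S = "{-(\<bar>x $ j\<bar> - \<bar>x $ i\<bar>)<..<\<bar>x $ j\<bar> - \<bar>x $ i\<bar>}"])
        (use j in \<open>auto simp: pyramid_def r\<close>)
    then show ?thesis using False by (auto simp: pyramid_slope_def)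
  qed
qed

lemma pyramid_measurable:
  "pyramid h \<in> borel_measurable (lebesgue :: (real^'n::finite) measure)"
  "pyramid_slope h i \<in> borel_measurable (lebesgue :: (real^'n::finite) measure)"
proof -
  have "(max_coord :: real^'n \<Rightarrow> real) \<in> borel_measurable lebesgue"
    unfolding borel_measurable_iff_le max_coord_le_iff by measurable
  then show "pyramid h \<in> borel_measurable (lebesgue :: (real^'n::finite) measure)"
    unfolding pyramid_def[abs_def] by simp
  show "pyramid_slope h i \<in> borel_measurable (lebesgue :: (real^'n::finite) measure)"
    unfolding pyramid_slope_def[abs_def] by measurable
qed

lemma pyramid_weak_deriv:
  fixes C :: "(real^'n::finite) set"
  assumes C: "open C" and h: "0 \<le> h"
  shows "has_distr_deriv C [i] (pyramid h) (pyramid_slope h i)"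
proof (rule distr_deriv_of_ae_deriv[OF C])
  show "\<bar>pyramid h x\<bar> \<le> h" for x :: "real^'n" using pyramid_bounds[OF h, of x] by simp
  show "\<bar>pyramid_slope h i x\<bar> \<le> 1" for x :: "real^'n" by (auto simp: pyramid_slope_def sgn_if)
  show "\<bar>pyramid h (x + axis i s) - pyramid h x\<bar> \<le> 1 * \<bar>s\<bar>" for x :: "real^'n" and s
    using pyramid_lipschitz by simp
  have "AE x in lebesgue. \<forall>j k. j \<noteq> k \<longrightarrow> \<bar>(x :: real^'n) $ j\<bar> \<noteq> \<bar>x $ k\<bar>"
    unfolding AE_all_countable using AE_component_neq_component by auto
  then show "AE x in lebesgue. ((\<lambda>s. pyramid h ((x :: real^'n) + axis i s)) has_real_derivative pyramid_slope h i x) (at 0)"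
    using AE_component_neq[of i 0] AE_component_neq[of i h] AE_component_neq[of i "- h"]
    by eventually_elim (intro pyramid_deriv[OF h]; auto)
qed (rule pyramid_measurable)+

section \<open>The difference operator on the cone\<close>

text \<open>
  The lower ends of the averaging box: \<open>[0, h]\<close> in the coordinates that have to remain positive and
  \<open>[-h, h]\<close> in the others. Both have the same distribution of \<open>\<bar>t\<^sub>i\<bar>\<close>, but a one-sided interval has half
  the length, which costs a factor \<open>2\<close> in the norm of the operator.
\<close>

definition cone_lower :: "'n set \<Rightarrow> real \<Rightarrow> 'n \<Rightarrow> real" where
  "cone_lower J h = (\<lambda>i. if i \<in> J then 0 else - h)"

definition difference_operator :: "'n::finite set \<Rightarrow> real \<Rightarrow> (real^'n \<Rightarrow> real) \<Rightarrow> real^'n \<Rightarrow> real" where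
  "difference_operator J h f x =
     foldr (forward_diff (cone_lower J h) (\<lambda>_. h)) all_coords f x / (\<Prod>i\<in>UNIV. h - cone_lower J h i)"

lemma prod_cone_lower:
  fixes J :: "'n::finite set"
  shows "(\<Prod>i\<in>UNIV. h - cone_lower J h i) = (2 * h) ^ CARD('n) / 2 ^ card J"
proof -
  have "(\<Prod>i\<in>UNIV. h - cone_lower J h i) = (\<Prod>i\<in>UNIV. 2 * h * (if i \<in> J then 1 / 2 else 1))"
    by (intro prod.cong) (auto simp: cone_lower_def)
  also have "\<dots> = (2 * h) ^ CARD('n) * (1 / 2) ^ card J"
    by (simp add: prod.distrib prod.If_cases)
  finally show ?thesis by (simp add: power_one_over)
qed

lemma length_all_coords: "length (all_coords :: 'n::finite list) = CARD('n)"
  by (metis all_coords distinct_card)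

lemma open_positive_cone: "open (positive_cone (J :: 'n::finite set))"
proof -
  have "positive_cone J = (\<Inter>i\<in>J. {x :: real^'n. 0 < x $ i})"
    by (auto simp: positive_cone_def)
  then show ?thesis by (auto intro!: open_INT open_Collect_less continuous_intros)
qed

lemma positive_cone_shift:
  assumes "x \<in> positive_cone J" "\<And>i. cone_lower J h i \<le> v $ i"
  shows "x + v \<in> positive_cone J"
  unfolding positive_cone_def
proof (intro CollectI ballI)
  fix i assume "i \<in> J"
  then have "0 < x $ i" "0 \<le> v $ i"
    using assms(1) assms(2)[of i] by (auto simp: positive_cone_def cone_lower_def)
  then show "0 < (x + v) $ i" by simp
qed

lemma foldr_forward_diff_add:
  "foldr (forward_diff a b) is (\<lambda>y. f y + g y) = (\<lambda>x. foldr (forward_diff a b) is f x + foldr (forward_diff a b) is g x)"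
  by (induction "is") (auto simp: forward_diff_def)

lemma foldr_forward_diff_cmult:
  "foldr (forward_diff a b) is (\<lambda>y. c * f y) = (\<lambda>x. c * foldr (forward_diff a b) is f x)"
  by (induction "is") (auto simp: forward_diff_def right_diff_distrib)

lemma difference_operator_add:
  "difference_operator J h (\<lambda>y. f y + g y) x = difference_operator J h f x + difference_operator J h g x"
  by (simp add: difference_operator_def foldr_forward_diff_add add_divide_distrib)

lemma difference_operator_cmult:
  "difference_operator J h (\<lambda>y. c * f y) x = c * difference_operator J h f x"
  by (simp add: difference_operator_def foldr_forward_diff_cmult)

text \<open>
  There are \<open>2\<^sup>d\<close> corners, and the box has volume \<open>2\<^bsup>d-m\<^esup> h\<^sup>d\<close> with \<open>m = card J\<close>.
\<close>

lemma difference_operator_bound: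
  fixes J :: "'n::finite set"
  assumes h: "h > 0" and f: "f \<in> borel_measurable (lebesgue_on (positive_cone J))"
    and B: "AE x in lebesgue_on (positive_cone J). \<bar>f x\<bar> \<le> B"
  shows "difference_operator J h f \<in> borel_measurable (lebesgue_on (positive_cone J))"
    and "AE x in lebesgue_on (positive_cone J). \<bar>difference_operator J h f x\<bar> \<le> 2 ^ card J / h ^ CARD('n) * B"
proof -
  let ?C = "positive_cone J" and ?a = "cone_lower J h" and ?b = "\<lambda>_::'n. h"
  let ?V = "\<Prod>i\<in>UNIV. h - cone_lower J h i"
  have V: "?V > 0" unfolding prod_cone_lower using h by simp
  have *: "foldr (forward_diff ?a ?b) all_coords f \<in> borel_measurable (lebesgue_on ?C) \<and>
    (AE x in lebesgue_on ?C. \<bar>foldr (forward_diff ?a ?b) all_coords f x\<bar> \<le> 2 ^ length (all_coords :: 'n list) * B)"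
  proof (rule foldr_forward_diff_Linf[OF _ _ _ f B])
    show "?C \<in> sets lebesgue" by (simp add: open_positive_cone)
    show "x + axis i s \<in> ?C" if "x \<in> ?C" "?a i \<le> s" "s \<le> h" for x s i
      using that h by (intro positive_cone_shift[of x J h]) (auto simp: cone_lower_def axis_def)
    show "?a i \<le> h" for i using h by (simp add: cone_lower_def)
  qed
  then show "difference_operator J h f \<in> borel_measurable (lebesgue_on ?C)"
    unfolding difference_operator_def[abs_def] by (intro borel_measurable_divide) auto
  have "AE x in lebesgue_on ?C. \<bar>foldr (forward_diff ?a ?b) all_coords f x\<bar> \<le> 2 ^ length (all_coords :: 'n list) * B"
    using * by simp
  then show "AE x in lebesgue_on ?C. \<bar>difference_operator J h f x\<bar> \<le> 2 ^ card J / h ^ CARD('n) * B"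
  proof eventually_elim
    case (elim x)
    have "\<bar>difference_operator J h f x\<bar> = \<bar>foldr (forward_diff ?a ?b) all_coords f x\<bar> / ?V"
      using V by (simp add: difference_operator_def)
    also have "\<dots> \<le> (2 ^ CARD('n) * B) / ?V"
      using elim V by (intro divide_right_mono) (auto simp: length_all_coords)
    also have "\<dots> = 2 ^ card J / h ^ CARD('n) * B"
      by (simp add: prod_cone_lower power_mult_distrib)
    finally show ?case .
  qed
qed

lemma difference_operator_bounded:
  fixes J :: "'n::finite set"
  assumes h: "h > 0"
  defines "M \<equiv> lebesgue_on (positive_cone J)"
  shows "op_norm M (difference_operator J h) \<le> ereal (2 ^ card J / h ^ CARD('n))"
    and "difference_operator J h \<in> bounded_ops M"
proof -
  note bound = difference_operator_bound[OF h, of _ J, folded M_def]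
  show norm: "op_norm M (difference_operator J h) \<le> ereal (2 ^ card J / h ^ CARD('n))"
    unfolding op_norm_def
  proof (rule SUP_least)
    fix f assume f: "f \<in> {f \<in> Linf M. Linf_norm M f \<le> 1}"
    then have "AE x in M. \<bar>f x\<bar> \<le> 1" by (intro Linf_norm_AE) (simp add: one_ereal_def)
    with f show "Linf_norm M (difference_operator J h f) \<le> ereal (2 ^ card J / h ^ CARD('n))"
      using bound[of f 1] by (intro Linf_norm_leI) (auto simp: Linf_def)
  qed
  have Linf: "difference_operator J h f \<in> Linf M" if f: "f \<in> Linf M" for f
  proof -
    obtain B where "AE x in M. \<bar>f x\<bar> \<le> B" using Linf_AE_bound[OF f] by metis
    with bound[OF Linf_measurable[OF f] this] show ?thesis by (intro LinfI)
  qed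
  have AE: "AE x in M. difference_operator J h f x = difference_operator J h g x"
    if f: "f \<in> Linf M" and g: "g \<in> Linf M" and eq: "AE x in M. f x = g x" for f g
  proof -
    have "(\<lambda>x. f x + (- 1) * g x) \<in> borel_measurable M"
      using Linf_measurable[OF f] Linf_measurable[OF g] by simp
    moreover have "AE x in M. \<bar>f x + (- 1) * g x\<bar> \<le> 0" using eq by eventually_elim simp
    ultimately have "AE x in M. \<bar>difference_operator J h (\<lambda>x. f x + (- 1) * g x) x\<bar> \<le> 2 ^ card J / h ^ CARD('n) * 0"
      by (rule bound(2))
    then show ?thesis
      unfolding difference_operator_add difference_operator_cmult by eventually_elim simp
  qed
  show "difference_operator J h \<in> bounded_ops M"
    unfolding bounded_ops_def
    using Linf AE le_less_trans[OF norm, of \<infinity>] by (auto simp: difference_operator_add difference_operator_cmult)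
qed

section \<open>The function class\<close>

lemma has_distr_deriv_integrable: "has_distr_deriv C is f g \<Longrightarrow> locally_integrable C g"
  by (simp add: has_distr_deriv_def)

lemma has_distr_deriv_cong_AE:
  assumes C: "open C" and g: "has_distr_deriv C is g k" and g': "locally_integrable C g'" and eq: "AE x in lebesgue_on C. g' x = g x"
  shows "has_distr_deriv C is g' k"
  using g g' integral_AE_cong_test[OF C test_iterated_partial eq g']
  by (simp add: has_distr_deriv_iff[OF C])

text \<open>
  Membership provides some weak derivatives, whereas the norm condition concerns the chosen
  representatives. By uniqueness these agree almost everywhere, so the chosen representatives are weak
  derivatives as well.
\<close>

lemma extremal_classD:
  fixes C :: "(real^'n::finite) set"
  assumes C: "open C" and f: "f \<in> extremal_class C unit_cube"
  shows "f \<in> Linf (lebesgue_on C)"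
    and "has_distr_deriv C all_coords f (mixed_deriv C f)"
    and "has_distr_deriv C [i] (mixed_deriv C f) (distr_deriv C [i] (mixed_deriv C f))"
    and "AE x in lebesgue_on C. (\<Sum>i\<in>UNIV. \<bar>distr_deriv C [i] (mixed_deriv C f) x\<bar>) \<le> 1"
proof -
  show "f \<in> Linf (lebesgue_on C)" using f by (auto simp: extremal_class_def W_mixed_grad_def)
  obtain g where g: "g \<in> W1inf C" "has_distr_deriv C all_coords f g"
    using f by (auto simp: extremal_class_def W_mixed_grad_def)
  show m: "has_distr_deriv C all_coords f (mixed_deriv C f)"
    by (rule has_distr_deriv_distr_deriv[OF g(2)])
  have eq: "AE x in lebesgue_on C. mixed_deriv C f x = g x" by (rule distr_deriv_unique[OF C m g(2)])
  obtain k where "has_distr_deriv C [i] g k" using g(1) by (auto simp: W1inf_def)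
  then have "has_distr_deriv C [i] (mixed_deriv C f) k"
    by (rule has_distr_deriv_cong_AE[OF C _ has_distr_deriv_integrable[OF m] eq])
  then show "has_distr_deriv C [i] (mixed_deriv C f) (distr_deriv C [i] (mixed_deriv C f))"
    by (rule has_distr_deriv_distr_deriv)
  have "Linf_norm (lebesgue_on C) (\<lambda>x. set_gauge (polar_set unit_cube) (distr_gradient C (mixed_deriv C f) x)) \<le> ereal 1"
    using f by (simp add: extremal_class_def one_ereal_def)
  from Linf_norm_AE[OF this] show "AE x in lebesgue_on C. (\<Sum>i\<in>UNIV. \<bar>distr_deriv C [i] (mixed_deriv C f) x\<bar>) \<le> 1"
    by eventually_elim (simp add: set_gauge_polar_unit_cube distr_gradient_def)
qed

lemma extremal_class_mixed_deriv_measurable: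
  assumes C: "open C" and f: "f \<in> extremal_class C unit_cube"
  shows "mixed_deriv C f \<in> borel_measurable (lebesgue_on C)"
  by (rule locally_integrable_measurable[OF C has_distr_deriv_integrable[OF extremal_classD(2)[OF C f]]])

lemma extremal_classI:
  fixes C :: "(real^'n::finite) set"
  assumes C: "open C" and f: "f \<in> Linf (lebesgue_on C)" and g: "g \<in> Linf (lebesgue_on C)"
    and fg: "has_distr_deriv C all_coords f g"
    and k: "\<And>i. k i \<in> Linf (lebesgue_on C)" "\<And>i. has_distr_deriv C [i] g (k i)"
    and k1: "AE x in lebesgue_on C. (\<Sum>i\<in>UNIV. \<bar>k i x\<bar>) \<le> 1"
  shows "f \<in> extremal_class C unit_cube"
    and "AE x in lebesgue_on C. mixed_deriv C f x = g x"
proof -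
  have m: "has_distr_deriv C all_coords f (mixed_deriv C f)"
    by (rule has_distr_deriv_distr_deriv[OF fg])
  show eq: "AE x in lebesgue_on C. mixed_deriv C f x = g x" by (rule distr_deriv_unique[OF C m fg])
  let ?k = "\<lambda>i. distr_deriv C [i] (mixed_deriv C f)"
  have mk: "has_distr_deriv C [i] (mixed_deriv C f) (k i)" for i
    by (rule has_distr_deriv_cong_AE[OF C k(2) has_distr_deriv_integrable[OF m] eq])
  have mk': "has_distr_deriv C [i] (mixed_deriv C f) (?k i)" for i
    by (rule has_distr_deriv_distr_deriv[OF mk])
  have "AE x in lebesgue_on C. \<forall>i. ?k i x = k i x"
    unfolding AE_all_countable using distr_deriv_unique[OF C mk' mk] by blast
  then have AE: "AE x in lebesgue_on C. \<bar>set_gauge (polar_set unit_cube) (distr_gradient C (mixed_deriv C f) x)\<bar> \<le> 1"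
    using k1 by eventually_elim (simp add: set_gauge_polar_unit_cube distr_gradient_def sum_nonneg)
  have "?k i \<in> borel_measurable (lebesgue_on C)" for i
    by (rule locally_integrable_measurable[OF C has_distr_deriv_integrable[OF mk']])
  then have "(\<lambda>x. set_gauge (polar_set unit_cube) (distr_gradient C (mixed_deriv C f) x)) \<in> borel_measurable (lebesgue_on C)"
    by (simp add: set_gauge_polar_unit_cube distr_gradient_def)
  from Linf_norm_leI[OF this AE] show "f \<in> extremal_class C unit_cube"
    using f g fg k by (auto simp: extremal_class_def W_mixed_grad_def W1inf_def one_ereal_def)
qed

lemma pyramid_primitive_extremal:
  fixes J :: "'n::finite set"
  assumes h: "0 \<le> h"
  defines "C \<equiv> positive_cone J"
  shows "pyramid_primitive J h \<in> extremal_class C unit_cube"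
    and "AE x in lebesgue_on C. mixed_deriv C (pyramid_primitive J h) x = pyramid h x"
    and "AE x in lebesgue_on C. \<bar>pyramid_primitive J h x\<bar> \<le> h ^ (CARD('n) + 1) / (2 ^ card J * (real CARD('n) + 1))"
proof -
  have C: "open C" unfolding C_def by (rule open_positive_cone)
  have d: "has_distr_deriv C all_coords (pyramid_primitive J h) (pyramid h)"
    by (rule pyramid_primitive_mixed_deriv[OF C h])
  show b: "AE x in lebesgue_on C. \<bar>pyramid_primitive J h x\<bar> \<le> h ^ (CARD('n) + 1) / (2 ^ card J * (real CARD('n) + 1))"
  proof (rule AE_I2)
    fix x assume "x \<in> space (lebesgue_on C)"
    then have "x \<in> C" by (simp add: space_restrict_space)
    then show "\<bar>pyramid_primitive J h x\<bar> \<le> h ^ (CARD('n) + 1) / (2 ^ card J * (real CARD('n) + 1))"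
      by (intro pyramid_primitive_bound[OF h]) (auto simp: C_def positive_cone_def)
  qed
  have f: "pyramid_primitive J h \<in> Linf (lebesgue_on C)"
    using d locally_integrable_measurable[OF C] b by (intro LinfI) (auto simp: has_distr_deriv_def)
  have g: "pyramid h \<in> Linf (lebesgue_on C)"
    by (intro LinfI[of _ _ h] measurable_restrict_space1 pyramid_measurable AE_I2)
      (simp add: abs_le_iff pyramid_bounds[OF h] order_trans[OF _ pyramid_bounds(1)[OF h]] h)
  have k: "pyramid_slope h i \<in> Linf (lebesgue_on C)" for i
    by (intro LinfI[of _ _ 1] measurable_restrict_space1 pyramid_measurable AE_I2)
      (auto simp: pyramid_slope_def sgn_if)
  note ext = extremal_classI[OF C f g d k pyramid_weak_deriv[OF C h] AE_I2[OF pyramid_slope_sum]]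
  show "pyramid_primitive J h \<in> extremal_class C unit_cube" by (rule ext(1))
  show "AE x in lebesgue_on C. mixed_deriv C (pyramid_primitive J h) x = pyramid h x" by (rule ext(2))
qed

text \<open>
  If \<open>c < h\<close>, then the pyramid exceeds \<open>c\<close> on the open box \<open>(0, h - c)\<^sup>d\<close>, which lies in the cone and has
  positive measure.
\<close>

lemma pyramid_essential_height:
  fixes J :: "'n::finite set"
  assumes "AE x in lebesgue_on (positive_cone J). \<bar>pyramid h x\<bar> \<le> c"
  shows "h \<le> c"
proof (rule ccontr)
  assume "\<not> h \<le> c"
  then have c: "c < h" by simp
  let ?O = "box 0 (\<chi> i. h - c) :: (real^'n) set"
  have ne: "?O \<noteq> {}"
    using c by (auto simp: interval_ne_empty_cart)
  have "AE x in lebesgue. x \<in> positive_cone J \<longrightarrow> \<bar>pyramid h x\<bar> \<le> c"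
    using assms by (simp add: AE_lebesgue_on_iff open_positive_cone)
  then have "AE x in lebesgue. x \<notin> ?O"
  proof eventually_elim
    case (elim x)
    show ?case
    proof
      assume x: "x \<in> ?O"
      then have "x \<in> positive_cone J" by (auto simp: positive_cone_def mem_box_cart)
      moreover have "max_coord x < h - c"
        using x by (auto simp: max_coord_less_iff mem_box_cart abs_less_iff) (smt (verit) zero_index)
      ultimately show False using elim by (auto simp: pyramid_def)
    qed
  qed
  then have "?O \<in> null_sets lebesgue"
    by (subst AE_iff_null_sets) auto
  then have "negligible ?O" by (simp add: negligible_iff_null_sets)
  then show False using open_not_negligible[OF open_box ne] by simp
qed

lemma Linf_norm_geI:
  assumes "\<And>c. AE x in M. \<bar>f x\<bar> \<le> c \<Longrightarrow> b \<le> c"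
  shows "ereal b \<le> Linf_norm M f"
proof (rule ccontr)
  assume "\<not> ereal b \<le> Linf_norm M f"
  then obtain c where c: "Linf_norm M f < ereal c" "ereal c < ereal b"
    using ereal_dense2[of "Linf_norm M f" "ereal b"] by (auto simp: not_le)
  then have "AE x in M. \<bar>f x\<bar> \<le> c" by (intro Linf_norm_AE) simp
  from assms[OF this] c(2) show False by simp
qed

lemma extremal_class_error:
  fixes J :: "'n::finite set"
  assumes h: "h > 0" and f: "f \<in> extremal_class (positive_cone J) unit_cube"
  shows "AE x in lebesgue_on (positive_cone J). \<bar>mixed_deriv (positive_cone J) f x - difference_operator J h f x\<bar>
    \<le> h * real CARD('n) / (real CARD('n) + 1)"
  unfolding difference_operator_def
  using mixed_difference_error[OF h open_positive_cone _ extremal_classD(1,2)[OF open_positive_cone f]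
      extremal_classD(3)[OF open_positive_cone f] extremal_classD(4)[OF open_positive_cone f], of J]
    positive_cone_shift[of _ J h]
  unfolding cone_lower_def by blast

text \<open>
  The operator norm only sees the unit ball; the general case follows by scaling.
\<close>

lemma bounded_ops_AE_bound:
  assumes S: "S \<in> bounded_ops M" "op_norm M S \<le> ereal N" and f: "f \<in> borel_measurable M" "AE x in M. \<bar>f x\<bar> \<le> \<delta>"
    and \<delta>: "\<delta> > 0"
  shows "AE x in M. \<bar>S f x\<bar> \<le> N * \<delta>"
proof -
  define f1 where "f1 y = 1 / \<delta> * f y" for y
  have b: "AE x in M. \<bar>f1 x\<bar> \<le> 1"
    using f(2) by eventually_elim (use \<delta> in \<open>simp add: f1_def abs_mult divide_le_eq\<close>)
  have m: "f1 \<in> borel_measurable M" using f(1) by (simp add: f1_def[abs_def])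
  have f1: "f1 \<in> Linf M" "Linf_norm M f1 \<le> 1"
    using LinfI[OF m b] Linf_norm_leI[OF m b] by (auto simp: one_ereal_def)
  then have "Linf_norm M (S f1) \<le> op_norm M S" unfolding op_norm_def by (intro SUP_upper) auto
  then have "AE x in M. \<bar>S f1 x\<bar> \<le> N" using S(2) by (intro Linf_norm_AE) (rule order_trans)
  moreover have "AE x in M. S (\<lambda>y. \<delta> * f1 y) x = \<delta> * S f1 x"
    using S(1) f1(1) by (auto simp: bounded_ops_def)
  ultimately have "AE x in M. \<bar>S (\<lambda>y. \<delta> * f1 y) x\<bar> \<le> N * \<delta>"
    by eventually_elim (use \<delta> in \<open>simp add: abs_mult mult.commute\<close>)
  moreover have "(\<lambda>y. \<delta> * f1 y) = f" using \<delta> by (auto simp: f1_def)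
  ultimately show ?thesis by simp
qed

text \<open>
  If \<open>f\<close> has norm at most \<open>\<delta>\<close>, then the zero function is an admissible observation of it. A linear operator
  sends this observation to zero, so its error on \<open>f\<close> is the full norm of \<open>A f\<close>.
\<close>

lemma modulus_le_optimal_recovery:
  assumes A: "\<And>f. f \<in> \<MM> \<Longrightarrow> A f \<in> borel_measurable M"
  shows "modulus_of_continuity M A \<MM> \<delta> \<le> optimal_recovery M A \<MM> (bounded_ops M) \<delta>"
  unfolding modulus_of_continuity_def optimal_recovery_def
proof (intro INF_greatest SUP_least)
  fix S f assume S: "S \<in> bounded_ops M" and f: "f \<in> {f \<in> \<MM>. Linf_norm M f \<le> ereal \<delta>}"
  let ?E = "SUP (f, \<eta>)\<in>{(f, \<eta>). f \<in> \<MM> \<and> \<eta> \<in> Linf M \<and> Linf_norm M (\<lambda>x. f x - \<eta> x) \<le> ereal \<delta>}.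
    Linf_norm M (\<lambda>x. A f x - S \<eta> x)"
  have z: "(\<lambda>_. 0) \<in> Linf M" by (rule LinfI[of _ _ 0]) auto
  have "\<And>c f. f \<in> Linf M \<Longrightarrow> AE x in M. S (\<lambda>y. c * f y) x = c * S f x"
    using S by (auto simp: bounded_ops_def)
  from this[OF z, of 0] have S0: "AE x in M. S (\<lambda>_. 0) x = 0" by simp
  have Sm: "S (\<lambda>_. 0) \<in> borel_measurable M"
    using S z by (auto simp: bounded_ops_def Linf_def)
  have "Linf_norm M (A f) = Linf_norm M (\<lambda>x. A f x - S (\<lambda>_. 0) x)"
    using f A Sm S0 by (intro Linf_norm_cong_AE) (auto elim: eventually_mono)
  also have "\<dots> \<le> ?E"
    using f z by (intro SUP_upper2[of "(f, \<lambda>_. 0)"]) auto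
  finally show "Linf_norm M (A f) \<le> ?E" .
qed

section \<open>The exact values\<close>

text \<open>
  The error of the difference operator splits into its approximation error on \<open>f\<close> and its norm times
  the error \<open>\<delta>\<close> of the observation.
\<close>

lemma optimal_recovery_le:
  fixes J :: "'n::finite set"
  assumes h: "h > 0"
  defines "C \<equiv> positive_cone J"
  shows "optimal_recovery (lebesgue_on C) (mixed_deriv C) (extremal_class C unit_cube) (bounded_ops (lebesgue_on C)) \<delta>
    \<le> ereal (h * real CARD('n) / (real CARD('n) + 1) + 2 ^ card J / h ^ CARD('n) * \<delta>)"
  unfolding optimal_recovery_def
proof (rule INF_lower2[of "difference_operator J h"])
  let ?M = "lebesgue_on C" and ?S = "difference_operator J h"
  let ?b = "h * real CARD('n) / (real CARD('n) + 1) + 2 ^ card J / h ^ CARD('n) * \<delta>"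
  show S: "?S \<in> bounded_ops ?M" unfolding C_def by (rule difference_operator_bounded[OF h])
  have C: "open C" unfolding C_def by (rule open_positive_cone)
  show "(SUP (f, \<eta>)\<in>{(f, \<eta>). f \<in> extremal_class C unit_cube \<and> \<eta> \<in> Linf ?M \<and> Linf_norm ?M (\<lambda>x. f x - \<eta> x) \<le> ereal \<delta>}.
      Linf_norm ?M (\<lambda>x. mixed_deriv C f x - ?S \<eta> x))
    \<le> ereal ?b"
  proof (rule SUP_least, clarify)
    fix f \<eta> assume f: "f \<in> extremal_class C unit_cube" and \<eta>: "\<eta> \<in> Linf ?M"
      and d: "Linf_norm ?M (\<lambda>x. f x - \<eta> x) \<le> ereal \<delta>"
    have fl: "f \<in> Linf ?M" by (rule extremal_classD(1)[OF C f])
    have "?S \<eta> \<in> Linf ?M" using S \<eta> by (auto simp: bounded_ops_def)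
    then have m: "(\<lambda>x. mixed_deriv C f x - ?S \<eta> x) \<in> borel_measurable ?M"
      by (intro borel_measurable_diff extremal_class_mixed_deriv_measurable[OF C f] Linf_measurable)
    have e: "AE x in ?M. \<bar>mixed_deriv C f x - ?S f x\<bar> \<le> h * real CARD('n) / (real CARD('n) + 1)"
      using extremal_class_error[OF h] f unfolding C_def by blast
    have "(\<lambda>x. f x + (- 1) * \<eta> x) \<in> borel_measurable ?M"
      using Linf_measurable[OF fl] Linf_measurable[OF \<eta>] by simp
    moreover have "AE x in ?M. \<bar>f x + (- 1) * \<eta> x\<bar> \<le> \<delta>"
      using Linf_norm_AE[OF d] by simp
    ultimately have "AE x in ?M. \<bar>?S (\<lambda>x. f x + (- 1) * \<eta> x) x\<bar> \<le> 2 ^ card J / h ^ CARD('n) * \<delta>"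
      unfolding C_def by (rule difference_operator_bound(2)[OF h])
    then have "AE x in ?M. \<bar>?S f x - ?S \<eta> x\<bar> \<le> 2 ^ card J / h ^ CARD('n) * \<delta>"
      unfolding difference_operator_add difference_operator_cmult by simp
    with e have "AE x in ?M. \<bar>mixed_deriv C f x - ?S \<eta> x\<bar> \<le> ?b"
      by eventually_elim linarith
    then show "Linf_norm ?M (\<lambda>x. mixed_deriv C f x - ?S \<eta> x)
      \<le> ereal ?b"
      by (rule Linf_norm_leI[OF m])
  qed
qed

lemma modulus_ge:
  fixes J :: "'n::finite set"
  assumes h: "h \<ge> 0" and \<delta>: "h ^ (CARD('n) + 1) / (2 ^ card J * (real CARD('n) + 1)) \<le> \<delta>"
  defines "C \<equiv> positive_cone J"
  shows "ereal h \<le> modulus_of_continuity (lebesgue_on C) (mixed_deriv C) (extremal_class C unit_cube) \<delta>"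
  unfolding modulus_of_continuity_def
proof (rule SUP_upper2[of "pyramid_primitive J h"])
  have C: "open C" unfolding C_def by (rule open_positive_cone)
  note ext = pyramid_primitive_extremal[OF h, of J, folded C_def]
  have "Linf_norm (lebesgue_on C) (pyramid_primitive J h) \<le> ereal (h ^ (CARD('n) + 1) / (2 ^ card J * (real CARD('n) + 1)))"
    by (rule Linf_norm_leI[OF Linf_measurable[OF extremal_classD(1)[OF C ext(1)]] ext(3)])
  also have "\<dots> \<le> ereal \<delta>" using \<delta> by simp
  finally show "pyramid_primitive J h \<in> {f \<in> extremal_class C unit_cube. Linf_norm (lebesgue_on C) f \<le> ereal \<delta>}"
    using ext(1) by simp
  show "ereal h \<le> Linf_norm (lebesgue_on C) (mixed_deriv C (pyramid_primitive J h))"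
  proof (rule Linf_norm_geI)
    fix c assume "AE x in lebesgue_on C. \<bar>mixed_deriv C (pyramid_primitive J h) x\<bar> \<le> c"
    with ext(2) have "AE x in lebesgue_on C. \<bar>pyramid h x\<bar> \<le> c" by eventually_elim simp
    then show "h \<le> c" unfolding C_def by (rule pyramid_essential_height)
  qed
qed

lemma best_approximation_le:
  fixes J :: "'n::finite set"
  assumes h: "h > 0" and N: "2 ^ card J / h ^ CARD('n) \<le> N"
  defines "C \<equiv> positive_cone J"
  shows "best_approximation (lebesgue_on C) (mixed_deriv C) (extremal_class C unit_cube) N
    \<le> ereal (h * real CARD('n) / (real CARD('n) + 1))"
  unfolding best_approximation_def
proof (rule INF_lower2[of "difference_operator J h"])
  let ?M = "lebesgue_on C" and ?S = "difference_operator J h"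
  have C: "open C" unfolding C_def by (rule open_positive_cone)
  note S = difference_operator_bounded[OF h, of J, folded C_def]
  have "op_norm ?M ?S \<le> ereal N" using S(1) N by (meson ereal_less_eq(3) order_trans)
  then show "?S \<in> {S \<in> bounded_ops ?M. op_norm ?M S \<le> ereal N}" using S(2) by simp
  show "(SUP f\<in>extremal_class C unit_cube. Linf_norm ?M (\<lambda>x. mixed_deriv C f x - ?S f x))
    \<le> ereal (h * real CARD('n) / (real CARD('n) + 1))"
  proof (rule SUP_least)
    fix f assume f: "f \<in> extremal_class C unit_cube"
    have "?S f \<in> Linf ?M" using S(2) extremal_classD(1)[OF C f] by (auto simp: bounded_ops_def)
    then have "(\<lambda>x. mixed_deriv C f x - ?S f x) \<in> borel_measurable ?M"
      by (intro borel_measurable_diff extremal_class_mixed_deriv_measurable[OF C f] Linf_measurable)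
    then show "Linf_norm ?M (\<lambda>x. mixed_deriv C f x - ?S f x) \<le> ereal (h * real CARD('n) / (real CARD('n) + 1))"
      using extremal_class_error[OF h] f unfolding C_def by (intro Linf_norm_leI) auto
  qed
qed

text \<open>
  An operator of norm at most \<open>N\<close> maps the primitive of the pyramid to a function of norm at most \<open>N \<delta>\<close>,
  which cannot compensate the height \<open>h\<close> of the pyramid.
\<close>

lemma best_approximation_ge:
  fixes J :: "'n::finite set"
  assumes h: "h > 0"
  defines "C \<equiv> positive_cone J" and "\<delta> \<equiv> h ^ (CARD('n) + 1) / (2 ^ card J * (real CARD('n) + 1))"
  shows "ereal (h - N * \<delta>) \<le> best_approximation (lebesgue_on C) (mixed_deriv C) (extremal_class C unit_cube) N"
  unfolding best_approximation_def
proof (rule INF_greatest)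
  let ?M = "lebesgue_on C" and ?f = "pyramid_primitive J h"
  fix S assume S: "S \<in> {S \<in> bounded_ops ?M. op_norm ?M S \<le> ereal N}"
  have C: "open C" unfolding C_def by (rule open_positive_cone)
  have \<delta>: "\<delta> > 0" using h by (simp add: \<delta>_def)
  note ext = pyramid_primitive_extremal[OF less_imp_le[OF h], of J, folded C_def \<delta>_def]
  have Sf: "AE x in ?M. \<bar>S ?f x\<bar> \<le> N * \<delta>"
    using S \<delta> ext(3) Linf_measurable[OF extremal_classD(1)[OF C ext(1)]] by (intro bounded_ops_AE_bound) auto
  have "ereal (h - N * \<delta>) \<le> Linf_norm ?M (\<lambda>x. mixed_deriv C ?f x - S ?f x)"
  proof (rule Linf_norm_geI)
    fix c assume "AE x in ?M. \<bar>mixed_deriv C ?f x - S ?f x\<bar> \<le> c"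
    with ext(2) Sf have "AE x in ?M. \<bar>pyramid h x\<bar> \<le> c + N * \<delta>" by eventually_elim linarith
    then have "h \<le> c + N * \<delta>" unfolding C_def by (rule pyramid_essential_height)
    then show "h - N * \<delta> \<le> c" by simp
  qed
  also have "\<dots> \<le> (SUP f\<in>extremal_class C unit_cube. Linf_norm ?M (\<lambda>x. mixed_deriv C f x - S f x))"
    using ext(1) by (intro SUP_upper)
  finally show "ereal (h - N * \<delta>) \<le> (SUP f\<in>extremal_class C unit_cube. Linf_norm ?M (\<lambda>x. mixed_deriv C f x - S f x))" .
qed

theorem theorem6:
  fixes J :: "'n::finite set" and C K :: "(real^'n) set"
    and \<MM> :: "(real^'n \<Rightarrow> real) set" and d m :: nat and \<delta> N :: real
  assumes d: "d = CARD('n)"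
    and m: "m \<in> {0, 1}" "card J = m"
    and C: "C = positive_cone J"
    and K: "K = unit_cube"
    and M: "\<MM> = extremal_class C K"
    and \<delta>: "\<delta> > 0" and N: "N > 0"
  shows "optimal_recovery (lebesgue_on C) (mixed_deriv C) \<MM> (bounded_ops (lebesgue_on C)) \<delta>
           = modulus_of_continuity (lebesgue_on C) (mixed_deriv C) \<MM> \<delta>
       \<and> modulus_of_continuity (lebesgue_on C) (mixed_deriv C) \<MM> \<delta>
           = ereal ((2 ^ m * (real d + 1) * \<delta>) powr (1 / (real d + 1)))
       \<and> best_approximation (lebesgue_on C) (mixed_deriv C) \<MM> N
           = ereal (real d / (real d + 1) * (2 ^ m / N) powr (1 / real d))"
proof -
  have d0: "d > 0" by (simp add: d)
  \<comment> \<open>This value of \<open>h\<close> minimises \<open>h d / (d + 1) + 2\<^sup>m \<delta> / h\<^sup>d\<close>, and the minimum is \<open>h\<close> itself.\<close>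
  define h where "h = (2 ^ m * (real d + 1) * \<delta>) powr (1 / (real d + 1))"
  have h: "h > 0" using \<delta> by (simp add: h_def)
  have hp: "h ^ (d + 1) = 2 ^ m * (real d + 1) * \<delta>"
  proof -
    have "h ^ (d + 1) = h powr real (d + 1)" by (rule powr_realpow[OF h, symmetric])
    also have "\<dots> = 2 ^ m * (real d + 1) * \<delta>" using \<delta> by (simp add: h_def powr_powr add.commute)
    finally show ?thesis .
  qed
  have "h * real d / (real d + 1) + 2 ^ m / h ^ d * \<delta> = h"
  proof -
    have "2 ^ m * \<delta> = h ^ d * h / (real d + 1)" using hp by (simp add: field_simps)
    then have "2 ^ m / h ^ d * \<delta> = h / (real d + 1)" using h by (simp add: field_simps)
    then have "h * real d / (real d + 1) + 2 ^ m / h ^ d * \<delta> = (h * real d + h) / (real d + 1)"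
      by (simp add: add_divide_distrib)
    then show ?thesis by (simp add: field_simps)
  qed
  then have up: "optimal_recovery (lebesgue_on C) (mixed_deriv C) \<MM> (bounded_ops (lebesgue_on C)) \<delta> \<le> ereal h"
    using optimal_recovery_le[OF h, of J \<delta>] by (simp add: M K C d m(2))
  have mid: "modulus_of_continuity (lebesgue_on C) (mixed_deriv C) \<MM> \<delta>
      \<le> optimal_recovery (lebesgue_on C) (mixed_deriv C) \<MM> (bounded_ops (lebesgue_on C)) \<delta>"
    unfolding M K C
    by (intro modulus_le_optimal_recovery extremal_class_mixed_deriv_measurable open_positive_cone)
  have "h ^ (d + 1) / (2 ^ m * (real d + 1)) = \<delta>"
    unfolding hp by (rule nonzero_mult_div_cancel_left) (simp add: add_nonneg_eq_0_iff)
  then have low: "ereal h \<le> modulus_of_continuity (lebesgue_on C) (mixed_deriv C) \<MM> \<delta>"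
    using modulus_ge[OF less_imp_le[OF h], of J \<delta>] by (simp add: M K C d m(2))
  \<comment> \<open>The step for which the norm bound \<open>2\<^sup>m / k\<^sup>d\<close> of the difference operator equals \<open>N\<close>.\<close>
  define k where "k = (2 ^ m / N) powr (1 / real d)"
  have k: "k > 0" using N by (simp add: k_def)
  have kp: "k ^ d = 2 ^ m / N"
  proof -
    have "k ^ d = k powr real d" using k by (simp add: powr_realpow)
    also have "\<dots> = 2 ^ m / N" using N d0 by (simp add: k_def powr_powr)
    finally show ?thesis .
  qed
  have "2 ^ m / k ^ d = N" using kp N by simp
  then have bup: "best_approximation (lebesgue_on C) (mixed_deriv C) \<MM> N \<le> ereal (k * real d / (real d + 1))"
    using best_approximation_le[OF k, of J N] by (simp add: M K C d m(2))
  have "N * k ^ (d + 1) = 2 ^ m * k" using kp N by simp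
  then have "N * (k ^ (d + 1) / (2 ^ m * (real d + 1))) = k / (real d + 1)"
    by (simp only: times_divide_eq_right) simp
  then have "k - N * (k ^ (d + 1) / (2 ^ m * (real d + 1))) = k - k / (real d + 1)" by simp
  also have "\<dots> = k * real d / (real d + 1)" by (simp add: field_simps)
  finally have "ereal (k * real d / (real d + 1)) \<le> best_approximation (lebesgue_on C) (mixed_deriv C) \<MM> N"
    using best_approximation_ge[OF k, of N J] by (simp add: M K C d m(2))
  with bup have "best_approximation (lebesgue_on C) (mixed_deriv C) \<MM> N = ereal (real d / (real d + 1) * k)"
    by (simp add: antisym mult.commute)
  moreover have "modulus_of_continuity (lebesgue_on C) (mixed_deriv C) \<MM> \<delta> = ereal h"
    by (rule antisym[OF order_trans[OF mid up] low])
  moreover from this have "optimal_recovery (lebesgue_on C) (mixed_deriv C) \<MM> (bounded_ops (lebesgue_on C)) \<delta>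
      = modulus_of_continuity (lebesgue_on C) (mixed_deriv C) \<MM> \<delta>"
    using up mid by (simp add: antisym)
  ultimately show ?thesis by (simp only: h_def k_def simp_thms)
qed

end
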